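(* Let $(\mathscr M,g)$ be a perfect-fluid space-time of dimension $n\ge4$, i.e. a Lorentzian manifold satisfying Einstein's equations $$R_{ij}-\tfrac12 R\,g_{ij}=\kappa T_{ij},\qquad T_{ij}=p\,g_{ij}+(p+\mu)\,u_iu_j,$$ with velocity vector field $u$, $u^ju_j=-1$, isotropic pressure $p$ and energy density $\mu$. Assume that there is a differentiable equation of state $p=p(\mu)$, that $p+\mu\neq0$ (everywhere), and that the Weyl tensor has null divergence, $\nabla_mC_{jkl}{}^m=0$. Then $\mathscr M$ is a generalized Robertson-Walker space-time. Moreover the velocity vector field is irrotational ($\nabla_ku_l-\nabla_lu_k=0$), geodesic ($u^k\nabla_ku_j=0$), and it annihilates the Weyl tensor ($C_{jkl}{}^mu_m=0$).
   Context: Lorentzian metrics have signature $(-,+,\dots,+)$, $\nabla$ is the Levi-Civita connection, $R_{ij}$ the Ricci tensor (standard sign convention), $R=g^{ij}R_{ij}$ the scalar curvature, $C_{jklm}$ the Weyl conformal curvature tensor. $\kappa=8\pi G>0$ is the gravitational constant (units with $c=1$). $p$ and $\mu$ are smooth scalar fields, and $u$ is a smooth vector field, identified with a 1-form through $g$. An $n$-dimensional Lorentzian manifold is a generalized Robertson-Walker (GRW) space-time if locally (around each point there are coordinates $(t,x_2,\dots,x_n)$ in which) the metric takes the form $$ds^2=-dt^2+q(t)^2\,g^*_{\alpha\beta}(x_2,\dots,x_n)\,dx^\alpha dx^\beta,\qquad \alpha,\beta=2,\dots,n,$$ with $q$ a smooth positive function and $g^*$ a Riemannian metric; i.e. it is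 locally a warped product $(-1)\times q^2\mathscr M^*$ with $(\mathscr M^*,g^* )$ an $(n-1)$-dimensional Riemannian manifold. *)

theory Defs
  imports "HOL-Analysis.Analysis"
begin

section \<open>Smooth maps between open subsets of normed spaces\<close>

text \<open>Meant for open \<open>S\<close> only, and used only there.\<close>

primrec Ck_on :: "nat \<Rightarrow> ('e::real_normed_vector \<Rightarrow> 'f::real_normed_vector) \<Rightarrow> 'e set \<Rightarrow> bool" where
  "Ck_on 0 f S \<longleftrightarrow> continuous_on S f"
| "Ck_on (Suc k) f S \<longleftrightarrow>
     (\<forall>x\<in>S. f differentiable (at x)) \<and>
     (\<forall>v. Ck_on k (\<lambda>x. frechet_derivative f (at x) v) S)"

definition smooth_on :: "('e::real_normed_vector \<Rightarrow> 'f::real_normed_vector) \<Rightarrow> 'e set \<Rightarrow> bool" where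
  "smooth_on f S \<longleftrightarrow> (\<forall>k. Ck_on k f S)"


section \<open>Smooth manifolds of dimension \<open>CARD('n)\<close>\<close>

text \<open>A chart is a pair of its domain and its coordinate map; the values of the coordinate map
  outside the domain are irrelevant.\<close>

type_synonym ('a, 'n) chart = "'a set \<times> ('a \<Rightarrow> real ^ 'n)"

abbreviation chart_dom :: "('a, 'n) chart \<Rightarrow> 'a set" where
  "chart_dom c \<equiv> fst c"

abbreviation chart_map :: "('a, 'n) chart \<Rightarrow> 'a \<Rightarrow> real ^ 'n" where
  "chart_map c \<equiv> snd c"

definition chart_img :: "('a, 'n) chart \<Rightarrow> (real ^ 'n) set" where
  "chart_img c = chart_map c ` chart_dom c"

definition chart_inv :: "('a, 'n) chart \<Rightarrow> real ^ 'n \<Rightarrow> 'a" where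
  "chart_inv c = inv_into (chart_dom c) (chart_map c)"

definition is_chart :: "'a topology \<Rightarrow> ('a, 'n::finite) chart \<Rightarrow> bool" where
  "is_chart X c \<longleftrightarrow>
     openin X (chart_dom c) \<and> open (chart_img c) \<and>
     homeomorphic_map (subtopology X (chart_dom c)) (top_of_set (chart_img c)) (chart_map c)"

definition compatible :: "('a, 'n::finite) chart \<Rightarrow> ('a, 'n) chart \<Rightarrow> bool" where
  "compatible c d \<longleftrightarrow>
     smooth_on (chart_map d \<circ> chart_inv c) (chart_map c ` (chart_dom c \<inter> chart_dom d)) \<and>
     smooth_on (chart_map c \<circ> chart_inv d) (chart_map d ` (chart_dom c \<inter> chart_dom d))"

definition smooth_atlas :: "'a topology \<Rightarrow> ('a, 'n::finite) chart set \<Rightarrow> bool" where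
  "smooth_atlas X A \<longleftrightarrow>
     (\<forall>c\<in>A. is_chart X c) \<and> (\<Union>c\<in>A. chart_dom c) = topspace X \<and>
     (\<forall>c\<in>A. \<forall>d\<in>A. compatible c d)"

definition smooth_manifold :: "'a topology \<Rightarrow> ('a, 'n::finite) chart set \<Rightarrow> bool" where
  "smooth_manifold X A \<longleftrightarrow> Hausdorff_space X \<and> second_countable X \<and> smooth_atlas X A"

text \<open>The maximal atlas determined by \<open>A\<close>: its members are all the coordinate systems of the
  manifold.\<close>

definition charts :: "'a topology \<Rightarrow> ('a, 'n::finite) chart set \<Rightarrow> ('a, 'n) chart set" where
  "charts X A = {c. is_chart X c \<and> (\<forall>a\<in>A. compatible c a)}"


section \<open>Fields\<close>

text \<open>The coordinate derivative \<open>\<partial>\<^sub>i f\<close> in the chart \<open>c\<close>, at the point \<open>x\<close> of the manifold.\<close>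

definition pd :: "('a, 'n::finite) chart \<Rightarrow> 'n \<Rightarrow> ('a \<Rightarrow> real) \<Rightarrow> 'a \<Rightarrow> real" where
  "pd c i f x = frechet_derivative (f \<circ> chart_inv c) (at (chart_map c x)) (axis i 1)"

definition smooth_in_chart :: "('a, 'n::finite) chart \<Rightarrow> ('a \<Rightarrow> 'f::real_normed_vector) \<Rightarrow> bool" where
  "smooth_in_chart c f \<longleftrightarrow> smooth_on (f \<circ> chart_inv c) (chart_img c)"

definition smooth_scalar_field ::
  "'a topology \<Rightarrow> ('a, 'n::finite) chart set \<Rightarrow> ('a \<Rightarrow> real) \<Rightarrow> bool" where
  "smooth_scalar_field X A f \<longleftrightarrow> (\<forall>c\<in>charts X A. smooth_in_chart c f)"

text \<open>Tensor fields are given by their components in every chart of the maximal atlas, as functions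
  of the point of the manifold, subject to the usual transformation laws.  With \<open>x\<close> the coordinates
  of \<open>c\<close> and \<open>y\<close> those of \<open>d\<close>, the entry in row \<open>a\<close>, column \<open>i\<close> of \<open>jacobian c d\<close> is
  \<open>\<partial>y\<^sup>a / \<partial>x\<^sup>i\<close>.\<close>

definition jacobian :: "('a, 'n::finite) chart \<Rightarrow> ('a, 'n) chart \<Rightarrow> 'a \<Rightarrow> real ^ 'n ^ 'n" where
  "jacobian c d x = (\<chi> a i. pd c i (\<lambda>z. chart_map d z $ a) x)"

type_synonym ('a, 'n) vector_field = "('a, 'n) chart \<Rightarrow> 'a \<Rightarrow> real ^ 'n"
type_synonym ('a, 'n) bilinear_field = "('a, 'n) chart \<Rightarrow> 'a \<Rightarrow> real ^ 'n ^ 'n"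

definition smooth_vector_field ::
  "'a topology \<Rightarrow> ('a, 'n::finite) chart set \<Rightarrow> ('a, 'n) vector_field \<Rightarrow> bool" where
  "smooth_vector_field X A u \<longleftrightarrow>
     (\<forall>c\<in>charts X A. smooth_in_chart c (u c)) \<and>
     (\<forall>c\<in>charts X A. \<forall>d\<in>charts X A. \<forall>x\<in>chart_dom c \<inter> chart_dom d.
        u d x = jacobian c d x *v u c x)"

text \<open>Signature \<open>(-,+,\<dots>,+)\<close>: there is a pseudo-orthonormal frame (the columns of \<open>P\<close>) with exactly
  one timelike member.\<close>

definition lorentzian_signature :: "real ^ 'n ^ 'n::finite \<Rightarrow> bool" where
  "lorentzian_signature G \<longleftrightarrow>
     (\<exists>(P::real ^ 'n ^ 'n) t. invertible P \<and>
        transpose P ** G ** P = (\<chi> i j. if i \<noteq> j then 0 else if i = t then -1 else 1))"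

definition lorentzian_manifold ::
  "'a topology \<Rightarrow> ('a, 'n::finite) chart set \<Rightarrow> ('a, 'n) bilinear_field \<Rightarrow> bool" where
  "lorentzian_manifold X A g \<longleftrightarrow>
     smooth_manifold X A \<and>
     (\<forall>c\<in>charts X A. smooth_in_chart c (g c) \<and>
        (\<forall>x\<in>chart_dom c. transpose (g c x) = g c x \<and> lorentzian_signature (g c x))) \<and>
     (\<forall>c\<in>charts X A. \<forall>d\<in>charts X A. \<forall>x\<in>chart_dom c \<inter> chart_dom d.
        g c x = transpose (jacobian c d x) ** g d x ** jacobian c d x)"


section \<open>Levi-Civita connection and curvature, in components\<close>

definition ginv :: "('a, 'n::finite) bilinear_field \<Rightarrow> ('a, 'n) bilinear_field" where
  "ginv g c x = matrix_inv (g c x)"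

text \<open>The 1-form \<open>u\<^sub>i = g\<^sub>i\<^sub>j u\<^sup>j\<close>.\<close>

definition flat ::
  "('a, 'n::finite) bilinear_field \<Rightarrow> ('a, 'n) vector_field \<Rightarrow> ('a, 'n) vector_field" where
  "flat g u c x = g c x *v u c x"

text \<open>\<open>christoffel g c k i j\<close> is \<open>\<Gamma>\<^sup>k\<^sub>i\<^sub>j\<close>.\<close>

definition christoffel ::
  "('a, 'n::finite) bilinear_field \<Rightarrow> ('a, 'n) chart \<Rightarrow> 'n \<Rightarrow> 'n \<Rightarrow> 'n \<Rightarrow> 'a \<Rightarrow> real" where
  "christoffel g c k i j x =
     (\<Sum>l\<in>UNIV. ginv g c x $ k $ l *
        (pd c i (\<lambda>z. g c z $ j $ l) x + pd c j (\<lambda>z. g c z $ i $ l) x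
          - pd c l (\<lambda>z. g c z $ i $ j) x)) / 2"

text \<open>\<open>nabla_form g c w k l\<close> is \<open>\<nabla>\<^sub>k w\<^sub>l\<close> for a 1-form \<open>w\<close>.\<close>

definition nabla_form ::
  "('a, 'n::finite) bilinear_field \<Rightarrow> ('a, 'n) chart \<Rightarrow> ('a, 'n) vector_field
    \<Rightarrow> 'n \<Rightarrow> 'n \<Rightarrow> 'a \<Rightarrow> real" where
  "nabla_form g c w k l x =
     pd c k (\<lambda>z. w c z $ l) x - (\<Sum>s\<in>UNIV. christoffel g c s k l x * w c x $ s)"

text \<open>\<open>riemann g c j k l m\<close> is \<open>R\<^sub>j\<^sub>k\<^sub>l\<^sub>m\<close>, where
  \<open>R\<^sup>e\<^sub>k\<^sub>l\<^sub>m = \<partial>\<^sub>l \<Gamma>\<^sup>e\<^sub>m\<^sub>k - \<partial>\<^sub>m \<Gamma>\<^sup>e\<^sub>l\<^sub>k + \<Gamma>\<^sup>e\<^sub>l\<^sub>s \<Gamma>\<^sup>s\<^sub>m\<^sub>k - \<Gamma>\<^sup>e\<^sub>m\<^sub>s \<Gamma>\<^sup>s\<^sub>l\<^sub>k\<close>.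
  The Ricci tensor is \<open>R\<^sub>k\<^sub>m = R\<^sup>l\<^sub>k\<^sub>l\<^sub>m\<close>, which is positive on round spheres.\<close>

definition riemann ::
  "('a, 'n::finite) bilinear_field \<Rightarrow> ('a, 'n) chart \<Rightarrow> 'n \<Rightarrow> 'n \<Rightarrow> 'n \<Rightarrow> 'n \<Rightarrow> 'a \<Rightarrow> real" where
  "riemann g c j k l m x =
     (\<Sum>e\<in>UNIV. g c x $ j $ e *
        (pd c l (christoffel g c e m k) x - pd c m (christoffel g c e l k) x
          + (\<Sum>s\<in>UNIV. christoffel g c e l s x * christoffel g c s m k x
                      - christoffel g c e m s x * christoffel g c s l k x)))"

definition ricci ::
  "('a, 'n::finite) bilinear_field \<Rightarrow> ('a, 'n) chart \<Rightarrow> 'n \<Rightarrow> 'n \<Rightarrow> 'a \<Rightarrow> real" where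
  "ricci g c k m x =
     (\<Sum>j\<in>UNIV. \<Sum>l\<in>UNIV. ginv g c x $ j $ l * riemann g c j k l m x)"

definition scalar_curvature ::
  "('a, 'n::finite) bilinear_field \<Rightarrow> ('a, 'n) chart \<Rightarrow> 'a \<Rightarrow> real" where
  "scalar_curvature g c x =
     (\<Sum>i\<in>UNIV. \<Sum>j\<in>UNIV. ginv g c x $ i $ j * ricci g c i j x)"

definition weyl ::
  "('a, 'n::finite) bilinear_field \<Rightarrow> ('a, 'n) chart \<Rightarrow> 'n \<Rightarrow> 'n \<Rightarrow> 'n \<Rightarrow> 'n \<Rightarrow> 'a \<Rightarrow> real" where
  "weyl g c j k l m x =
     riemann g c j k l m x
     - (g c x $ j $ l * ricci g c k m x - g c x $ j $ m * ricci g c k l x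
        + g c x $ k $ m * ricci g c j l x - g c x $ k $ l * ricci g c j m x)
       / (real CARD('n) - 2)
     + scalar_curvature g c x
       * (g c x $ j $ l * g c x $ k $ m - g c x $ j $ m * g c x $ k $ l)
       / ((real CARD('n) - 1) * (real CARD('n) - 2))"

text \<open>\<open>weyl_up g c j k l m\<close> is \<open>C\<^sub>j\<^sub>k\<^sub>l\<^sup>m\<close>, and \<open>nabla_weyl_up g c i j k l m\<close> is \<open>\<nabla>\<^sub>i C\<^sub>j\<^sub>k\<^sub>l\<^sup>m\<close>.\<close>

definition weyl_up ::
  "('a, 'n::finite) bilinear_field \<Rightarrow> ('a, 'n) chart \<Rightarrow> 'n \<Rightarrow> 'n \<Rightarrow> 'n \<Rightarrow> 'n \<Rightarrow> 'a \<Rightarrow> real" where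
  "weyl_up g c j k l m x = (\<Sum>e\<in>UNIV. weyl g c j k l e x * ginv g c x $ e $ m)"

definition nabla_weyl_up ::
  "('a, 'n::finite) bilinear_field \<Rightarrow> ('a, 'n) chart
    \<Rightarrow> 'n \<Rightarrow> 'n \<Rightarrow> 'n \<Rightarrow> 'n \<Rightarrow> 'n \<Rightarrow> 'a \<Rightarrow> real" where
  "nabla_weyl_up g c i j k l m x =
     pd c i (weyl_up g c j k l m) x
     - (\<Sum>s\<in>UNIV. christoffel g c s i j x * weyl_up g c s k l m x)
     - (\<Sum>s\<in>UNIV. christoffel g c s i k x * weyl_up g c j s l m x)
     - (\<Sum>s\<in>UNIV. christoffel g c s i l x * weyl_up g c j k s m x)
     + (\<Sum>s\<in>UNIV. christoffel g c m i s x * weyl_up g c j k l s x)"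


section \<open>Perfect fluids and generalized Robertson-Walker space-times\<close>

definition fluid_stress ::
  "('a, 'n::finite) bilinear_field \<Rightarrow> ('a, 'n) vector_field \<Rightarrow> ('a \<Rightarrow> real) \<Rightarrow> ('a \<Rightarrow> real)
    \<Rightarrow> ('a, 'n) chart \<Rightarrow> 'n \<Rightarrow> 'n \<Rightarrow> 'a \<Rightarrow> real" where
  "fluid_stress g u p \<mu> c i j x =
     p x * g c x $ i $ j + (p x + \<mu> x) * flat g u c x $ i * flat g u c x $ j"

definition perfect_fluid_spacetime ::
  "'a topology \<Rightarrow> ('a, 'n::finite) chart set \<Rightarrow> ('a, 'n) bilinear_field
    \<Rightarrow> real \<Rightarrow> ('a, 'n) vector_field \<Rightarrow> ('a \<Rightarrow> real) \<Rightarrow> ('a \<Rightarrow> real) \<Rightarrow> bool" where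
  "perfect_fluid_spacetime X A g \<kappa> u p \<mu> \<longleftrightarrow>
     lorentzian_manifold X A g \<and> smooth_vector_field X A u \<and>
     smooth_scalar_field X A p \<and> smooth_scalar_field X A \<mu> \<and>
     (\<forall>c\<in>charts X A. \<forall>x\<in>chart_dom c.
        (\<Sum>j\<in>UNIV. u c x $ j * flat g u c x $ j) = -1 \<and>
        (\<forall>i j. ricci g c i j x - 1/2 * scalar_curvature g c x * g c x $ i $ j
               = \<kappa> * fluid_stress g u p \<mu> c i j x))"

text \<open>The time coordinate is the one with index \<open>t\<close>.  Functions and open sets in the remaining
  \<open>n - 1\<close> coordinates are represented by functions \<open>h\<close> and open sets \<open>W\<close> that do not depend on
  the coordinate \<open>t\<close>; only the entries of \<open>h\<close> with both indices different from \<open>t\<close> are used.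
  The chart has image \<open>I \<times> W\<close>, on which the metric is \<open>-dt\<^sup>2 + q(t)\<^sup>2 h\<close>.\<close>

definition warped_chart ::
  "('a, 'n::finite) bilinear_field \<Rightarrow> ('a, 'n) chart \<Rightarrow> bool" where
  "warped_chart g c \<longleftrightarrow>
     (\<exists>(t::'n) (I::real set) (W::(real ^ 'n) set) (q::real \<Rightarrow> real) (h::real ^ 'n \<Rightarrow> real ^ 'n ^ 'n).
        open I \<and> is_interval I \<and> open W \<and>
        (\<forall>y z. (\<forall>\<alpha>. \<alpha> \<noteq> t \<longrightarrow> y $ \<alpha> = z $ \<alpha>) \<longrightarrow> (y \<in> W \<longleftrightarrow> z \<in> W) \<and> h y = h z) \<and>
        chart_img c = {z \<in> W. z $ t \<in> I} \<and>
        smooth_on q I \<and> (\<forall>s\<in>I. q s > 0) \<and>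
        smooth_on h W \<and>
        (\<forall>z\<in>W. transpose (h z) = h z \<and>
               (\<forall>v. v \<noteq> 0 \<and> v $ t = 0 \<longrightarrow> v \<bullet> (h z *v v) > 0)) \<and>
        (\<forall>x\<in>chart_dom c. let z = chart_map c x in
           g c x $ t $ t = -1 \<and>
           (\<forall>\<alpha>. \<alpha> \<noteq> t \<longrightarrow> g c x $ t $ \<alpha> = 0 \<and> g c x $ \<alpha> $ t = 0) \<and>
           (\<forall>\<alpha> \<beta>. \<alpha> \<noteq> t \<and> \<beta> \<noteq> t \<longrightarrow> g c x $ \<alpha> $ \<beta> = (q (z $ t))\<^sup>2 * h z $ \<alpha> $ \<beta>)))"

definition generalized_robertson_walker ::
  "'a topology \<Rightarrow> ('a, 'n::finite) chart set \<Rightarrow> ('a, 'n) bilinear_field \<Rightarrow> bool" where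
  "generalized_robertson_walker X A g \<longleftrightarrow>
     lorentzian_manifold X A g \<and>
     (\<forall>x\<in>topspace X. \<exists>c\<in>charts X A. x \<in> chart_dom c \<and> warped_chart g c)"

end

theory Submission
  imports Defs "HOL-Analysis.Analysis"
begin

text \<open>In dimension \<open>n\<close>, a divergence-free Weyl tensor means that
  \<open>P\<^sub>i\<^sub>j = R\<^sub>i\<^sub>j - R g\<^sub>i\<^sub>j / (2 (n - 1))\<close> is a Codazzi tensor.  By Einstein's equations \<open>P\<close> is a combination of
  \<open>g\<close> and \<open>u \<otimes> u\<close> whose second coefficient is \<open>\<kappa> (p + \<mu>) \<noteq> 0\<close>; contracting the Codazzi equation with
  \<open>u\<close> and with \<open>g\<close>, and using that \<open>dp\<close> is proportional to \<open>d\<mu>\<close>, one finds that \<open>u\<close> is torse-forming: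
  \<open>\<nabla>\<^sub>k u\<^sub>l = \<phi> (g\<^sub>k\<^sub>l + u\<^sub>k u\<^sub>l)\<close>, with the gradient of \<open>\<phi>\<close> parallel to \<open>u\<close>.  Hence \<open>u\<close> is closed and geodesic, and the Ricci
  identity for \<open>u\<close> gives \<open>C\<^sub>j\<^sub>k\<^sub>l\<^sup>m u\<^sub>m = 0\<close>.  Writing \<open>u\<close> locally as \<open>-dt\<close> and straightening its flow
  yields comoving coordinates, in which the torse-forming equation is a linear ordinary differential
  equation for the spatial metric, with a coefficient depending on \<open>t\<close> only.\<close>

section \<open>Calculus of smooth maps\<close>

text \<open>The tensor calculus is pointwise algebra in a single chart; the analytic weight lies in
  the comoving coordinates. A chart that merely turns u into a coordinate field could still have
  mixed entries g_t\<alpha>, so the time coordinate must itself be a potential T of minus the 1-form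
  u. Such a T exists because u is closed, and it grows at unit rate along u because u has square -1.
  The flow of u is therefore started on a coordinate hyperplane and run until T reaches the
  prescribed value: then u is the t-direction and its 1-form is -dt at once. The new chart must
  belong to the maximal atlas, hence be smooth together with its inverse. This is why smooth
  dependence of a flow on initial data and smoothness of local inverses are derived here, both by
  induction on the order of differentiability. The dimension enters through factors that must not
  vanish: the divergence of the Weyl tensor is (n - 3)/(n - 2) times the Codazzi defect of P, and
  the trace of the Codazzi equation fixes the gradient of the coefficient of g up to the factor n -
  2.\<close>

lemma Ck_on_SucD: "Ck_on (Suc k) f S \<Longrightarrow> Ck_on k f S"
proof (induction k arbitrary: f)
  case 0
  then show ?case
    by (auto simp: continuous_on_eq_continuous_within
        intro: differentiable_imp_continuous_within differentiable_at_withinI)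
next
  case (Suc k)
  then show ?case by auto
qed

lemma Ck_on_imp_continuous_on: "Ck_on k f S \<Longrightarrow> continuous_on S f"
  by (induction k) (auto dest: Ck_on_SucD simp del: Ck_on.simps(2))

lemma Ck_on_has_derivative:
  "Ck_on (Suc k) f S \<Longrightarrow> x \<in> S \<Longrightarrow> (f has_derivative frechet_derivative f (at x)) (at x)"
  by (simp add: frechet_derivative_works[symmetric])

lemma Ck_on_subset: "Ck_on k f S \<Longrightarrow> T \<subseteq> S \<Longrightarrow> Ck_on k f T"
  by (induction k arbitrary: f) (auto intro: continuous_on_subset)

lemma Ck_on_cong:
  assumes "open S" "\<And>x. x \<in> S \<Longrightarrow> f x = g x" "Ck_on k f S"
  shows "Ck_on k g S"
  using assms(2,3)
proof (induction k arbitrary: f g)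
  case 0
  then show ?case by (metis Ck_on.simps(1) continuous_on_cong)
next
  case (Suc k)
  have d: "(g has_derivative frechet_derivative f (at x)) (at x)" if "x \<in> S" for x
    using Ck_on_has_derivative[OF Suc.prems(2) that] assms(1) that Suc.prems(1)
    by (rule has_derivative_transform_within_open) auto
  have "Ck_on k (\<lambda>x. frechet_derivative g (at x) v) S" for v
  proof (rule Suc.IH)
    show "frechet_derivative f (at x) v = frechet_derivative g (at x) v" if "x \<in> S" for x
      using frechet_derivative_at[OF d[OF that]] by simp
  qed (use Suc.prems in simp)
  with d show ?case by (auto simp: differentiable_def)
qed

lemma Ck_on_SucI:
  assumes "open S" "\<And>x. x \<in> S \<Longrightarrow> (f has_derivative F x) (at x)"
    "\<And>v. Ck_on k (\<lambda>x. F x v) S"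
  shows "Ck_on (Suc k) f S"
proof -
  have "Ck_on k (\<lambda>x. frechet_derivative f (at x) v) S" for v
    by (rule Ck_on_cong[OF assms(1) _ assms(3)[of v]])
      (use frechet_derivative_at[OF assms(2)] in simp)
  then show ?thesis using assms(2) by (auto simp: differentiable_def)
qed

lemma Ck_on_const: "Ck_on k (\<lambda>x. c) S"
  by (induction k arbitrary: c) (auto simp: frechet_derivative_const)

lemma Ck_on_bounded_linear_id:
  assumes "bounded_linear f" shows "Ck_on k f S"
proof (cases k)
  case 0
  then show ?thesis using assms by (simp add: linear_continuous_on)
next
  case (Suc m)
  have "frechet_derivative f (at x) = f" for x
    using frechet_derivative_at[OF bounded_linear_imp_has_derivative[OF assms]] by metis
  then show ?thesis
    using Suc assms by (auto simp: Ck_on_const bounded_linear_imp_differentiable)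
qed

lemma Ck_on_add:
  assumes "open S"
  shows "Ck_on k f S \<Longrightarrow> Ck_on k g S \<Longrightarrow> Ck_on k (\<lambda>x. f x + g x) S"
proof (induction k arbitrary: f g)
  case 0
  then show ?case by (auto intro: continuous_intros)
next
  case (Suc k)
  show ?case
    by (rule Ck_on_SucI[OF assms has_derivative_add[OF
          Ck_on_has_derivative[OF Suc.prems(1)] Ck_on_has_derivative[OF Suc.prems(2)]]])
      (use Suc in auto)
qed

lemma Ck_on_bilinear:
  assumes "open S" "bounded_bilinear B"
  shows "Ck_on k f S \<Longrightarrow> Ck_on k g S \<Longrightarrow> Ck_on k (\<lambda>x. B (f x) (g x)) S"
proof (induction k arbitrary: f g)
  case 0
  then show ?case using bounded_bilinear.continuous_on[OF assms(2)] by auto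
next
  case (Suc k)
  show ?case
    by (rule Ck_on_SucI[OF assms(1) bounded_bilinear.FDERIV[OF assms(2)
          Ck_on_has_derivative[OF Suc.prems(1)] Ck_on_has_derivative[OF Suc.prems(2)]]])
      (use Suc Suc.prems[THEN Ck_on_SucD] in \<open>auto intro!: Ck_on_add[OF assms(1)]\<close>)
qed

lemma Ck_on_linear:
  assumes "open S" "bounded_linear L" "Ck_on k f S"
  shows "Ck_on k (\<lambda>x. L (f x)) S"
  using assms(3)
proof (induction k arbitrary: f)
  case 0
  then show ?case using bounded_linear.continuous_on[OF assms(2)] by auto
next
  case (Suc k)
  show ?case
    by (rule Ck_on_SucI[OF assms(1) bounded_linear.has_derivative[OF assms(2)
          Ck_on_has_derivative[OF Suc.prems(1)]]])
      (use Suc in auto)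
qed

lemma Ck_on_sum:
  assumes "open S" "\<And>i. i \<in> I \<Longrightarrow> Ck_on k (f i) S"
  shows "Ck_on k (\<lambda>x. \<Sum>i\<in>I. f i x) S"
proof (cases "finite I")
  case True
  then show ?thesis using assms(2)
    by (induction I) (auto intro!: Ck_on_add[OF assms(1)] Ck_on_const)
qed (simp add: Ck_on_const)

lemmas Ck_on_mult = Ck_on_bilinear[OF _ bounded_bilinear_mult]
lemmas Ck_on_scaleR = Ck_on_bilinear[OF _ bounded_bilinear_scaleR]

lemma Ck_on_minus: "open S \<Longrightarrow> Ck_on k f S \<Longrightarrow> Ck_on k (\<lambda>x. - f x) S"
  by (rule Ck_on_linear[OF _ bounded_linear_minus[OF bounded_linear_ident]])

lemma Ck_on_diff:
  assumes "open S" "Ck_on k f S" "Ck_on k g S"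
  shows "Ck_on k (\<lambda>x. f x - g x) S"
  using Ck_on_add[OF assms(1,2) Ck_on_minus[OF assms(1,3)]] by simp

lemma Ck_on_prod:
  fixes f :: "'i \<Rightarrow> 'e::real_normed_vector \<Rightarrow> real"
  assumes "open S" "\<And>i. i \<in> I \<Longrightarrow> Ck_on k (f i) S"
  shows "Ck_on k (\<lambda>x. \<Prod>i\<in>I. f i x) S"
proof (cases "finite I")
  case True
  then show ?thesis using assms(2)
    by (induction I) (auto intro!: Ck_on_mult[OF assms(1)] Ck_on_const)
qed (simp add: Ck_on_const)

lemma Ck_on_inverse:
  fixes f :: "'e::real_normed_vector \<Rightarrow> real"
  assumes "open S" "\<And>x. x \<in> S \<Longrightarrow> f x \<noteq> 0"
  shows "Ck_on k f S \<Longrightarrow> Ck_on k (\<lambda>x. inverse (f x)) S"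
proof (induction k)
  case 0
  then show ?case using assms by (auto intro: continuous_intros)
next
  case (Suc k)
  have "Ck_on k (\<lambda>x. inverse (f x)) S"
    using Suc Ck_on_SucD by blast
  then have "Ck_on k (\<lambda>x. - (inverse (f x) * frechet_derivative f (at x) v * inverse (f x))) S" for v
    using Suc.prems by (auto intro!: Ck_on_mult Ck_on_minus assms(1))
  then show ?case
    by (intro Ck_on_SucI[OF assms(1)
        Deriv.has_derivative_inverse[OF assms(2) Ck_on_has_derivative[OF Suc.prems]]])
qed

text \<open>The chain rule evaluates the outer derivative in the direction \<open>g' x v\<close>,
  which moves with x, whereas \<open>Ck_on\<close> controls it only in fixed directions. Expanding
  the direction in a basis repairs this, and is the reason for the Euclidean middle space.\<close>

lemma Ck_on_compose:
  fixes f :: "'b::euclidean_space \<Rightarrow> 'c::real_normed_vector"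
  assumes "open S" "open T" "g ` S \<subseteq> T"
  shows "Ck_on k g S \<Longrightarrow> Ck_on k f T \<Longrightarrow> Ck_on k (\<lambda>x. f (g x)) S"
proof (induction k arbitrary: f)
  case 0
  then show ?case using assms(3) by (auto intro: continuous_on_compose2)
next
  case (Suc k)
  let ?g' = "\<lambda>x. frechet_derivative g (at x)" and ?f' = "\<lambda>y. frechet_derivative f (at y)"
  have d: "((\<lambda>x. f (g x)) has_derivative (\<lambda>v. ?f' (g x) (?g' x v))) (at x)" if "x \<in> S" for x
    using diff_chain_at[OF Ck_on_has_derivative[OF Suc.prems(1) that]
        Ck_on_has_derivative[OF Suc.prems(2)]] that assms(3) by (auto simp: o_def)
  have lin: "linear (?f' (g x))" if "x \<in> S" for x
    using Ck_on_has_derivative[OF Suc.prems(2), of "g x"] that assms(3) has_derivative_linear by blast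
  have "Ck_on k (\<lambda>x. \<Sum>b\<in>Basis. (?g' x v \<bullet> b) *\<^sub>R ?f' (g x) b) S" for v
    using Suc.prems Ck_on_SucD[OF Suc.prems(1)]
    by (auto intro!: Ck_on_sum Ck_on_scaleR Ck_on_linear[OF assms(1) bounded_linear_inner_left] assms Suc.IH)
  moreover have "(\<Sum>b\<in>Basis. (?g' x v \<bullet> b) *\<^sub>R ?f' (g x) b) = ?f' (g x) (?g' x v)" if "x \<in> S" for x v
    using linear_sum[OF lin[OF that], of "\<lambda>b. (?g' x v \<bullet> b) *\<^sub>R b" Basis]
    by (simp add: linear_scale[OF lin[OF that]] euclidean_representation)
  ultimately have "Ck_on k (\<lambda>x. ?f' (g x) (?g' x v)) S" for v
    by (rule Ck_on_cong[OF assms(1), rotated])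
  with d show ?case by (intro Ck_on_SucI[OF assms(1)]) auto
qed

lemma Ck_on_Pair:
  assumes "open S" "Ck_on k f S" "Ck_on k g S"
  shows "Ck_on k (\<lambda>x. (f x, g x)) S"
proof -
  have "Ck_on k (\<lambda>x. (f x, 0) + (0, g x)) S"
    by (intro Ck_on_add assms Ck_on_linear[OF _ bounded_linear_Pair[OF bounded_linear_ident bounded_linear_zero]]
        Ck_on_linear[OF _ bounded_linear_Pair[OF bounded_linear_zero bounded_linear_ident]])
  then show ?thesis by simp
qed

lemma Ck_on_vec_nth:
  fixes f :: "'e::real_normed_vector \<Rightarrow> ('b::real_normed_vector) ^ 'n"
  shows "open S \<Longrightarrow> Ck_on k f S \<Longrightarrow> Ck_on k (\<lambda>x. f x $ i) S"
  by (rule Ck_on_linear[OF _ bounded_linear_vec_nth])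

lemma bounded_linear_axis: "bounded_linear (axis i :: 'b::real_normed_vector \<Rightarrow> 'b ^ 'n)"
proof (rule bounded_linear_intro[of _ 1])
  fix x y :: 'b and r :: real
  show "axis i (x + y) = (axis i x + axis i y :: 'b ^ 'n)" "axis i (r *\<^sub>R x) = r *\<^sub>R (axis i x :: 'b ^ 'n)"
    by (auto simp: axis_def vec_eq_iff)
  show "norm (axis i x :: 'b ^ 'n) \<le> norm x * 1"
    by (simp add: norm_vec_def L2_set_def axis_def if_distrib if_distribR power2_eq_square sum.delta
        cong: if_cong)
qed

lemma Ck_on_vec_lambda:
  fixes f :: "'n::finite \<Rightarrow> 'e::real_normed_vector \<Rightarrow> 'b::real_normed_vector"
  assumes "open S" "\<And>i. Ck_on k (f i) S"
  shows "Ck_on k (\<lambda>x. \<chi> i. f i x) S"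
proof -
  have "Ck_on k (\<lambda>x. \<Sum>i\<in>UNIV. (axis i (f i x) :: 'b ^ 'n)) S"
    by (intro Ck_on_sum Ck_on_linear[OF _ bounded_linear_axis] assms)
  moreover have "(\<Sum>i\<in>UNIV. (axis i (f i x) :: 'b ^ 'n)) = (\<chi> i. f i x)" for x
    by (simp add: vec_eq_iff sum_component axis_def sum.delta)
  ultimately show ?thesis by simp
qed

lemma Ck_on_det:
  fixes M :: "'e::real_normed_vector \<Rightarrow> real ^ 'n ^ 'n"
  assumes "open S" "\<And>i j. Ck_on k (\<lambda>x. M x $ i $ j) S"
  shows "Ck_on k (\<lambda>x. det (M x)) S"
  unfolding det_def
  by (intro Ck_on_sum Ck_on_mult Ck_on_prod Ck_on_const assms)

text \<open>Cramer's rule writes the solution as a quotient of determinants, which are polynomial in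
  the data. Inverse matrices and derivatives of inverse maps get their regularity from here.\<close>

lemma Ck_on_solve:
  fixes M :: "'e::real_normed_vector \<Rightarrow> real ^ 'n ^ 'n"
  assumes S: "open S" and M: "\<And>i j. Ck_on k (\<lambda>x. M x $ i $ j) S" and b: "\<And>i. Ck_on k (\<lambda>x. b x $ i) S"
    and inv: "\<And>x. x \<in> S \<Longrightarrow> invertible (M x)" and sol: "\<And>x. x \<in> S \<Longrightarrow> M x *v w x = b x"
  shows "Ck_on k w S"
proof -
  have nz: "det (M x) \<noteq> 0" if "x \<in> S" for x
    using inv[OF that] invertible_det_nz by blast
  have "Ck_on k (\<lambda>x. (\<chi> i j. if j = l then b x $ i else M x $ i $ j) $ i $ j) S" for i j l
    using M b by (cases "j = l") auto
  then have "Ck_on k (\<lambda>x. \<chi> l. det (\<chi> i j. if j = l then b x $ i else M x $ i $ j) * inverse (det (M x))) S"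
    by (intro Ck_on_vec_lambda Ck_on_mult Ck_on_det Ck_on_inverse S M nz) auto
  then show ?thesis
    by (rule Ck_on_cong[OF S, rotated])
      (use cramer[OF nz] sol in \<open>simp add: divide_inverse\<close>)
qed

section \<open>Maps of class C-infinity\<close>

lemma smooth_on_continuous: "smooth_on f S \<Longrightarrow> continuous_on S f"
  unfolding smooth_on_def using Ck_on_imp_continuous_on by blast

lemma smooth_on_has_derivative:
  "smooth_on f S \<Longrightarrow> x \<in> S \<Longrightarrow> (f has_derivative frechet_derivative f (at x)) (at x)"
  unfolding smooth_on_def using Ck_on_has_derivative by blast

lemma smooth_on_frechet_derivative:
  "smooth_on f S \<Longrightarrow> smooth_on (\<lambda>x. frechet_derivative f (at x) v) S"
  unfolding smooth_on_def using Ck_on.simps(2) by blast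

lemma smooth_onI_derivative:
  assumes "open S" "\<And>x. x \<in> S \<Longrightarrow> (f has_derivative F x) (at x)" "\<And>v. smooth_on (\<lambda>x. F x v) S"
  shows "smooth_on f S"
  unfolding smooth_on_def
proof
  fix k
  have "Ck_on (Suc k) f S"
    using assms unfolding smooth_on_def by (intro Ck_on_SucI) auto
  then show "Ck_on k f S" by (rule Ck_on_SucD)
qed

lemma smooth_on_subset: "smooth_on f S \<Longrightarrow> T \<subseteq> S \<Longrightarrow> smooth_on f T"
  unfolding smooth_on_def using Ck_on_subset by blast

lemma smooth_on_cong:
  "open S \<Longrightarrow> (\<And>x. x \<in> S \<Longrightarrow> f x = g x) \<Longrightarrow> smooth_on f S \<Longrightarrow> smooth_on g S"
  unfolding smooth_on_def using Ck_on_cong by blast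

lemma smooth_on_const: "smooth_on (\<lambda>x. c) S"
  by (simp add: smooth_on_def Ck_on_const)

lemma smooth_on_bounded_linear: "bounded_linear f \<Longrightarrow> smooth_on f S"
  by (simp add: smooth_on_def Ck_on_bounded_linear_id)

lemma smooth_on_add: "open S \<Longrightarrow> smooth_on f S \<Longrightarrow> smooth_on g S \<Longrightarrow> smooth_on (\<lambda>x. f x + g x) S"
  by (simp add: smooth_on_def Ck_on_add)

lemma smooth_on_diff: "open S \<Longrightarrow> smooth_on f S \<Longrightarrow> smooth_on g S \<Longrightarrow> smooth_on (\<lambda>x. f x - g x) S"
  by (simp add: smooth_on_def Ck_on_diff)

lemma smooth_on_mult:
  fixes f g :: "'e::real_normed_vector \<Rightarrow> real"
  shows "open S \<Longrightarrow> smooth_on f S \<Longrightarrow> smooth_on g S \<Longrightarrow> smooth_on (\<lambda>x. f x * g x) S"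
  by (simp add: smooth_on_def Ck_on_mult)

lemma smooth_on_scaleR:
  "open S \<Longrightarrow> smooth_on f S \<Longrightarrow> smooth_on g S \<Longrightarrow> smooth_on (\<lambda>x. f x *\<^sub>R g x) S"
  by (simp add: smooth_on_def Ck_on_scaleR)

lemma smooth_on_inverse:
  fixes f :: "'e::real_normed_vector \<Rightarrow> real"
  shows "open S \<Longrightarrow> smooth_on f S \<Longrightarrow> (\<And>x. x \<in> S \<Longrightarrow> f x \<noteq> 0) \<Longrightarrow> smooth_on (\<lambda>x. inverse (f x)) S"
  by (simp add: smooth_on_def Ck_on_inverse)

lemma smooth_on_sum:
  "open S \<Longrightarrow> (\<And>i. i \<in> I \<Longrightarrow> smooth_on (f i) S) \<Longrightarrow> smooth_on (\<lambda>x. \<Sum>i\<in>I. f i x) S"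
  by (simp add: smooth_on_def Ck_on_sum)

lemma smooth_on_compose:
  fixes f :: "'b::euclidean_space \<Rightarrow> 'c::real_normed_vector"
  shows "open S \<Longrightarrow> open T \<Longrightarrow> g ` S \<subseteq> T \<Longrightarrow> smooth_on g S \<Longrightarrow> smooth_on f T \<Longrightarrow> smooth_on (\<lambda>x. f (g x)) S"
  unfolding smooth_on_def using Ck_on_compose by blast

lemma smooth_on_vec_nth:
  fixes f :: "'e::real_normed_vector \<Rightarrow> ('b::real_normed_vector) ^ 'n"
  shows "open S \<Longrightarrow> smooth_on f S \<Longrightarrow> smooth_on (\<lambda>x. f x $ i) S"
  by (simp add: smooth_on_def Ck_on_vec_nth)

lemma smooth_on_vec_lambda:
  fixes f :: "'n::finite \<Rightarrow> 'e::real_normed_vector \<Rightarrow> 'b::real_normed_vector"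
  shows "open S \<Longrightarrow> (\<And>i. smooth_on (f i) S) \<Longrightarrow> smooth_on (\<lambda>x. \<chi> i. f i x) S"
  by (simp add: smooth_on_def Ck_on_vec_lambda)

lemma smooth_on_solve:
  fixes M :: "'e::real_normed_vector \<Rightarrow> real ^ 'n ^ 'n"
  assumes "open S" "\<And>i j. smooth_on (\<lambda>x. M x $ i $ j) S" "\<And>i. smooth_on (\<lambda>x. b x $ i) S"
    and "\<And>x. x \<in> S \<Longrightarrow> invertible (M x)" "\<And>x. x \<in> S \<Longrightarrow> M x *v w x = b x"
  shows "smooth_on w S"
  unfolding smooth_on_def
proof
  fix k
  show "Ck_on k w S"
    using assms(2,3) unfolding smooth_on_def
    by (intro Ck_on_solve[OF assms(1), where M = M and b = b] assms(4,5)) auto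
qed

text \<open>The root occurs in its own derivative, f' / (2 sqrt f), so its regularity is raised one
  order at a time.\<close>

lemma smooth_on_sqrt:
  fixes f :: "'e::real_normed_vector \<Rightarrow> real"
  assumes S: "open S" and f: "smooth_on f S" and pos: "\<And>x. x \<in> S \<Longrightarrow> f x > 0"
  shows "smooth_on (\<lambda>x. sqrt (f x)) S"
proof -
  have "Ck_on k (\<lambda>x. sqrt (f x)) S" for k
  proof (induction k)
    case 0
    then show ?case using smooth_on_continuous[OF f] by (auto intro: continuous_intros)
  next
    case (Suc k)
    have d: "((\<lambda>x. sqrt (f x)) has_derivative
        (\<lambda>v. frechet_derivative f (at x) v * (inverse (sqrt (f x)) / 2))) (at x)" if "x \<in> S" for x
      using smooth_on_has_derivative[OF f that] pos[OF that]
      by (auto intro!: derivative_eq_intros)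
    have nz: "sqrt (f x) \<noteq> 0" if "x \<in> S" for x
      using pos[OF that] by simp
    have "Ck_on k (\<lambda>x. frechet_derivative f (at x) v * (inverse (sqrt (f x)) * (1 / 2))) S" for v
      using smooth_on_frechet_derivative[OF f, of v] nz unfolding smooth_on_def
      by (intro Ck_on_mult Ck_on_inverse Ck_on_const S Suc) auto
    with d show ?case by (intro Ck_on_SucI[OF S]) auto
  qed
  then show ?thesis by (simp add: smooth_on_def)
qed

lemma matrix_inv_inverse:
  fixes M :: "real ^ 'n ^ 'n"
  assumes "invertible M"
  shows "M ** matrix_inv M = mat 1" "matrix_inv M ** M = mat 1"
  using someI_ex[OF assms[unfolded invertible_def]] unfolding matrix_inv_def by auto

lemma smooth_on_matrix_inv:
  fixes M :: "'e::real_normed_vector \<Rightarrow> real ^ 'n ^ 'n"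
  assumes S: "open S" and M: "smooth_on M S" and inv: "\<And>x. x \<in> S \<Longrightarrow> invertible (M x)"
  shows "smooth_on (\<lambda>x. matrix_inv (M x)) S"
proof -
  have "smooth_on (\<lambda>x. matrix_inv (M x) *v axis j 1) S" for j
  proof (rule smooth_on_solve[OF S, where b = "\<lambda>x. axis j 1"])
    show "M x *v (matrix_inv (M x) *v axis j 1) = axis j 1" if "x \<in> S" for x
      by (simp add: matrix_vector_mul_assoc matrix_inv_inverse[OF inv[OF that]])
  qed (use inv smooth_on_vec_nth[OF S smooth_on_vec_nth[OF S M]] smooth_on_const in auto)
  then have "smooth_on (\<lambda>x. \<chi> i j. (matrix_inv (M x) *v axis j 1) $ i) S"
    by (intro smooth_on_vec_lambda smooth_on_vec_nth S)
  moreover have "(\<chi> i j. (matrix_inv (M x) *v axis j 1) $ i) = matrix_inv (M x)" for x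
    by (simp add: vec_eq_iff matrix_vector_mult_basis column_def)
  ultimately show ?thesis by simp
qed

text \<open>Both continuity and differentiability on an open set are tested point by point. This
  lets regularity proved on slightly smaller time intervals be glued together.\<close>

lemma Ck_on_local:
  assumes "\<And>x. x \<in> S \<Longrightarrow> \<exists>T. open T \<and> x \<in> T \<and> Ck_on k f T"
  shows "Ck_on k f S"
  using assms
proof (induction k arbitrary: f)
  case 0
  then show ?case
    by (metis Ck_on.simps(1) continuous_on_eq_continuous_at continuous_at_imp_continuous_on)
next
  case (Suc k)
  then show ?case by (metis Ck_on.simps(2))
qed

section \<open>Symmetry of second derivatives\<close>

lemma has_real_derivative_along_line:
  fixes f :: "'e::real_normed_vector \<Rightarrow> real"
  assumes "(f has_derivative D) (at (a + s *\<^sub>R v))"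
  shows "((\<lambda>s. f (a + s *\<^sub>R v)) has_real_derivative D v) (at s)"
proof -
  have "((\<lambda>s. a + s *\<^sub>R v) has_derivative (\<lambda>h. h *\<^sub>R v)) (at s)"
    by (auto intro!: derivative_eq_intros)
  from diff_chain_at[OF this assms]
  show ?thesis
    using linear_scale[OF has_derivative_linear[OF assms], of _ v]
    by (simp add: has_field_derivative_def o_def mult_commute_abs)
qed

text \<open>The mean value theorem is used twice: in direction v for the increment in direction w,
  then in direction w for the derivative along v. The left-hand side is symmetric in v and w, which
  is what the next lemma exploits.\<close>

lemma second_difference:
  fixes f :: "'e::real_normed_vector \<Rightarrow> real"
  assumes f: "smooth_on f S" and r: "r > 0"
    and S: "\<And>s t. 0 \<le> s \<Longrightarrow> s \<le> r \<Longrightarrow> 0 \<le> t \<Longrightarrow> t \<le> r \<Longrightarrow> x + s *\<^sub>R v + t *\<^sub>R w \<in> S"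
  obtains s t where "0 < s" "s < r" "0 < t" "t < r"
    "f (x + r *\<^sub>R v + r *\<^sub>R w) - f (x + r *\<^sub>R v) - f (x + r *\<^sub>R w) + f x =
      r * r * frechet_derivative (\<lambda>y. frechet_derivative f (at y) v) (at (x + s *\<^sub>R v + t *\<^sub>R w)) w"
proof -
  let ?f' = "\<lambda>y. frechet_derivative f (at y) v"
  let ?g = "\<lambda>s. f (x + r *\<^sub>R w + s *\<^sub>R v) - f (x + s *\<^sub>R v)"
  have "(?g has_real_derivative ?f' (x + r *\<^sub>R w + s *\<^sub>R v) - ?f' (x + s *\<^sub>R v)) (at s)"
    if "0 \<le> s" "s \<le> r" for s
  proof -
    have "x + s *\<^sub>R v + r *\<^sub>R w \<in> S" "x + s *\<^sub>R v + 0 *\<^sub>R w \<in> S"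
      using that r S[of s r] S[of s 0] by auto
    then have "(f has_derivative frechet_derivative f (at (x + r *\<^sub>R w + s *\<^sub>R v))) (at (x + r *\<^sub>R w + s *\<^sub>R v))"
      "(f has_derivative frechet_derivative f (at (x + s *\<^sub>R v))) (at (x + s *\<^sub>R v))"
      by (auto intro!: smooth_on_has_derivative[OF f] simp: ac_simps)
    from this[THEN has_real_derivative_along_line] show ?thesis by (rule DERIV_diff)
  qed
  then obtain s where s: "0 < s" "s < r"
    "?g r - ?g 0 = r * (?f' (x + r *\<^sub>R w + s *\<^sub>R v) - ?f' (x + s *\<^sub>R v))"
    using MVT2[OF r, of ?g "\<lambda>s. ?f' (x + r *\<^sub>R w + s *\<^sub>R v) - ?f' (x + s *\<^sub>R v)"] by auto
  let ?h = "\<lambda>t. ?f' (x + s *\<^sub>R v + t *\<^sub>R w)"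
  have "(?h has_real_derivative frechet_derivative ?f' (at (x + s *\<^sub>R v + t *\<^sub>R w)) w) (at t)"
    if "0 \<le> t" "t \<le> r" for t
    using s that S smooth_on_has_derivative[OF smooth_on_frechet_derivative[OF f]]
    by (intro has_real_derivative_along_line) auto
  then obtain t where t: "0 < t" "t < r"
    "?h r - ?h 0 = r * frechet_derivative ?f' (at (x + s *\<^sub>R v + t *\<^sub>R w)) w"
    using MVT2[OF r, of ?h "\<lambda>t. frechet_derivative ?f' (at (x + s *\<^sub>R v + t *\<^sub>R w)) w"] by auto
  show thesis
    using s t by (intro that[of s t]) (simp_all add: algebra_simps)
qed

text \<open>One second difference, read in both orders, equates the two mixed derivatives at two
  nearby points. Were they different at x, continuity would keep them apart on a small enough
  parallelogram.\<close>

lemma frechet_derivative_commute: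
  fixes f :: "'e::real_normed_vector \<Rightarrow> real"
  assumes S: "open S" "x \<in> S" and f: "smooth_on f S"
  shows "frechet_derivative (\<lambda>y. frechet_derivative f (at y) v) (at x) w =
         frechet_derivative (\<lambda>y. frechet_derivative f (at y) w) (at x) v"
    (is "?A x = ?B x")
proof (rule ccontr)
  assume ne: "?A x \<noteq> ?B x"
  define e where "e = \<bar>?A x - ?B x\<bar> / 2"
  have e: "e > 0" using ne by (simp add: e_def)
  have "smooth_on ?A S" "smooth_on ?B S"
    by (intro smooth_on_frechet_derivative f)+
  then have "isCont ?A x" "isCont ?B x"
    using S smooth_on_continuous continuous_on_eq_continuous_at by blast+
  then obtain d1 d2 where d: "d1 > 0" "d2 > 0"
    "\<And>y. dist y x < d1 \<Longrightarrow> dist (?A y) (?A x) < e" "\<And>y. dist y x < d2 \<Longrightarrow> dist (?B y) (?B x) < e"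
    using e unfolding continuous_at_eps_delta by metis
  obtain d0 where d0: "d0 > 0" "ball x d0 \<subseteq> S"
    using S open_contains_ball by blast
  define d where "d = min d0 (min d1 d2)"
  \<comment> \<open>The side length makes every point of the parallelogram spanned by r v and r w
    lie within d of x; the added 1 avoids a zero denominator.\<close>
  define r where "r = d / (2 * (norm v + norm w + 1))"
  have pos: "norm v + norm w + 1 > 0" by (smt (verit) norm_ge_zero)
  have dpos: "d > 0" using d d0 by (simp add: d_def)
  then have r: "r > 0" using pos by (simp add: r_def)
  have near: "dist (x + s *\<^sub>R a + t *\<^sub>R b) x < d"
    if "0 \<le> s" "s \<le> r" "0 \<le> t" "t \<le> r" "norm a + norm b = norm v + norm w" for s t and a b :: 'e
  proof -
    have "dist (x + s *\<^sub>R a + t *\<^sub>R b) x \<le> s * norm a + t * norm b"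
      using that norm_triangle_ineq[of "s *\<^sub>R a" "t *\<^sub>R b"] by (simp add: dist_norm add.assoc)
    also have "\<dots> \<le> r * norm a + r * norm b"
      using that by (intro add_mono mult_right_mono) auto
    also have "\<dots> = r * (norm v + norm w)" by (simp add: that(5)[symmetric] distrib_left)
    also have "\<dots> < r * (2 * (norm v + norm w + 1))"
      using r pos by (intro mult_strict_left_mono) auto
    also have "\<dots> = d" using pos by (simp add: r_def)
    finally show ?thesis .
  qed
  obtain s t where st: "0 < s" "s < r" "0 < t" "t < r"
    "f (x + r *\<^sub>R v + r *\<^sub>R w) - f (x + r *\<^sub>R v) - f (x + r *\<^sub>R w) + f x = r * r * ?A (x + s *\<^sub>R v + t *\<^sub>R w)"
  proof (rule second_difference[OF f r, of x v w])
    show "x + s *\<^sub>R v + t *\<^sub>R w \<in> S" if "0 \<le> s" "s \<le> r" "0 \<le> t" "t \<le> r" for s t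
      using near[of s t v w] that d0(2) by (force simp: d_def dist_commute)
  qed
  obtain s' t' where st': "0 < s'" "s' < r" "0 < t'" "t' < r"
    "f (x + r *\<^sub>R w + r *\<^sub>R v) - f (x + r *\<^sub>R w) - f (x + r *\<^sub>R v) + f x = r * r * ?B (x + s' *\<^sub>R w + t' *\<^sub>R v)"
  proof (rule second_difference[OF f r, of x w v])
    show "x + s *\<^sub>R w + t *\<^sub>R v \<in> S" if "0 \<le> s" "s \<le> r" "0 \<le> t" "t \<le> r" for s t
      using near[of s t w v] that d0(2) by (force simp: d_def dist_commute)
  qed
  have "r * r * ?A (x + s *\<^sub>R v + t *\<^sub>R w) = r * r * ?B (x + s' *\<^sub>R w + t' *\<^sub>R v)"
    using st(5) st'(5) by (simp add: algebra_simps)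
  then have "?A (x + s *\<^sub>R v + t *\<^sub>R w) = ?B (x + s' *\<^sub>R w + t' *\<^sub>R v)"
    using r by simp
  moreover have "dist (?A (x + s *\<^sub>R v + t *\<^sub>R w)) (?A x) < e"
    using near[of s t v w] st by (intro d(3)) (auto simp: d_def)
  moreover have "dist (?B (x + s' *\<^sub>R w + t' *\<^sub>R v)) (?B x) < e"
    using near[of s' t' w v] st' by (intro d(4)) (auto simp: d_def)
  ultimately show False unfolding dist_real_def e_def by (smt (verit) field_sum_of_halves)
qed

text \<open>Uniform estimates and the inverse function theorem ask for a derivative that is
  continuous in operator norm. In finite dimension this follows from continuity in each basis
  direction, which is all that \<open>Ck_on\<close> records.\<close>

lemma C1_continuous_blinfun:
  fixes f :: "'a::euclidean_space \<Rightarrow> 'b::real_normed_vector"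
  assumes "Ck_on (Suc 0) f S"
  shows "continuous_on S (\<lambda>x. Blinfun (frechet_derivative f (at x)))"
    and "x \<in> S \<Longrightarrow> blinfun_apply (Blinfun (frechet_derivative f (at x))) = frechet_derivative f (at x)"
proof -
  show ap: "blinfun_apply (Blinfun (frechet_derivative f (at x))) = frechet_derivative f (at x)" if "x \<in> S" for x
    using Ck_on_has_derivative[OF assms that] has_derivative_bounded_linear bounded_linear_Blinfun_apply by blast
  show "continuous_on S (\<lambda>x. Blinfun (frechet_derivative f (at x)))"
  proof (rule continuous_on_blinfun_componentwise)
    fix i :: 'a
    have "continuous_on S (\<lambda>x. frechet_derivative f (at x) i)" using assms by simp
    then show "continuous_on S (\<lambda>x. blinfun_apply (Blinfun (frechet_derivative f (at x))) i)"
      by (subst continuous_on_cong[OF refl, where g = "\<lambda>x. frechet_derivative f (at x) i"]) (auto simp: ap)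
  qed
qed

text \<open>Bootstrapping from the C^1 case: the derivative of g solves a linear system with matrix
  f' at g(y). If g is of class k, so is this matrix, hence by Cramer's rule the derivative of g, and
  g is of class k + 1.\<close>

proposition smooth_inverse_function:
  fixes f :: "real ^ 'n \<Rightarrow> real ^ 'n"
  assumes U: "open U" "x0 \<in> U" and f: "smooth_on f U"
    and inj: "\<And>v. frechet_derivative f (at x0) v = 0 \<Longrightarrow> v = 0"
  obtains U' V g where "open U'" "U' \<subseteq> U" "x0 \<in> U'" "open V" "homeomorphism U' V f g" "smooth_on g V"
    "\<And>y v. y \<in> V \<Longrightarrow> frechet_derivative g (at y) (frechet_derivative f (at (g y)) v) = v"
proof -
  let ?F = "\<lambda>x. Blinfun (frechet_derivative f (at x))"
  have C1: "Ck_on (Suc 0) f U" using f unfolding smooth_on_def by blast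
  note F = C1_continuous_blinfun[OF C1]
  have lin: "linear (frechet_derivative f (at x))" if "x \<in> U" for x
    using Ck_on_has_derivative[OF C1 that] has_derivative_linear by blast
  have "inj (frechet_derivative f (at x0))"
    using inj linear_injective_0[OF lin[OF U(2)]] by blast
  then obtain h where h: "linear h" "\<And>v. h (frechet_derivative f (at x0) v) = v"
    using linear_injective_isomorphism[OF lin[OF U(2)]] by blast
  have der: "(f has_derivative blinfun_apply (?F x)) (at x)" if "x \<in> U" for x
    using smooth_on_has_derivative[OF f that] F(2)[OF that] by simp
  have h': "Blinfun h o\<^sub>L ?F x0 = id_blinfun"
    by (rule blinfun_eqI) (simp add: F(2)[OF U(2)] h(2) bounded_linear_Blinfun_apply linear_conv_bounded_linear[THEN iffD1, OF h(1)])
  obtain U' V g g' where V: "open U'" "U' \<subseteq> U" "x0 \<in> U'" "open V" "homeomorphism U' V f g"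
    "\<And>y. y \<in> V \<Longrightarrow> (g has_derivative g' y) (at y)"
    "\<And>y. y \<in> V \<Longrightarrow> g' y = inv (blinfun_apply (?F (g y)))"
    "\<And>y. y \<in> V \<Longrightarrow> bij (blinfun_apply (?F (g y)))"
    by (rule inverse_function_theorem[OF U(1) der F(1) U(2) h']) blast+
  have gU: "g y \<in> U" if "y \<in> V" for y
    using V(2,5) that by (auto simp: homeomorphism_def)
  have g': "g' y = frechet_derivative g (at y)" if "y \<in> V" for y
    using V(6)[OF that] by (rule frechet_derivative_at)
  have bij: "bij (frechet_derivative f (at (g y)))" if "y \<in> V" for y
    using V(8)[OF that] F(2)[OF gU[OF that]] by simp
  have inv: "frechet_derivative g (at y) (frechet_derivative f (at (g y)) v) = v"
    "frechet_derivative f (at (g y)) (frechet_derivative g (at y) v) = v" if "y \<in> V" for y v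
    using bij[OF that] V(7)[OF that] F(2)[OF gU[OF that]] g'[OF that]
    by (simp_all add: bij_is_inj bij_is_surj surj_f_inv_f)
  let ?M = "\<lambda>y. matrix (frechet_derivative f (at (g y)))"
  have Mv: "?M y *v v = frechet_derivative f (at (g y)) v" if "y \<in> V" for y v
    using fun_cong[OF matrix_vector_mul(2)[OF lin[OF gU[OF that]]]] .
  have "Ck_on k g V" for k
  proof (induction k)
    case 0
    then show ?case using V(5) by (simp add: homeomorphism_def)
  next
    case (Suc k)
    have "Ck_on k (\<lambda>y. frechet_derivative g (at y) v) V" for v
    proof (rule Ck_on_solve[OF V(4), where M = ?M and b = "\<lambda>y. v"])
      have "Ck_on k (\<lambda>y. frechet_derivative f (at (g y)) w) V" for w
        using smooth_on_frechet_derivative[OF f, of w] gU unfolding smooth_on_def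
        by (intro Ck_on_compose[OF V(4) U(1) _ Suc, of "\<lambda>x. frechet_derivative f (at x) w"]) auto
      then show "Ck_on k (\<lambda>y. ?M y $ i $ j) V" for i j
        unfolding matrix_def by (simp add: Ck_on_vec_nth V(4))
      fix y assume y: "y \<in> V"
      show "?M y *v frechet_derivative g (at y) v = v"
        using Mv[OF y] inv(2)[OF y] by simp
      have "\<exists>B. B ** ?M y = mat 1"
        using matrix_left_invertible_injective[of "?M y"] Mv[OF y] bij[OF y]
        by (simp add: bij_is_inj inj_on_def) (metis bij_is_inj inj_eq)
      then show "invertible (?M y)" by (simp add: invertible_left_inverse)
    qed (rule Ck_on_const)
    then show ?case
      using V(6) g' by (intro Ck_on_SucI[OF V(4)]) auto
  qed
  then show thesis
    using V inv(1) by (intro that[of U' V g]) (auto simp: smooth_on_def)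
qed

text \<open>The potential is the line integral of \<omega> along the straight segment from the
  centre; a ball is star-shaped, so the segments stay inside.\<close>

lemma poincare_lemma:
  fixes \<omega> :: "real ^ 'n \<Rightarrow> real ^ 'n"
  assumes w: "smooth_on \<omega> (ball z0 r)" and r: "r > 0"
    and closed: "\<And>z v w. z \<in> ball z0 r \<Longrightarrow>
      frechet_derivative \<omega> (at z) v \<bullet> w = frechet_derivative \<omega> (at z) w \<bullet> v"
  obtains T where "smooth_on T (ball z0 r)" "T z0 = 0"
    "\<And>z. z \<in> ball z0 r \<Longrightarrow> (T has_derivative (\<lambda>v. \<omega> z \<bullet> v)) (at z)"
proof -
  let ?B = "ball z0 r"
  let ?D = "\<lambda>z. frechet_derivative \<omega> (at z)"
  define p where "p z s = z0 + s *\<^sub>R (z - z0)" for z and s :: real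
  \<comment> \<open>This is the derivative of the integrand \<open>f z s\<close> in z, to be
    integrated over s by the Leibniz rule.\<close>
  define F where "F z s v = s * (?D (p z s) v \<bullet> (z - z0)) + \<omega> (p z s) \<bullet> v" for z s v
  define f where "f z s = \<omega> (p z s) \<bullet> (z - z0)" for z s
  have pB: "p z s \<in> ?B" if "z \<in> ?B" "s \<in> {0..1}" for z s
  proof -
    have "norm (s *\<^sub>R (z - z0)) \<le> norm (z - z0)"
      using that(2) by (simp add: mult_left_le_one_le)
    then show ?thesis using that(1) by (simp add: p_def dist_norm norm_minus_commute)
  qed
  have dw: "(\<omega> has_derivative ?D z) (at z)" if "z \<in> ?B" for z
    using smooth_on_has_derivative[OF w that] .
  have df: "((\<lambda>z. f z s) has_derivative F z s) (at z)" if "z \<in> ?B" "s \<in> {0..1}" for z s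
  proof -
    have "((\<lambda>z. p z s) has_derivative (\<lambda>v. s *\<^sub>R v)) (at z)"
      unfolding p_def by (auto intro!: derivative_eq_intros)
    from diff_chain_at[OF this dw[OF pB[OF that]]]
    have "((\<lambda>z. \<omega> (p z s)) has_derivative (\<lambda>v. ?D (p z s) (s *\<^sub>R v))) (at z)"
      by (simp add: o_def)
    then show ?thesis
      unfolding f_def F_def
      using linear_scale[OF has_derivative_linear[OF dw[OF pB[OF that]]]]
      by (auto intro!: derivative_eq_intros simp: fun_eq_iff)
  qed
  have bl: "blinfun_apply (Blinfun (F z s)) = F z s" if "z \<in> ?B" "s \<in> {0..1}" for z s
    using has_derivative_bounded_linear[OF df[OF that]] by (simp add: bounded_linear_Blinfun_apply)
  have cp: "continuous_on (?B \<times> {0..1}) (\<lambda>(z, s). p z s)"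
    unfolding p_def by (auto intro!: continuous_intros simp: split_beta)
  have cw: "continuous_on (?B \<times> {0..1}) (\<lambda>(z, s). \<omega> (p z s))"
    using continuous_on_compose2[OF smooth_on_continuous[OF w] cp] pB
    by (force simp: split_beta)
  have cD: "continuous_on (?B \<times> {0..1}) (\<lambda>(z, s). ?D (p z s) v)" for v
    using continuous_on_compose2[OF smooth_on_continuous[OF smooth_on_frechet_derivative[OF w, of v]] cp] pB
    by (force simp: split_beta)
  have cF: "continuous_on (?B \<times> {0..1}) (\<lambda>(z, s). F z s v)" for v
    using cw cD[of v] unfolding F_def by (auto intro!: continuous_intros simp: split_beta)
  have cBF: "continuous_on (?B \<times> {0..1}) (\<lambda>(z, s). Blinfun (F z s))"
    by (rule continuous_on_blinfun_componentwise, rule continuous_on_eq[OF cF]) (auto simp: bl)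
  have slice: "continuous_on {0..1} (\<lambda>s. h (z, s))" if "continuous_on (?B \<times> {0..1}) h" "z \<in> ?B"
    for h :: "_ \<Rightarrow> 'x::topological_space" and z
    by (rule continuous_on_compose2[OF that(1)]) (use that(2) in \<open>auto intro!: continuous_intros\<close>)
  have cf: "continuous_on {0..1} (f z)" if "z \<in> ?B" for z
    using slice[OF cw that] unfolding f_def by (auto intro!: continuous_intros)
  define T where "T z = integral {0..1} (f z)" for z
  have dT: "(T has_derivative (\<lambda>v. \<omega> z \<bullet> v)) (at z)" if z: "z \<in> ?B" for z
  proof -
    have "((\<lambda>z. integral (cbox 0 1) (f z)) has_derivative
        blinfun_apply (integral (cbox 0 1) (\<lambda>s. Blinfun (F z s)))) (at z within ?B)"
    proof (rule leibniz_rule)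
      show "f z integrable_on cbox 0 1" if "z \<in> ?B" for z
        using cf[OF that] by (simp add: integrable_continuous_interval)
      show "((\<lambda>z. f z s) has_derivative blinfun_apply (Blinfun (F z s))) (at z within ?B)"
        if "z \<in> ?B" "s \<in> cbox 0 1" for z s
        using df[of z s] bl[of z s] that has_derivative_at_withinI by fastforce
    qed (use cBF z in auto)
    moreover have "blinfun_apply (integral (cbox 0 1) (\<lambda>s. Blinfun (F z s))) = (\<lambda>v. \<omega> z \<bullet> v)"
    proof
      fix v
      have int: "(\<lambda>s. Blinfun (F z s)) integrable_on {0..1}"
        using slice[OF cBF z] by (auto intro: integrable_continuous_interval)
      have "blinfun_apply (integral {0..1} (\<lambda>s. Blinfun (F z s))) v = integral {0..1} (\<lambda>s. F z s v)"
      proof -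
        have "integral {0..1} (\<lambda>s. F z s v) = integral {0..1} ((\<lambda>b. blinfun_apply b v) \<circ> (\<lambda>s. Blinfun (F z s)))"
          by (rule integral_cong) (simp add: bl[OF z])
        also have "\<dots> = blinfun_apply (integral {0..1} (\<lambda>s. Blinfun (F z s))) v"
          by (rule integral_linear[OF int]) (rule blinfun.bounded_linear_left)
        finally show ?thesis by simp
      qed
      also have "\<dots> = \<omega> z \<bullet> v"
      proof (rule integral_unique)
        \<comment> \<open>Closedness exchanges v and z - z0 in the first term of \<open>F\<close>,
          which thereby becomes a total derivative in s. Its integral is the boundary value at s =
          1, namely \<open>\<omega> z \<bullet> v\<close>.\<close>
        have "((\<lambda>s. s * (\<omega> (p z s) \<bullet> v)) has_vector_derivative F z s v) (at s within {0..1})" if s: "s \<in> {0..1}" for s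
        proof -
          have "((\<lambda>s. p z s) has_derivative (\<lambda>h. h *\<^sub>R (z - z0))) (at s)"
            unfolding p_def by (auto intro!: derivative_eq_intros)
          from diff_chain_at[OF this dw[OF pB[OF z s]]]
          have "((\<lambda>s. \<omega> (p z s)) has_derivative (\<lambda>h. h *\<^sub>R ?D (p z s) (z - z0))) (at s)"
            using linear_scale[OF has_derivative_linear[OF dw[OF pB[OF z s]]]] by (simp add: o_def)
          then have "((\<lambda>s. s * (\<omega> (p z s) \<bullet> v)) has_derivative
              (\<lambda>h. h * F z s v)) (at s)"
            unfolding F_def closed[OF pB[OF z s], of v]
            by (auto intro!: derivative_eq_intros simp: fun_eq_iff algebra_simps)
          then show ?thesis
            by (simp add: has_vector_derivative_def has_derivative_at_withinI)
        qed
        from fundamental_theorem_of_calculus[OF _ this]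
        show "((\<lambda>s. F z s v) has_integral \<omega> z \<bullet> v) {0..1}"
          by (simp add: p_def)
      qed
      finally show "blinfun_apply (integral (cbox 0 1) (\<lambda>s. Blinfun (F z s))) v = \<omega> z \<bullet> v" by simp
    qed
    moreover have "T = (\<lambda>z. integral (cbox 0 1) (f z))" by (simp add: T_def fun_eq_iff)
    ultimately show ?thesis by (simp add: at_within_open[OF z open_ball])
  qed
  have "smooth_on (\<lambda>z. \<omega> z \<bullet> v) ?B" for v
    using w unfolding smooth_on_def by (auto intro: Ck_on_linear[OF _ bounded_linear_inner_left])
  then have "smooth_on T ?B"
    using dT by (intro smooth_onI_derivative[OF open_ball, of z0 r T "\<lambda>z v. \<omega> z \<bullet> v"]) auto
  moreover have "T z0 = 0" by (simp add: T_def f_def[abs_def])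
  ultimately show thesis using dT that by blast
qed

section \<open>Smooth dependence of solutions of ordinary differential equations on parameters\<close>

text \<open>The derivative is uniformly continuous on a compact neighbourhood of K, so the mean
  value inequality gives a linearization error that is small uniformly in the base point. It is
  applied along whole solution curves.\<close>

lemma has_derivative_uniformly_on_compact:
  fixes f :: "'a::euclidean_space \<Rightarrow> 'b::real_normed_vector"
  assumes \<Omega>: "open \<Omega>" and f: "Ck_on (Suc 0) f \<Omega>" and K: "compact K" "K \<subseteq> \<Omega>"
  obtains B where "B \<ge> 0" "\<And>p h. p \<in> K \<Longrightarrow> norm (frechet_derivative f (at p) h) \<le> B * norm h"
    and "\<And>e. e > 0 \<Longrightarrow> \<exists>d>0. \<forall>p\<in>K. \<forall>q. dist p q < d \<longrightarrow>
      q \<in> \<Omega> \<and> norm (f q - f p - frechet_derivative f (at p) (q - p)) \<le> e * norm (q - p)"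
proof -
  let ?D = "\<lambda>x. frechet_derivative f (at x)" and ?F = "\<lambda>x. Blinfun (frechet_derivative f (at x))"
  note cF = C1_continuous_blinfun(1)[OF f] and ap = C1_continuous_blinfun(2)[OF f]
  have "compact (?F ` K)"
    using cF K by (meson compact_continuous_image continuous_on_subset)
  then obtain B where B: "B > 0" "\<And>p. p \<in> K \<Longrightarrow> norm (?F p) \<le> B"
    using compact_imp_bounded bounded_pos by (metis (no_types, lifting) imageI)
  show thesis
  proof (rule that[of B])
    show "norm (?D p h) \<le> B * norm h" if "p \<in> K" for p h
      using norm_blinfun[of "?F p" h] ap[of p] B(2)[OF that] that K(2)
      by (smt (verit, ccfv_SIG) mult_right_mono norm_ge_zero subsetD)
  next
    fix e :: real assume e: "e > 0"
    show "\<exists>d>0. \<forall>p\<in>K. \<forall>q. dist p q < d \<longrightarrow>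
      q \<in> \<Omega> \<and> norm (f q - f p - ?D p (q - p)) \<le> e * norm (q - p)"
    proof (cases "K = {}")
      case False
      obtain \<eta> where \<eta>: "\<eta> > 0" "(\<Union>x\<in>K. cball x \<eta>) \<subseteq> \<Omega>"
        using compact_subset_open_imp_cball_epsilon_subset[OF K(1) \<Omega> K(2)] by blast
      \<comment> \<open>The closed \<eta>-neighbourhood of K, written as a Minkowski sum because a
        sum of compact sets is compact.\<close>
      let ?K = "{x + y |x y. x \<in> K \<and> y \<in> cball 0 \<eta>}"
      have K': "?K = (\<Union>x\<in>K. cball x \<eta>)"
      proof (intro set_eqI iffI)
        fix z assume "z \<in> (\<Union>x\<in>K. cball x \<eta>)"
        then obtain x where "x \<in> K" "dist x z \<le> \<eta>" by auto
        then have "z = x + (z - x)" "z - x \<in> cball 0 \<eta>"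
          by (auto simp: dist_norm norm_minus_commute)
        then show "z \<in> ?K" using \<open>x \<in> K\<close> by blast
      next
        fix z assume "z \<in> ?K"
        then obtain x y where "z = x + y" "x \<in> K" "norm y \<le> \<eta>" by auto
        then show "z \<in> (\<Union>x\<in>K. cball x \<eta>)" by (auto simp: dist_norm intro!: bexI[of _ x])
      qed
      have "continuous_on ?K ?F" unfolding K' by (rule continuous_on_subset[OF cF \<eta>(2)])
      then have "uniformly_continuous_on ?K ?F"
        using compact_sums[OF K(1) compact_cball] by (rule compact_uniformly_continuous)
      then obtain d0 where d0: "d0 > 0" "\<forall>p\<in>?K. \<forall>q\<in>?K. dist q p < d0 \<longrightarrow> dist (?F q) (?F p) < e"
        using e unfolding uniformly_continuous_on_def by blast
      show ?thesis
      proof (intro exI[of _ "min d0 \<eta>"] conjI ballI allI impI)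
        show "min d0 \<eta> > 0" using d0 \<eta> by simp
        fix p q assume p: "p \<in> K" and q: "dist p q < min d0 \<eta>"
        have sub: "ball p (min d0 \<eta>) \<subseteq> \<Omega>"
          using \<eta>(2) p by (force simp: subset_iff)
        then show "q \<in> \<Omega>" using q by auto
        have "norm (f q - f p - ?D p (q - p)) \<le> norm (q - p) * e"
        proof (rule differentiable_bound_linearization[where S = "ball p (min d0 \<eta>)" and ?x0.0 = p and f' = ?D])
          show "p + t *\<^sub>R (q - p) \<in> ball p (min d0 \<eta>)" if "t \<in> {0..1}" for t
          proof -
            have "norm (t *\<^sub>R (q - p)) \<le> norm (q - p)"
              using that by (simp add: mult_left_le_one_le)
            then show ?thesis using q by (simp add: dist_norm norm_minus_commute)
          qed
          show "(f has_derivative ?D x) (at x within ball p (min d0 \<eta>))" if "x \<in> ball p (min d0 \<eta>)" for x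
            using Ck_on_has_derivative[OF f] sub that has_derivative_at_withinI by blast
          show "onorm (?D x - ?D p) \<le> e" if x: "x \<in> ball p (min d0 \<eta>)" for x
          proof -
            have "x \<in> ?K" "p \<in> ?K" "dist x p < d0"
              using x p \<eta>(1) unfolding K' by (auto simp: dist_commute intro!: bexI[of _ p])
            then have "dist (?F x) (?F p) < e" using d0(2) by blast
            then have "norm (?F x - ?F p) < e" by (simp add: dist_norm)
            moreover have "blinfun_apply (?F x - ?F p) = ?D x - ?D p"
            proof -
              have "x \<in> \<Omega>" "p \<in> \<Omega>" using x p sub K(2) by blast+
              then show ?thesis by (simp add: ap fun_eq_iff blinfun.diff_left)
            qed
            ultimately show ?thesis by (simp add: norm_blinfun.rep_eq)
          qed
        qed (use d0 \<eta> in auto)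
        then show "norm (f q - f p - ?D p (q - p)) \<le> e * norm (q - p)" by (simp add: mult.commute)
      qed
    qed (auto intro: exI[of _ 1])
  qed (use B in auto)
qed

lemma onorm_scaleR_le: "norm v \<le> c \<Longrightarrow> onorm (\<lambda>k::real. k *\<^sub>R v) \<le> c"
  by (intro onorm_le) (simp add: mult.commute[of c] mult_left_mono)

text \<open>At a point where the norm of y is maximal, the mean value inequality over a time of at
  most 1 bounds that maximum by the initial norm plus half the maximum plus e. Absorbing the half on
  the left produces the factors 2.\<close>

lemma ode_growth:
  fixes y :: "real \<Rightarrow> 'a::real_normed_vector"
  assumes r: "0 \<le> r" "r \<le> 1"
    and y: "\<And>t. \<bar>t\<bar> \<le> r \<Longrightarrow> (y has_vector_derivative f t) (at t)"
    and f: "\<And>t. \<bar>t\<bar> \<le> r \<Longrightarrow> norm (f t) \<le> norm (y t) / 2 + e"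
    and t: "\<bar>t\<bar> \<le> r"
  shows "norm (y t) \<le> 2 * norm (y 0) + 2 * e"
proof -
  have "continuous_on {-r..r} (\<lambda>s. norm (y s))"
    by (intro continuous_on_norm continuous_at_imp_continuous_on ballI has_vector_derivative_continuous[OF y]) auto
  then obtain m where m: "m \<in> {-r..r}" "\<And>s. s \<in> {-r..r} \<Longrightarrow> norm (y s) \<le> norm (y m)"
    using continuous_attains_sup[of "{-r..r}" "\<lambda>s. norm (y s)"] r by auto
  let ?c = "norm (y m) / 2 + e"
  have c: "norm (f s) \<le> ?c" if "s \<in> {-r..r}" for s
  proof -
    have "\<bar>s\<bar> \<le> r" using that by auto
    from f[OF this] m(2)[OF that] show ?thesis by simp
  qed
  have c0: "?c \<ge> 0" using c[of 0] r norm_ge_zero[of "f 0"] by (smt (verit) atLeastAtMost_iff)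
  have "norm (y m - y 0) \<le> ?c * norm (m - 0)"
  proof (rule differentiable_bound[where S = "{-r..r}" and f' = "\<lambda>t h. h *\<^sub>R f t"])
    show "(y has_derivative (\<lambda>h. h *\<^sub>R f t)) (at t within {-r..r})" if "t \<in> {-r..r}" for t
      using y[of t] that unfolding has_vector_derivative_def by (auto intro: has_derivative_at_withinI)
    show "onorm (\<lambda>h. h *\<^sub>R f t) \<le> ?c" if "t \<in> {-r..r}" for t
      using c[OF that] by (rule onorm_scaleR_le)
  qed (use m r in auto)
  also have "\<dots> \<le> ?c * 1"
    using m(1) r c0 by (intro mult_left_mono) auto
  finally have "norm (y m) \<le> norm (y 0) + ?c"
    using norm_triangle_sub[of "y m" "y 0"] by simp
  moreover have "t \<in> {-r..r}" using t by auto
  ultimately show ?thesis using m(2)[of t] by simp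
qed

text \<open>Picard iteration on bounded continuous curves: with Lipschitz constant 1/2 and time at
  most 1 the integral operator contracts by 1/2, so one application of Banach's theorem covers the
  whole interval. The Lipschitz bound on all of space removes any question of escape.\<close>

lemma ode_existence:
  fixes N :: "real \<Rightarrow> 'a::euclidean_space \<Rightarrow> 'a"
  assumes R: "0 < R" "R \<le> 1" and N: "continuous_on ({-R..R} \<times> UNIV) (\<lambda>(t, x). N t x)"
    and lip: "\<And>t a b. \<bar>t\<bar> \<le> R \<Longrightarrow> norm (N t a - N t b) \<le> norm (a - b) / 2"
  obtains x where "x 0 = x0" "\<And>t. \<bar>t\<bar> < R \<Longrightarrow> (x has_vector_derivative N t (x t)) (at t)"
proof -
  let ?I = "{-R..R}"
  have cN: "continuous_on ?I (\<lambda>t. N t (apply_bcontfun g t))" for g :: "real \<Rightarrow>\<^sub>C 'a"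
  proof -
    have "continuous_on ?I (\<lambda>t. case (t, apply_bcontfun g t) of (t, x) \<Rightarrow> N t x)"
      by (rule continuous_on_compose2[OF N]) (auto intro!: continuous_intros)
    then show ?thesis by simp
  qed
  have "\<exists>F. \<forall>t\<in>?I. (F has_vector_derivative N t (apply_bcontfun g t)) (at t within ?I)" for g :: "real \<Rightarrow>\<^sub>C 'a"
    using antiderivative_continuous[OF cN] by metis
  then obtain F where F: "\<And>g t. t \<in> ?I \<Longrightarrow> (F g has_vector_derivative N t (apply_bcontfun g t)) (at t within ?I)"
    by metis
  \<comment> \<open>Clamping the time extends the antiderivative by constants beyond the interval,
    so that it becomes an element of the complete space of bounded continuous functions on the
    line.\<close>
  have "\<exists>h::real \<Rightarrow>\<^sub>C 'a. \<forall>t. apply_bcontfun h t = x0 + F g (clamp (-R) R t) - F g 0" for g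
  proof -
    have "continuous_on ?I (F g)"
      unfolding continuous_on_eq_continuous_within using has_vector_derivative_continuous[OF F] by blast
    then have "continuous_on (cbox (-R) R) (\<lambda>t. x0 + F g t - F g 0)"
      by (auto intro!: continuous_intros)
    then obtain h :: "real \<Rightarrow>\<^sub>C 'a" where "\<And>t. apply_bcontfun h t = x0 + F g (clamp (-R) R t) - F g 0"
      by (rule continuous_on_cbox_bcontfunE) blast
    then show ?thesis by blast
  qed
  then obtain T where T: "\<And>g t. apply_bcontfun (T g) t = x0 + F g (clamp (-R) R t) - F g 0"
    by metis
  have cl: "clamp (-R) R t \<in> ?I" for t
    using clamp_in_interval[of "-R" R t] R by simp
  have "dist (T g) (T h) \<le> 1/2 * dist g h" for g h
  proof (rule dist_bound)
    fix t
    let ?s = "clamp (-R) R t"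
    have "norm ((F g ?s - F h ?s) - (F g 0 - F h 0)) \<le> (dist g h / 2) * norm (?s - 0)"
    proof (rule differentiable_bound[where S = ?I and
          f' = "\<lambda>t k. k *\<^sub>R (N t (apply_bcontfun g t) - N t (apply_bcontfun h t))"])
      fix s assume s: "s \<in> ?I"
      show "((\<lambda>s. F g s - F h s) has_derivative
          (\<lambda>k. k *\<^sub>R (N s (apply_bcontfun g s) - N s (apply_bcontfun h s)))) (at s within ?I)"
        using has_vector_derivative_diff[OF F[OF s] F[OF s]] by (simp add: has_vector_derivative_def)
      have "norm (N s (apply_bcontfun g s) - N s (apply_bcontfun h s)) \<le> dist g h / 2"
      proof -
        have "\<bar>s\<bar> \<le> R" using s by auto
        from lip[OF this, of "apply_bcontfun g s" "apply_bcontfun h s"] dist_bounded[of g s h]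
        show ?thesis by (simp add: dist_norm)
      qed
      then show "onorm (\<lambda>k. k *\<^sub>R (N s (apply_bcontfun g s) - N s (apply_bcontfun h s))) \<le> dist g h / 2"
        by (rule onorm_scaleR_le)
    qed (use cl R in auto)
    also have "\<dots> \<le> (dist g h / 2) * 1"
      using cl[of t] R by (intro mult_left_mono) auto
    finally show "dist (apply_bcontfun (T g) t) (apply_bcontfun (T h) t) \<le> 1/2 * dist g h"
      by (simp add: T dist_norm algebra_simps)
  qed
  then obtain g where g: "T g = g"
    using banach_fix_type[of "1/2" T] by auto
  have clid: "clamp (-R) R t = t" if "t \<in> ?I" for t
    using clamp_cancel_cbox[of t "-R" R] that by simp
  have gt: "apply_bcontfun g t = x0 + F g t - F g 0" if "t \<in> ?I" for t
    using T[of g t] clid[OF that] g by simp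
  show thesis
  proof (rule that[of "apply_bcontfun g"])
    show "apply_bcontfun g 0 = x0" using gt[of 0] R by simp
    fix t :: real assume t: "\<bar>t\<bar> < R"
    then have ti: "t \<in> ?I" "t \<in> {-R<..<R}" by auto
    have "((\<lambda>t. x0 + F g t - F g 0) has_vector_derivative N t (apply_bcontfun g t)) (at t within ?I)"
      using F[OF ti(1), of g] by (auto intro!: derivative_eq_intros)
    then have "((\<lambda>t. x0 + F g t - F g 0) has_vector_derivative N t (apply_bcontfun g t)) (at t within {-R<..<R})"
      by (rule has_vector_derivative_within_subset) auto
    then have "((\<lambda>t. x0 + F g t - F g 0) has_vector_derivative N t (apply_bcontfun g t)) (at t)"
      using at_within_open[OF ti(2)] by simp
    then show "(apply_bcontfun g has_vector_derivative N t (apply_bcontfun g t)) (at t)"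
      by (rule has_vector_derivative_transform_within_open[where S = "{-R<..<R}"])
        (use ti gt in auto)
  qed
qed

text \<open>The time interval is shorter than 1 and the Lipschitz constant is 1/2, so that solutions are
  compared by the supremum norm alone; no Gronwall inequality is needed.\<close>

definition ode_family ::
  "('z::euclidean_space \<times> real \<times> 'a::euclidean_space) set \<Rightarrow> 'z set \<Rightarrow> real
    \<Rightarrow> ('z \<times> real \<times> 'a \<Rightarrow> 'a) \<Rightarrow> ('z \<Rightarrow> 'a) \<Rightarrow> ('z \<Rightarrow> real \<Rightarrow> 'a) \<Rightarrow> bool" where
  "ode_family \<Omega> Z R N x0 x \<longleftrightarrow> open \<Omega> \<and> open Z \<and> 0 < R \<and> R \<le> 1 \<and>
     (\<forall>z\<in>Z. x z 0 = x0 z) \<and>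
     (\<forall>z\<in>Z. \<forall>t. \<bar>t\<bar> < R \<longrightarrow> (z, t, x z t) \<in> \<Omega> \<and> (x z has_vector_derivative N (z, t, x z t)) (at t)) \<and>
     (\<forall>z t a b. (z, t, a) \<in> \<Omega> \<longrightarrow> (z, t, b) \<in> \<Omega> \<longrightarrow> norm (N (z, t, a) - N (z, t, b)) \<le> norm (a - b) / 2)"

lemma ode_family_solution_continuous:
  assumes "ode_family \<Omega> Z R N x0 x" "z \<in> Z" "r < R"
  shows "continuous_on {-r..r} (x z)"
proof (intro continuous_at_imp_continuous_on ballI)
  fix t assume "t \<in> {-r..r}"
  then have "(x z has_vector_derivative N (z, t, x z t)) (at t)"
    using assms by (auto simp: ode_family_def)
  then show "isCont (x z) t" by (rule has_vector_derivative_continuous)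
qed

text \<open>The difference of the two right-hand sides splits into a Lipschitz part at the same
  parameter and a part evaluated along the fixed curve \<open>x z1\<close>. The latter is small
  uniformly in time, by compactness of the time interval, and \<open>ode_growth\<close> does the
  rest.\<close>

lemma ode_family_uniform:
  assumes ode: "ode_family \<Omega> Z R N x0 x" and N: "continuous_on \<Omega> N" and x0: "continuous_on Z x0"
    and z1: "z1 \<in> Z" and r: "r < R" and e: "e > 0"
  obtains d where "d > 0" "ball z1 d \<subseteq> Z"
    "\<And>z t. dist z1 z < d \<Longrightarrow> \<bar>t\<bar> \<le> r \<Longrightarrow> norm (x z t - x z1 t) \<le> e"
proof -
  note o = ode[unfolded ode_family_def]
  define C where "C = (\<lambda>t. (z1, t, x z1 t)) ` {-r..r}"
  have cx: "continuous_on {-r..r} (x z1)"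
    using ode_family_solution_continuous[OF ode z1 r] .
  then have C: "compact C" "C \<subseteq> \<Omega>"
    unfolding C_def using o z1 r by (auto intro!: compact_continuous_image continuous_intros)
  then obtain \<eta> where \<eta>: "\<eta> > 0" "(\<Union>p\<in>C. ball p \<eta>) \<subseteq> \<Omega>"
    using o by (metis compact_subset_open_imp_ball_epsilon_subset)
  let ?U = "ball z1 \<eta> \<inter> Z"
  have in_\<Omega>: "(z, t, x z1 t) \<in> \<Omega>" if "z \<in> ?U" "\<bar>t\<bar> \<le> r" for z t
  proof -
    have "(z1, t, x z1 t) \<in> C" using that unfolding C_def by (intro image_eqI[of _ _ t]) auto
    moreover have "(z, t, x z1 t) \<in> ball (z1, t, x z1 t) \<eta>"
      using that by (simp add: dist_Pair_Pair)
    ultimately show ?thesis using \<eta>(2) by blast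
  qed
  have "continuous_on (?U \<times> {-r..r}) (\<lambda>(z, t). N (z, t, x z1 t))"
    unfolding split_beta
    by (rule continuous_on_compose2[OF N])
      (use in_\<Omega> in \<open>auto intro!: continuous_intros continuous_on_compose2[OF cx]\<close>)
  \<comment> \<open>\<open>ode_growth\<close> doubles both the forcing and the initial difference; a
    quarter of e for each adds up to e.\<close>
  then obtain V where V: "z1 \<in> V" "open V"
    "\<forall>z\<in>V \<inter> ?U. \<forall>t\<in>{-r..r}. dist (N (z, t, x z1 t)) (N (z1, t, x z1 t)) \<le> e / 4"
    by (rule continuous_on_prod_compactE[where e = "e / 4" and ?x0.0 = z1]) (use e \<eta> z1 in auto)
  obtain d1 where d1: "d1 > 0" "\<And>z. z \<in> Z \<Longrightarrow> dist z z1 < d1 \<Longrightarrow> dist (x0 z) (x0 z1) < e / 4"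
    using x0 z1 e unfolding continuous_on_iff by (metis zero_less_divide_iff zero_less_numeral)
  have "open (V \<inter> ?U \<inter> ball z1 d1)" "z1 \<in> V \<inter> ?U \<inter> ball z1 d1"
    using V o z1 \<eta> d1 by auto
  then obtain d where d: "d > 0" "ball z1 d \<subseteq> V \<inter> ?U \<inter> ball z1 d1"
    using open_contains_ball by blast
  show thesis
  proof (rule that[OF d(1)])
    show "ball z1 d \<subseteq> Z" using d by blast
    fix z t assume "dist z1 z < d" and t: "\<bar>t\<bar> \<le> r"
    then have z: "z \<in> V \<inter> ?U" "z \<in> Z" "dist z z1 < d1" using d(2) by (auto simp: dist_commute)
    have "norm (x z t - x z1 t) \<le> 2 * norm (x z 0 - x z1 0) + 2 * (e / 4)"
    proof (rule ode_growth[where y = "\<lambda>t. x z t - x z1 t" and r = r and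
          f = "\<lambda>t. N (z, t, x z t) - N (z1, t, x z1 t)"])
      show "((\<lambda>t. x z t - x z1 t) has_vector_derivative N (z, s, x z s) - N (z1, s, x z1 s)) (at s)"
        if "\<bar>s\<bar> \<le> r" for s
        using o z z1 r that by (intro has_vector_derivative_diff) auto
      show "norm (N (z, s, x z s) - N (z1, s, x z1 s)) \<le> norm (x z s - x z1 s) / 2 + e / 4" if s: "\<bar>s\<bar> \<le> r" for s
      proof -
        have "norm (N (z, s, x z s) - N (z, s, x z1 s)) \<le> norm (x z s - x z1 s) / 2"
          using o in_\<Omega>[of z s] z s r by auto
        moreover have "norm (N (z, s, x z1 s) - N (z1, s, x z1 s)) \<le> e / 4"
        proof -
          have "s \<in> {-r..r}" using s by auto
          with V(3) z have "dist (N (z, s, x z1 s)) (N (z1, s, x z1 s)) \<le> e / 4" by blast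
          then show ?thesis by (simp add: dist_norm)
        qed
        ultimately show ?thesis
          using norm_triangle_ineq[of "N (z, s, x z s) - N (z, s, x z1 s)" "N (z, s, x z1 s) - N (z1, s, x z1 s)"] by simp
      qed
    qed (use r o t in auto)
    also have "norm (x z 0 - x z1 0) \<le> e / 4"
      using o z z1 d1(2)[of z] by (auto simp: dist_norm)
    finally show "norm (x z t - x z1 t) \<le> e" by simp
  qed
qed

lemma ode_family_continuous:
  assumes ode: "ode_family \<Omega> Z R N x0 x" and N: "continuous_on \<Omega> N" and x0: "continuous_on Z x0"
  shows "continuous_on (Z \<times> {-R<..<R}) (\<lambda>(z, t). x z t)"
  unfolding continuous_on_iff
proof (intro ballI allI impI)
  fix p and e :: real assume p: "p \<in> Z \<times> {-R<..<R}" and e: "e > 0"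
  note o = ode[unfolded ode_family_def]
  obtain z1 t1 where p1: "p = (z1, t1)" "z1 \<in> Z" "\<bar>t1\<bar> < R" using p by (cases p) auto
  define r where "r = (\<bar>t1\<bar> + R) / 2"
  have r: "r < R" "\<bar>t1\<bar> < r" using p1 by (auto simp: r_def)
  obtain d1 where d1: "d1 > 0" "\<And>z t. dist z1 z < d1 \<Longrightarrow> \<bar>t\<bar> \<le> r \<Longrightarrow> norm (x z t - x z1 t) \<le> e / 3"
    by (rule ode_family_uniform[OF ode N x0 p1(2) r(1), of "e/3"]) (use e in auto)
  have "isCont (x z1) t1"
    using o p1 has_vector_derivative_continuous by blast
  then obtain d2 where d2: "d2 > 0" "\<And>t. dist t t1 < d2 \<Longrightarrow> dist (x z1 t) (x z1 t1) < e / 3"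
    using e unfolding continuous_at_eps_delta by (metis zero_less_divide_iff zero_less_numeral)
  show "\<exists>d>0. \<forall>q\<in>Z \<times> {-R<..<R}. dist q p < d \<longrightarrow>
      dist (case q of (z, t) \<Rightarrow> x z t) (case p of (z, t) \<Rightarrow> x z t) < e"
  proof (intro exI[of _ "min (min d1 d2) (r - \<bar>t1\<bar>)"] conjI ballI impI)
    fix q assume q: "q \<in> Z \<times> {-R<..<R}" "dist q p < min (min d1 d2) (r - \<bar>t1\<bar>)"
    obtain z t where zt: "q = (z, t)" by (cases q)
    have "dist z z1 \<le> dist q p" "dist t t1 \<le> dist q p"
      using dist_fst_le[of q p] dist_snd_le[of q p] by (auto simp: zt p1)
    then have "dist z1 z < d1" "dist t t1 < d2" "\<bar>t\<bar> \<le> r"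
      using q(2) by (auto simp: dist_commute dist_real_def)
    then have "norm (x z t - x z1 t) \<le> e / 3" "dist (x z1 t) (x z1 t1) < e / 3"
      using d1 d2 by auto
    then show "dist (case q of (z, t) \<Rightarrow> x z t) (case p of (z, t) \<Rightarrow> x z t) < e"
      using e norm_triangle_ineq[of "x z t - x z1 t" "x z1 t - x z1 t1"] by (simp add: zt p1 dist_norm)
  qed (use d1 d2 r in auto)
qed

text \<open>A difference quotient in the state variable is bounded by the Lipschitz constant, hence
  so is its limit. Thus the variational equation inherits the constant 1/2 and falls under the same
  existence and growth results.\<close>

lemma ode_family_contract:
  assumes ode: "ode_family \<Omega> Z R N x0 x" and N: "Ck_on (Suc 0) N \<Omega>" and p: "(z, t, a) \<in> \<Omega>"
  shows "norm (frechet_derivative N (at (z, t, a)) (0, 0, w)) \<le> norm w / 2"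
proof (rule field_le_epsilon)
  fix e :: real assume e: "e > 0"
  note o = ode[unfolded ode_family_def]
  let ?p = "(z, t, a)" and ?D = "frechet_derivative N (at (z, t, a))"
  define e' where "e' = e / (norm w + 1)"
  have n: "norm w + 1 > 0" by (simp add: add_nonneg_pos)
  have e': "e' > 0" "e' * norm w \<le> e"
    using e n by (simp_all add: e'_def field_simps)
  obtain d where d: "d > 0" "\<And>q. dist ?p q < d \<Longrightarrow> q \<in> \<Omega> \<and> norm (N q - N ?p - ?D (q - ?p)) \<le> e' * norm (q - ?p)"
    using has_derivative_uniformly_on_compact[of \<Omega> N "{?p}"] o N p e'(1) by (metis compact_sing empty_subsetI insert_subset singletonI)
  define h where "h = d / (2 * (norm w + 1))"
  have h: "h > 0" using d(1) n by (simp add: h_def)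
  have "h * norm w \<le> h * (norm w + 1)" using h by (simp add: mult_left_mono)
  also have "\<dots> = d / 2" using n by (simp add: h_def field_simps)
  also have "\<dots> < d" using d(1) by simp
  finally have hw: "h * norm w < d" .
  let ?q = "(z, t, a + h *\<^sub>R w)"
  have q: "?q - ?p = h *\<^sub>R (0, 0, w)" by simp
  have "dist ?p ?q < d" using hw h by (simp add: dist_Pair_Pair dist_norm)
  then have 1: "?q \<in> \<Omega>" "norm (N ?q - N ?p - ?D (h *\<^sub>R (0, 0, w))) \<le> e' * norm (h *\<^sub>R (0::'a, 0::real, w))"
    using d(2)[of ?q] unfolding q by auto
  have "norm (N ?q - N ?p) \<le> norm (a + h *\<^sub>R w - a) / 2"
    using o 1(1) p by blast
  then have 2: "norm (N ?q - N ?p) \<le> h * norm w / 2" using h by simp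
  have "h * norm (?D (0, 0, w)) = norm (?D (h *\<^sub>R (0, 0, w)))"
    using h linear_scale[OF has_derivative_linear[OF Ck_on_has_derivative[OF N p]], of h "(0, 0, w)"] by simp
  also have "\<dots> \<le> norm (N ?q - N ?p) + norm (N ?q - N ?p - ?D (h *\<^sub>R (0, 0, w)))"
    using norm_triangle_ineq4[of "N ?q - N ?p" "N ?q - N ?p - ?D (h *\<^sub>R (0, 0, w))"] by simp
  also have "\<dots> \<le> h * norm w / 2 + e' * (h * norm w)"
    using 1(2) 2 h by (simp add: norm_Pair)
  also have "\<dots> = h * (norm w / 2 + e' * norm w)" by (simp add: algebra_simps)
  finally have "norm (?D (0, 0, w)) \<le> norm w / 2 + e' * norm w" using h by simp
  then show "norm (?D (0, 0, w)) \<le> norm w / 2 + e" using e' by simp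
qed

text \<open>The candidate derivative \<open>W\<close> is an argument, so that it can be an explicit
  solution of the variational equation as well as an abstract one. The remainder
  \<open>x y t - x z t - W (y - z) t\<close> obeys \<open>ode_growth\<close> with an initial value
  and a forcing that are small relative to y - z.\<close>

lemma ode_family_differentiable:
  fixes x :: "'z::euclidean_space \<Rightarrow> real \<Rightarrow> 'a::euclidean_space"
  assumes ode: "ode_family \<Omega> Z R N x0 x" and N: "Ck_on (Suc 0) N \<Omega>" and x0: "Ck_on (Suc 0) x0 Z"
    and z: "z \<in> Z" and t: "\<bar>t\<bar> < R"
    and W0: "\<And>v. W v 0 = frechet_derivative x0 (at z) v"
    and W: "\<And>v t. \<bar>t\<bar> < R \<Longrightarrow> (W v has_vector_derivative
        frechet_derivative N (at (z, t, x z t)) (v, 0, W v t)) (at t)"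
    and lin: "linear (\<lambda>v. W v t)"
  shows "((\<lambda>z. x z t) has_derivative (\<lambda>v. W v t)) (at z)"
proof -
  note o = ode[unfolded ode_family_def]
  let ?D = "\<lambda>t. frechet_derivative N (at (z, t, x z t))"
  define r where "r = \<bar>t\<bar>"
  have r: "0 \<le> r" "r < R" "r \<le> 1" using t o by (auto simp: r_def)
  define K where "K = (\<lambda>t. (z, t, x z t)) ` {-r..r}"
  have cx: "continuous_on {-r..r} (x z)"
    using ode_family_solution_continuous[OF ode z r(2)] .
  then have K: "compact K" "K \<subseteq> \<Omega>"
    unfolding K_def using o z r by (auto intro!: compact_continuous_image continuous_intros)
  have Kmem: "(z, s, x z s) \<in> K" if "\<bar>s\<bar> \<le> r" for s
    using that unfolding K_def by (intro image_eqI[of _ _ s]) auto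
  have \<Omega>: "open \<Omega>" using o by blast
  obtain B where B: "B \<ge> 0" "\<And>p h. p \<in> K \<Longrightarrow> norm (frechet_derivative N (at p) h) \<le> B * norm h"
    "\<And>e. e > 0 \<Longrightarrow> \<exists>d>0. \<forall>p\<in>K. \<forall>q. dist p q < d \<longrightarrow>
      q \<in> \<Omega> \<and> norm (N q - N p - frechet_derivative N (at p) (q - p)) \<le> e * norm (q - p)"
    using has_derivative_uniformly_on_compact[OF \<Omega> N K] by metis
  have linD: "linear (?D s)" if "\<bar>s\<bar> < R" for s
    using Ck_on_has_derivative[OF N] o z that has_derivative_linear by blast
  have dx0: "(x0 has_derivative frechet_derivative x0 (at z)) (at z)"
    using Ck_on_has_derivative[OF x0 z] .
  then obtain L where L: "L \<ge> 0" "\<And>v. norm (frechet_derivative x0 (at z) v) \<le> L * norm v"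
    using bounded_linear.nonneg_bounded[OF has_derivative_bounded_linear[OF dx0]] by (metis mult.commute)
  \<comment> \<open>C will be a Lipschitz constant of the solution in the parameter:
    \<open>ode_growth\<close> doubles the initial rate L + 1 and the forcing rate B + 1, where each
    1 covers a linearization error.\<close>
  define C where "C = 2 * (L + 1) + 2 * (B + 1)"
  have C: "C \<ge> 0" using L B by (simp add: C_def)
  have est: "\<exists>d>0. \<forall>y. norm (y - z) < d \<longrightarrow> norm (x y t - x z t - W (y - z) t) \<le> e * norm (y - z)"
    if e: "e > 0" for e
  proof -
    \<comment> \<open>The bound by 1 serves the Lipschitz estimate; the other one matches the final
      sum, 2 e1 from the initial value and 2 e1 (1 + C) from the forcing.\<close>
    define e1 where "e1 = min 1 (e / (2 + 2 * (1 + C)))"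
    have c: "2 + 2 * (1 + C) > 0" using C by simp
    have "e1 \<le> e / (2 + 2 * (1 + C))" by (simp add: e1_def)
    then have e1: "e1 > 0" "e1 \<le> 1" "e1 * (2 + 2 * (1 + C)) \<le> e"
      using e c by (simp_all add: e1_def pos_le_divide_eq[OF c] del: distrib_left_numeral)
    obtain d1 where d1: "d1 > 0" "\<And>p q. p \<in> K \<Longrightarrow> dist p q < d1 \<Longrightarrow>
      q \<in> \<Omega> \<and> norm (N q - N p - frechet_derivative N (at p) (q - p)) \<le> e1 * norm (q - p)"
      using B(3)[OF e1(1)] by blast
    obtain d2 where d2: "d2 > 0" "ball z d2 \<subseteq> Z"
      "\<And>y s. dist z y < d2 \<Longrightarrow> \<bar>s\<bar> \<le> r \<Longrightarrow> norm (x y s - x z s) \<le> d1 / 3"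
      by (rule ode_family_uniform[OF ode Ck_on_imp_continuous_on[OF N] Ck_on_imp_continuous_on[OF x0] z r(2), of "d1 / 3"])
        (use d1(1) in auto)
    obtain d3 where d3: "d3 > 0" "\<And>y. norm (y - z) < d3 \<Longrightarrow>
      norm (x0 y - x0 z - frechet_derivative x0 (at z) (y - z)) \<le> e1 * norm (y - z)"
      using dx0 e1(1) unfolding has_derivative_at_alt by blast
    show ?thesis
    proof (intro exI[of _ "min (min d1 d2) d3 / 3"] conjI allI impI)
      show "min (min d1 d2) d3 / 3 > 0" using d1 d2 d3 by simp
      fix y assume "norm (y - z) < min (min d1 d2) d3 / 3"
      then have y: "norm (y - z) < d1 / 3" "dist z y < d2" "norm (y - z) < d3"
        using norm_ge_zero[of "y - z"] d1(1) d2(1) d3(1) by (auto simp: dist_norm norm_minus_commute)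
      then have yZ: "y \<in> Z" using d2(2) by auto
      let ?h = "y - z"
      have N_est: "q \<in> \<Omega>" "norm (N q - N (z, s, x z s) - ?D s (?h, 0, a)) \<le> e1 * (norm ?h + norm a)"
        if q: "q = (y, s, x z s + a)" and s: "\<bar>s\<bar> \<le> r" and a: "norm a \<le> d1 / 3" for q s a
      proof -
        have p: "(z, s, x z s) \<in> K" using Kmem s .
        have eq: "q - (z, s, x z s) = (?h, 0, a)" by (simp add: q)
        have le: "norm (?h, 0::real, a) \<le> norm ?h + norm a"
          using norm_Pair_le[of ?h "(0::real, a)"] by (simp add: norm_Pair)
        then have "dist (z, s, x z s) q < d1"
          using y(1) a d1(1) by (simp add: dist_norm norm_minus_commute[of _ q] eq)
        from d1(2)[OF p this] show "q \<in> \<Omega>"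
          "norm (N q - N (z, s, x z s) - ?D s (?h, 0, a)) \<le> e1 * (norm ?h + norm a)"
          using e1(1) order_trans[OF _ mult_left_mono[OF le]] unfolding eq by auto
      qed
      have Lip: "norm (x y s - x z s) \<le> C * norm ?h" if s: "\<bar>s\<bar> \<le> r" for s
      proof -
        have "norm (x y s - x z s) \<le> 2 * norm (x y 0 - x z 0) + 2 * ((B + 1) * norm ?h)"
        proof (rule ode_growth[where y = "\<lambda>t. x y t - x z t" and r = r and
              f = "\<lambda>t. N (y, t, x y t) - N (z, t, x z t)"])
          fix s assume s: "\<bar>s\<bar> \<le> r"
          show "((\<lambda>t. x y t - x z t) has_vector_derivative N (y, s, x y s) - N (z, s, x z s)) (at s)"
            using o yZ z s r by (intro has_vector_derivative_diff) auto
          let ?q = "(y, s, x z s)"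
          have q: "?q \<in> \<Omega>" "norm (N ?q - N (z, s, x z s) - ?D s (?h, 0, 0)) \<le> e1 * norm ?h"
            using N_est[of ?q s 0] s d1(1) by auto
          have "norm (N (y, s, x y s) - N ?q) \<le> norm (x y s - x z s) / 2"
            using o q(1) yZ s r by auto
          moreover have "norm (N ?q - N (z, s, x z s)) \<le> (B + 1) * norm ?h"
          proof -
            have "norm (?D s (?h, 0, 0)) \<le> B * norm ?h"
              using B(2)[OF Kmem[OF s], of "(?h, 0, 0)"] by (simp add: norm_Pair)
            moreover have "e1 * norm ?h \<le> norm ?h" using e1 by (simp add: mult_left_le_one_le)
            ultimately show ?thesis
              using q(2) norm_triangle_sub[of "N ?q - N (z, s, x z s)" "?D s (?h, 0, 0)"] by (simp add: algebra_simps)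
          qed
          ultimately show "norm (N (y, s, x y s) - N (z, s, x z s)) \<le> norm (x y s - x z s) / 2 + (B + 1) * norm ?h"
            using norm_triangle_ineq[of "N (y, s, x y s) - N ?q" "N ?q - N (z, s, x z s)"] by simp
        qed (use r s in auto)
        also have "norm (x y 0 - x z 0) \<le> (L + 1) * norm ?h"
        proof -
          have "e1 * norm ?h \<le> norm ?h" using e1 by (simp add: mult_left_le_one_le)
          then show ?thesis
            using o yZ z d3(2)[OF y(3)] L(2)[of ?h]
              norm_triangle_sub[of "x0 y - x0 z" "frechet_derivative x0 (at z) ?h"] by (simp add: algebra_simps)
        qed
        finally show ?thesis by (simp add: C_def algebra_simps)
      qed
      have "norm (x y t - x z t - W ?h t) \<le> 2 * norm (x y 0 - x z 0 - W ?h 0) + 2 * (e1 * (1 + C) * norm ?h)"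
      proof (rule ode_growth[where y = "\<lambda>t. x y t - x z t - W ?h t" and r = r and
            f = "\<lambda>t. N (y, t, x y t) - N (z, t, x z t) - ?D t (?h, 0, W ?h t)"])
        fix s assume s: "\<bar>s\<bar> \<le> r"
        show "((\<lambda>t. x y t - x z t - W ?h t) has_vector_derivative
            N (y, s, x y s) - N (z, s, x z s) - ?D s (?h, 0, W ?h s)) (at s)"
          using o yZ z s r by (intro has_vector_derivative_diff W) auto
        let ?\<delta> = "x y s - x z s"
        have 1: "norm (N (y, s, x y s) - N (z, s, x z s) - ?D s (?h, 0, ?\<delta>)) \<le> e1 * (norm ?h + norm ?\<delta>)"
          using N_est(2)[of "(y, s, x y s)" s ?\<delta>] s d2(3)[OF y(2) s] by simp
        have "e1 * (norm ?h + norm ?\<delta>) \<le> e1 * (norm ?h + C * norm ?h)"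
          using Lip[OF s] e1(1) by (intro mult_left_mono) auto
        then have 2: "norm (N (y, s, x y s) - N (z, s, x z s) - ?D s (?h, 0, ?\<delta>)) \<le> e1 * (1 + C) * norm ?h"
          using 1 by (simp add: algebra_simps)
        \<comment> \<open>Linearity cancels the parameter increment, so this part is controlled by
          the state derivative alone, which is a contraction by 1/2.\<close>
        have "?D s (?h, 0, ?\<delta>) - ?D s (?h, 0, W ?h s) = ?D s (0, 0, ?\<delta> - W ?h s)"
          using linear_diff[OF linD, of s "(?h, 0, ?\<delta>)" "(?h, 0, W ?h s)"] s r by simp
        then have 3: "norm (?D s (?h, 0, ?\<delta>) - ?D s (?h, 0, W ?h s)) \<le> norm (?\<delta> - W ?h s) / 2"
          using ode_family_contract[OF ode N, of z s "x z s"] o z s r by auto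
        show "norm (N (y, s, x y s) - N (z, s, x z s) - ?D s (?h, 0, W ?h s))
            \<le> norm (x y s - x z s - W ?h s) / 2 + e1 * (1 + C) * norm ?h"
          using 2 3 norm_triangle_ineq[of "N (y, s, x y s) - N (z, s, x z s) - ?D s (?h, 0, ?\<delta>)"
              "?D s (?h, 0, ?\<delta>) - ?D s (?h, 0, W ?h s)"] by simp
      qed (use r in \<open>auto simp: r_def\<close>)
      also have "norm (x y 0 - x z 0 - W ?h 0) \<le> e1 * norm ?h"
        using d3(2)[OF y(3)] o yZ z W0 by simp
      finally have "norm (x y t - x z t - W ?h t) \<le> (e1 * (2 + 2 * (1 + C))) * norm ?h"
        by (simp add: algebra_simps)
      also have "\<dots> \<le> e * norm ?h" using e1(3) by (intro mult_right_mono) auto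
      finally show "norm (x y t - x z t - W ?h t) \<le> e * norm ?h" .
    qed
  qed
  have "bounded_linear (\<lambda>v. W v t)" using lin by (simp add: linear_conv_bounded_linear)
  then show ?thesis unfolding has_derivative_at_alt using est by blast
qed

lemma ode_family_mono:
  "ode_family \<Omega> Z R N x0 x \<Longrightarrow> 0 < R' \<Longrightarrow> R' \<le> R \<Longrightarrow> ode_family \<Omega> Z R' N x0 x"
  unfolding ode_family_def by auto

lemma Ck_on_Suc_imp_C1: "Ck_on (Suc k) f S \<Longrightarrow> Ck_on (Suc 0) f S"
  by (auto intro: Ck_on_imp_continuous_on)

text \<open>The derivative of the solution in a parameter direction solves the variational equation, which
  is again of the form considered here, with a coefficient one degree less regular.\<close>

theorem ode_family_Ck:
  fixes x :: "'z::euclidean_space \<Rightarrow> real \<Rightarrow> 'a::euclidean_space"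
  shows "ode_family \<Omega> Z R N x0 x \<Longrightarrow> Ck_on k N \<Omega> \<Longrightarrow> Ck_on k x0 Z \<Longrightarrow>
    Ck_on k (\<lambda>(z, t). x z t) (Z \<times> {-R<..<R})"
proof (induction k arbitrary: \<Omega> R N x0 x)
  case 0
  then show ?case using ode_family_continuous by auto
next
  case (Suc k)
  note ode = Suc.prems(1) and N = Suc.prems(2) and x0 = Suc.prems(3)
  note o = ode[unfolded ode_family_def]
  have N1: "Ck_on (Suc 0) N \<Omega>" and x01: "Ck_on (Suc 0) x0 Z"
    using N x0 by (auto intro: Ck_on_Suc_imp_C1 simp del: Ck_on.simps)
  have Z: "open Z" and \<Omega>: "open \<Omega>" using o by auto
  have oJ: "open (Z \<times> {-R<..<R})" using Z by (simp add: open_Times)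
  have x: "Ck_on k (\<lambda>(z, t). x z t) (Z \<times> {-R<..<R})"
    using Suc.IH[OF ode Ck_on_SucD[OF N] Ck_on_SucD[OF x0]] .
  define D where "D = (\<lambda>z t. frechet_derivative N (at (z, t, x z t)))"
  have linD: "linear (D z t)" if "z \<in> Z" "\<bar>t\<bar> < R" for z t
    unfolding D_def using Ck_on_has_derivative[OF N] o that has_derivative_linear by blast
  \<comment> \<open>The variational equation is linear in its unknown, so its states range over the
    whole space; its coefficients live on the already known solution, of class k by
    induction.\<close>
  let ?\<Omega> = "Z \<times> {-R<..<R} \<times> (UNIV::'a set)"
  have o\<Omega>: "open ?\<Omega>" using Z by (simp add: open_Times)
  have fst_snd_linear: "bounded_linear (fst :: 'z \<times> real \<times> 'a \<Rightarrow> 'z)" "bounded_linear (\<lambda>p :: 'z \<times> real \<times> 'a. fst (snd p))"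
    by (intro bounded_linear_fst bounded_linear_fst_comp bounded_linear_snd)+
  have curve: "Ck_on k (\<lambda>(z, t, w). (z, t, x z t)) ?\<Omega>"
  proof -
    have "Ck_on k (\<lambda>p. case (fst p, fst (snd p)) of (z, t) \<Rightarrow> x z t) ?\<Omega>"
      by (rule Ck_on_compose[OF o\<Omega> oJ _ _ x])
        (auto intro!: Ck_on_bounded_linear_id bounded_linear_Pair fst_snd_linear)
    then have "Ck_on k (\<lambda>p. (fst p, fst (snd p), x (fst p) (fst (snd p)))) ?\<Omega>"
      using fst_snd_linear by (intro Ck_on_Pair o\<Omega>) (auto intro: Ck_on_bounded_linear_id)
    then show ?thesis by (simp add: split_beta')
  qed
  have Dc: "Ck_on k (\<lambda>(z, t, w::'a). D z t c) ?\<Omega>" for c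
  proof -
    have "Ck_on k (\<lambda>p. (\<lambda>q. frechet_derivative N (at q) c) (case p of (z, t, w) \<Rightarrow> (z, t, x z t))) ?\<Omega>"
    proof (rule Ck_on_compose[OF o\<Omega> \<Omega> _ curve])
      show "Ck_on k (\<lambda>q. frechet_derivative N (at q) c) \<Omega>"
        using N unfolding Ck_on.simps(2) by blast
    qed (use o in auto)
    then show ?thesis by (simp add: D_def split_beta')
  qed
  define M where "M v = (\<lambda>(z, t, w). D z t (v, 0, w))" for v
  have DM: "D z t (v, 0, w) = D z t (v, 0, 0) + (\<Sum>b\<in>Basis. (w \<bullet> b) *\<^sub>R D z t (0, 0, b))"
    if "z \<in> Z" "\<bar>t\<bar> < R" for z t v w
  proof -
    have "(v, 0, w) = (v, 0, 0) + (\<Sum>b\<in>Basis. (w \<bullet> b) *\<^sub>R (0::'z, 0::real, b))"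
      by (simp add: sum_prod euclidean_representation)
    then show ?thesis
      by (simp only: linear_add[OF linD[OF that]] linear_sum[OF linD[OF that]] linear_scale[OF linD[OF that]])
  qed
  have CM: "Ck_on k (M v) ?\<Omega>" for v
  proof (rule Ck_on_cong[OF o\<Omega>])
    show "Ck_on k (\<lambda>p. (\<lambda>(z, t, w). D z t (v, 0, 0)) p +
        (\<Sum>b\<in>Basis. (snd (snd p) \<bullet> b) *\<^sub>R (\<lambda>(z, t, w). D z t (0, 0, b)) p)) ?\<Omega>"
      by (intro Ck_on_add Ck_on_sum Ck_on_scaleR Dc o\<Omega> Ck_on_bounded_linear_id
          bounded_linear_inner_left_comp bounded_linear_snd_comp bounded_linear_snd)
  next
    fix p assume "p \<in> ?\<Omega>"
    then obtain z t w where p: "p = (z, t, w)" "z \<in> Z" "\<bar>t\<bar> < R" by (cases p) auto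
    show "(\<lambda>(z, t, w). D z t (v, 0, 0)) p +
        (\<Sum>b\<in>Basis. (snd (snd p) \<bullet> b) *\<^sub>R (\<lambda>(z, t, w). D z t (0, 0, b)) p) = M v p"
      unfolding M_def p(1) prod.case snd_conv by (rule DM[OF p(2,3), symmetric])
  qed
  show ?case
  proof (rule Ck_on_local)
    fix p assume p: "p \<in> Z \<times> {-R<..<R}"
    obtain z1 t1 where p1: "p = (z1, t1)" "z1 \<in> Z" "\<bar>t1\<bar> < R" using p by (cases p) auto
    \<comment> \<open>The existence result wants coefficients that are continuous on a closed time
      interval, hence the retreat to a smaller radius that still contains t1.\<close>
    define R' where "R' = (\<bar>t1\<bar> + R) / 2"
    have R': "0 < R'" "R' < R" "\<bar>t1\<bar> < R'" "R' \<le> 1" using p1 o by (auto simp: R'_def)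
    let ?T = "Z \<times> {-R'<..<R'}"
    have oT: "open ?T" using Z by (simp add: open_Times)
    have lip: "norm (M v (z, t, a) - M v (z, t, b)) \<le> norm (a - b) / 2" if "z \<in> Z" "\<bar>t\<bar> < R" for v z t a b
    proof -
      have "M v (z, t, a) - M v (z, t, b) = D z t (0, 0, a - b)"
        using linear_diff[OF linD[OF that], of "(v, 0, a)" "(v, 0, b)"] by (simp add: M_def)
      then show ?thesis
        using ode_family_contract[OF ode N1, of z t "x z t" "a - b"] o that by (simp add: D_def)
    qed
    have ex: "\<exists>w. w 0 = frechet_derivative x0 (at z) v \<and>
        (\<forall>t. \<bar>t\<bar> < R' \<longrightarrow> (w has_vector_derivative M v (z, t, w t)) (at t))" if z: "z \<in> Z" for z v
    proof -
      have "continuous_on ({-R'..R'} \<times> UNIV) (\<lambda>q. M v (z, q))"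
        using R' z by (intro continuous_on_compose2[OF Ck_on_imp_continuous_on[OF CM]]) (auto intro!: continuous_intros)
      then have c: "continuous_on ({-R'..R'} \<times> UNIV) (\<lambda>(t, w). M v (z, t, w))"
        by (simp add: split_beta')
      have l: "norm (M v (z, t, a) - M v (z, t, b)) \<le> norm (a - b) / 2" if "\<bar>t\<bar> \<le> R'" for t a b
        using lip[OF z] that R' by auto
      show ?thesis
        using ode_existence[OF R'(1,4) c l] by metis
    qed
    define w where "w v z = (SOME w. w 0 = frechet_derivative x0 (at z) v \<and>
        (\<forall>t. \<bar>t\<bar> < R' \<longrightarrow> (w has_vector_derivative M v (z, t, w t)) (at t)))" for v z
    have w: "w v z 0 = frechet_derivative x0 (at z) v"
      "\<bar>t\<bar> < R' \<Longrightarrow> (w v z has_vector_derivative M v (z, t, w v z t)) (at t)" if "z \<in> Z" for z v t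
      using someI_ex[OF ex[OF that, of v]] unfolding w_def by auto
    \<comment> \<open>The solutions \<open>w v z\<close> are chosen separately for each v.
      Superposing those of the basis directions makes the dependence on v linear by construction,
      without an appeal to uniqueness.\<close>
    define W where "W v z t = (\<Sum>b\<in>Basis. (v \<bullet> b) *\<^sub>R w b z t)" for v z t
    have linW: "linear (\<lambda>v. W v z t)" for z t
      unfolding W_def
      by (intro linear_compose_sum ballI linearI) (auto simp: inner_add_left algebra_simps)
    have W0: "W v z 0 = frechet_derivative x0 (at z) v" if "z \<in> Z" for z v
    proof -
      have l: "linear (frechet_derivative x0 (at z))"
        using Ck_on_has_derivative[OF x0 that] has_derivative_linear by blast
      have "frechet_derivative x0 (at z) (\<Sum>b\<in>Basis. (v \<bullet> b) *\<^sub>R b) = W v z 0"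
        by (simp only: linear_sum[OF l] linear_scale[OF l] W_def w(1)[OF that])
      then show ?thesis by (simp add: euclidean_representation)
    qed
    have W': "(W v z has_vector_derivative M v (z, t, W v z t)) (at t)" if "z \<in> Z" "\<bar>t\<bar> < R'" for v z t
    proof -
      have tR: "\<bar>t\<bar> < R" using that R' by simp
      have "(W v z has_vector_derivative (\<Sum>b\<in>Basis. (v \<bullet> b) *\<^sub>R M b (z, t, w b z t))) (at t)"
        unfolding W_def[abs_def]
        by (intro has_vector_derivative_sum bounded_linear.has_vector_derivative[OF bounded_linear_scaleR_right] w that)
      moreover have "(\<Sum>b\<in>Basis. (v \<bullet> b) *\<^sub>R M b (z, t, w b z t)) = M v (z, t, W v z t)"
      proof -
        have "D z t (\<Sum>b\<in>Basis. (v \<bullet> b) *\<^sub>R (b, 0, w b z t)) = (\<Sum>b\<in>Basis. (v \<bullet> b) *\<^sub>R M b (z, t, w b z t))"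
          by (simp only: linear_sum[OF linD[OF that(1) tR]] linear_scale[OF linD[OF that(1) tR]] M_def prod.case)
        moreover have "(\<Sum>b\<in>Basis. (v \<bullet> b) *\<^sub>R (b, 0::real, w b z t)) = (v, 0, W v z t)"
          by (simp add: sum_prod euclidean_representation W_def)
        ultimately show ?thesis by (simp add: M_def)
      qed
      ultimately show ?thesis by simp
    qed
    have "ode_family ?\<Omega> Z R' (M v) (\<lambda>z. frechet_derivative x0 (at z) v) (W v)" for v
      unfolding ode_family_def using o\<Omega> Z R' W0 W' lip by auto
    then have CW: "Ck_on k (\<lambda>(z, t). W v z t) ?T" for v
      using x0 by (intro Suc.IH[OF _ CM]) auto
    have xT: "Ck_on k (\<lambda>(z, t). x z t) ?T"
      by (rule Ck_on_subset[OF x]) (use R' in auto)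
    have CN: "Ck_on k (\<lambda>(z, t). N (z, t, x z t)) ?T"
    proof -
      have "Ck_on k (\<lambda>q. N (fst q, snd q, (\<lambda>(z, t). x z t) q)) ?T"
        using o R' by (intro Ck_on_compose[OF oT \<Omega> _ _ Ck_on_SucD[OF N]] Ck_on_Pair oT xT
            Ck_on_bounded_linear_id bounded_linear_fst bounded_linear_snd) auto
      then show ?thesis by (simp add: split_beta')
    qed
    have der: "((\<lambda>(z, t). x z t) has_derivative (\<lambda>(v, h). W v z t + h *\<^sub>R N (z, t, x z t))) (at (z, t))"
      if zt: "z \<in> Z" "\<bar>t\<bar> < R'" for z t
    proof -
      let ?J = "{-R'<..<R'}"
      have in_T: "(z, t) \<in> Z \<times> ?J" using zt by auto
      have "((\<lambda>(z, t). x z t) has_derivative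
          (\<lambda>(v, h). W v z t + blinfun_apply (blinfun_scaleR_left (N (z, t, x z t))) h)) (at (z, t) within Z \<times> ?J)"
      proof (rule has_derivative_partialsI)
        show "((\<lambda>z. x z t) has_derivative (\<lambda>v. W v z t)) (at z within Z)"
        proof (rule has_derivative_at_withinI, rule ode_family_differentiable[OF ode_family_mono[OF ode] N1 x01 zt])
          show "(W v z has_vector_derivative frechet_derivative N (at (z, t, x z t)) (v, 0, W v z t)) (at t)"
            if "\<bar>t\<bar> < R'" for v t
            using W'[OF zt(1) that, of v] by (simp add: M_def D_def)
        qed (use R' W0 zt linW in auto)
        show "((\<lambda>t. x z t) has_derivative blinfun_apply (blinfun_scaleR_left (N (z, t, x z t)))) (at t within ?J)"
          if "z \<in> Z" "t \<in> ?J" for z t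
        proof -
          have "\<bar>t\<bar> < R" using that R' by auto
          with that(1) o have "(x z has_vector_derivative N (z, t, x z t)) (at t)" by blast
          then show ?thesis by (simp add: has_vector_derivative_def has_derivative_at_withinI)
        qed
        have "continuous_on (Z \<times> ?J) (\<lambda>q. blinfun_scaleR_left ((\<lambda>(z, t). N (z, t, x z t)) q))"
          by (intro continuous_intros Ck_on_imp_continuous_on[OF CN])
        then show "continuous (at (z, t) within Z \<times> ?J) (\<lambda>(z, t). blinfun_scaleR_left (N (z, t, x z t)))"
          using in_T by (auto simp: continuous_on_eq_continuous_within split_beta')
      qed (use zt in auto)
      then show ?thesis using at_within_open[OF in_T oT] by simp
    qed
    have "Ck_on (Suc k) (\<lambda>(z, t). x z t) ?T"
    proof (rule Ck_on_SucI[OF oT])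
      show "((\<lambda>(z, t). x z t) has_derivative
          (\<lambda>(v, h). W v (fst q) (snd q) + h *\<^sub>R N (fst q, snd q, x (fst q) (snd q)))) (at q)" if "q \<in> ?T" for q
        using der[of "fst q" "snd q"] that by auto
      fix v :: "'z \<times> real"
      have "Ck_on k (\<lambda>q. (\<lambda>(z, t). W (fst v) z t) q + snd v *\<^sub>R (\<lambda>(z, t). N (z, t, x z t)) q) ?T"
        by (intro Ck_on_add Ck_on_scaleR Ck_on_const oT CW CN)
      then show "Ck_on k (\<lambda>q. case v of (v, h) \<Rightarrow> W v (fst q) (snd q) + h *\<^sub>R N (fst q, snd q, x (fst q) (snd q))) ?T"
        by (simp add: split_beta')
    qed
    then show "\<exists>T. open T \<and> p \<in> T \<and> Ck_on (Suc k) (\<lambda>(z, t). x z t) T"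
      using oT p1 R' by (intro exI[of _ ?T]) auto
  qed
qed

section \<open>Straightening a vector field\<close>

text \<open>\<open>\<Phi> w\<close> is reached from the point \<open>b w\<close> of the hyperplane
  through z0 by following V for the time \<open>w $ t - T (b w)\<close>. Since T grows at unit rate
  along V, its value on arrival is exactly \<open>w $ t\<close>; and moving w in direction t only
  prolongs the flow, so the t-derivative is V.\<close>

proposition straightening:
  fixes V :: "real ^ 'n \<Rightarrow> real ^ 'n" and T :: "real ^ 'n \<Rightarrow> real" and t :: 'n
  assumes U: "open U" "z0 \<in> U" and V: "smooth_on V U" and Vt: "V z0 $ t \<noteq> 0"
    and T: "smooth_on T U" "T z0 = 0" and TV: "\<And>z. z \<in> U \<Longrightarrow> frechet_derivative T (at z) (V z) = 1"
  obtains d \<Phi> \<Psi> E where "d > 0" "open E" "E \<subseteq> U" "z0 \<in> E"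
    "homeomorphism {w. \<bar>w $ t\<bar> < d \<and> (\<forall>\<alpha>. \<alpha> \<noteq> t \<longrightarrow> \<bar>w $ \<alpha> - z0 $ \<alpha>\<bar> < d)} E \<Phi> \<Psi>"
    "smooth_on \<Phi> {w. \<bar>w $ t\<bar> < d \<and> (\<forall>\<alpha>. \<alpha> \<noteq> t \<longrightarrow> \<bar>w $ \<alpha> - z0 $ \<alpha>\<bar> < d)}" "smooth_on \<Psi> E"
    "\<And>w. \<bar>w $ t\<bar> < d \<Longrightarrow> (\<forall>\<alpha>. \<alpha> \<noteq> t \<longrightarrow> \<bar>w $ \<alpha> - z0 $ \<alpha>\<bar> < d) \<Longrightarrow>
       frechet_derivative \<Phi> (at w) (axis t 1) = V (\<Phi> w) \<and> T (\<Phi> w) = w $ t"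
proof -
  obtain \<rho> where \<rho>: "\<rho> > 0" "cball z0 \<rho> \<subseteq> U"
    using U open_contains_cball by blast
  let ?DV = "\<lambda>z. frechet_derivative V (at z)"
  have V1: "Ck_on (Suc 0) V U" using V unfolding smooth_on_def by blast
  obtain L where L: "L \<ge> 0" "\<And>p h. p \<in> cball z0 \<rho> \<Longrightarrow> norm (?DV p h) \<le> L * norm h"
    using has_derivative_uniformly_on_compact[OF U(1) V1 compact_cball \<rho>(2)] by metis
  have lipV: "norm (V a - V b) \<le> L * norm (a - b)" if "a \<in> cball z0 \<rho>" "b \<in> cball z0 \<rho>" for a b
  proof (rule differentiable_bound[OF convex_cball _ _ that])
    fix p assume p: "p \<in> cball z0 \<rho>"
    show "(V has_derivative ?DV p) (at p within cball z0 \<rho>)"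
      using Ck_on_has_derivative[OF V1] p \<rho>(2) has_derivative_at_withinI by blast
    show "onorm (?DV p) \<le> L" using L(2)[OF p] by (rule onorm_le)
  qed
  have "compact (V ` cball z0 \<rho>)"
    by (intro compact_continuous_image compact_cball continuous_on_subset[OF smooth_on_continuous[OF V] \<rho>(2)])
  then obtain B where B: "B > 0" "\<And>p. p \<in> cball z0 \<rho> \<Longrightarrow> norm (V p) \<le> B"
    using compact_imp_bounded[of "V ` cball z0 \<rho>"] unfolding bounded_pos by blast
  \<comment> \<open>\<open>b\<close> projects to the starting hyperplane, \<open>s\<close> is the
    flow time, and \<open>w0\<close> is the point that corresponds to z0 itself: there the flow time
    is 0.\<close>
  define b where "b w = (\<chi> \<alpha>. if \<alpha> = t then z0 $ t else w $ \<alpha>)" for w :: "real ^ 'n"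
  define b' where "b' v = (\<chi> \<alpha>. if \<alpha> = t then 0 else v $ \<alpha>)" for v :: "real ^ 'n"
  define s where "s w = w $ t - T (b w)" for w
  define w0 where "w0 = (\<chi> \<alpha>. if \<alpha> = t then 0 else z0 $ \<alpha>)"
  have bw0: "b w0 = z0" by (simp add: b_def w0_def vec_eq_iff)
  have sw0: "s w0 = 0" by (simp add: s_def bw0 T(2)) (simp add: w0_def)
  have lb': "linear b'" by (intro linearI) (auto simp: b'_def vec_eq_iff)
  then have blb': "bounded_linear b'" by (simp add: linear_conv_bounded_linear)
  have b_eq: "b w = b' w + z0 $ t *\<^sub>R axis t 1" for w
    by (simp add: b_def b'_def vec_eq_iff axis_def)
  have db: "(b has_derivative b') (at w)" for w
    unfolding b_eq[abs_def] by (auto intro!: derivative_eq_intros bounded_linear_imp_has_derivative blb')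
  have sb: "smooth_on b S" if "open S" for S
    unfolding b_eq[abs_def] by (intro smooth_on_add smooth_on_const smooth_on_bounded_linear blb' that)
  have cb: "continuous_on UNIV b" using smooth_on_continuous[OF sb[OF open_UNIV]] .
  define Y where "Y = b -` ball z0 (\<rho> / 2)"
  have Y: "open Y" "w0 \<in> Y"
    using open_vimage[OF open_ball cb] \<rho> by (auto simp: Y_def bw0)
  have bY: "b w \<in> ball z0 (\<rho> / 2)" "b w \<in> U" if "w \<in> Y" for w
  proof -
    show "b w \<in> ball z0 (\<rho> / 2)" using that by (simp add: Y_def)
    then have "b w \<in> cball z0 \<rho>" using \<rho>(1) by simp
    then show "b w \<in> U" using \<rho>(2) by blast
  qed
  have "smooth_on (\<lambda>w. T (b w)) Y"
    by (rule smooth_on_compose[OF Y(1) U(1) _ sb[OF Y(1)] T(1)]) (use bY in auto)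
  then have ss: "smooth_on s Y"
    unfolding s_def[abs_def]
    by (rule smooth_on_diff[OF Y(1) smooth_on_bounded_linear[OF bounded_linear_vec_nth]])
  \<comment> \<open>The first bound gives the rescaled field Lipschitz constant 1/2, the second
    keeps its solutions within \<rho>/2 of their start and so inside the ball of radius
    \<rho>.\<close>
  define \<eta> where "\<eta> = min (1 / (4 * (L + 1))) (\<rho> / (4 * B))"
  have \<eta>: "\<eta> > 0" "2 * \<eta> * L \<le> 1/2" "2 * \<eta> * B \<le> \<rho> / 2"
  proof -
    show "\<eta> > 0" using L B \<rho> by (simp add: \<eta>_def)
    have "2 * \<eta> * L \<le> 2 * (1 / (4 * (L + 1))) * L"
      using L by (intro mult_right_mono) (auto simp: \<eta>_def)
    also have "\<dots> \<le> 1/2" using L by (simp add: field_simps)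
    finally show "2 * \<eta> * L \<le> 1/2" .
    have "2 * \<eta> * B \<le> 2 * (\<rho> / (4 * B)) * B"
      using B by (intro mult_right_mono) (auto simp: \<eta>_def)
    also have "\<dots> = \<rho> / 2" using B by simp
    finally show "2 * \<eta> * B \<le> \<rho> / 2" .
  qed
  define Z where "Z = Y \<inter> s -` {-\<eta><..<\<eta>}"
  have Z: "open Z" "w0 \<in> Z"
    using continuous_open_preimage[OF smooth_on_continuous[OF ss] Y(1) open_greaterThanLessThan] Y \<eta>(1)
    by (auto simp: Z_def sw0)
  have sZ: "\<bar>s w\<bar> < \<eta>" if "w \<in> Z" for w using that by (auto simp: Z_def)
  have ZY: "Z \<subseteq> Y" by (auto simp: Z_def)
  \<comment> \<open>Time is rescaled by \<open>2 * s w\<close>, so that the flow at time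
    \<open>s w\<close> is the solution at parameter 1/2 for every w, safely inside the common
    interval of radius 1.\<close>
  let ?N = "\<lambda>w x. (2 * s w) *\<^sub>R V x"
  have lipN: "norm (?N w x - ?N w y) \<le> norm (x - y) / 2"
    if "w \<in> Z" "x \<in> cball z0 \<rho>" "y \<in> cball z0 \<rho>" for w x y
  proof -
    have "norm (?N w x - ?N w y) = (2 * \<bar>s w\<bar>) * norm (V x - V y)"
      by (simp add: abs_mult flip: scaleR_diff_right)
    also have "\<dots> \<le> (2 * \<eta>) * (L * norm (x - y))"
      using sZ[OF that(1)] lipV[OF that(2,3)] by (intro mult_mono) auto
    also have "\<dots> = (2 * \<eta> * L) * norm (x - y)" by simp
    also have "\<dots> \<le> 1/2 * norm (x - y)" using \<eta>(2) by (intro mult_right_mono) auto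
    finally show ?thesis by simp
  qed
  have ex: "\<exists>x. x 0 = b w \<and> (\<forall>\<tau>. \<bar>\<tau>\<bar> < 1 \<longrightarrow> x \<tau> \<in> ball z0 \<rho> \<and> (x has_vector_derivative ?N w (x \<tau>)) (at \<tau>))"
    if w: "w \<in> Z" for w
  proof -
    \<comment> \<open>Composing with the nearest-point retraction, which does not increase
      distances, makes the field globally Lipschitz; the solution is then seen never to leave the
      ball, where the retraction is the identity.\<close>
    let ?c = "closest_point (cball z0 \<rho>)"
    have ne: "cball z0 \<rho> \<noteq> {}" using \<rho> by simp
    have cin: "?c x \<in> cball z0 \<rho>" for x by (rule closest_point_in_set[OF closed_cball ne])
    have c1: "continuous_on ({-1..1} \<times> UNIV) (\<lambda>(\<tau>::real, x). ?N w (?c x))"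
      unfolding split_beta
      by (intro continuous_intros continuous_on_compose2[OF continuous_on_subset[OF smooth_on_continuous[OF V] \<rho>(2)]]
          continuous_on_compose2[OF continuous_on_closest_point[OF convex_cball closed_cball ne, of UNIV]])
        (use cin in auto)
    have c2: "norm (?N w (?c x) - ?N w (?c y)) \<le> norm (x - y) / 2" for x y
      using lipN[OF w cin cin, of x y] closest_point_lipschitz[OF convex_cball closed_cball ne, of x y]
      by (simp add: dist_norm)
    obtain x where x: "x 0 = b w" "\<And>\<tau>. \<bar>\<tau>\<bar> < 1 \<Longrightarrow> (x has_vector_derivative ?N w (?c (x \<tau>))) (at \<tau>)"
      using ode_existence[of 1 "\<lambda>\<tau> x. ?N w (?c x)" "b w"] c1 c2 by auto
    have in_ball: "x \<tau> \<in> ball z0 \<rho>" if \<tau>: "\<bar>\<tau>\<bar> < 1" for \<tau>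
    proof -
      have "norm (x \<tau> - x 0) \<le> (\<rho> / 2) * norm (\<tau> - 0)"
      proof (rule differentiable_bound[of "{-1<..<1}" x "\<lambda>\<tau> h. h *\<^sub>R ?N w (?c (x \<tau>))"])
        fix \<sigma> :: real assume \<sigma>: "\<sigma> \<in> {-1<..<1}"
        then have "\<bar>\<sigma>\<bar> < 1" by auto
        from x(2)[OF this] show "(x has_derivative (\<lambda>h. h *\<^sub>R ?N w (?c (x \<sigma>)))) (at \<sigma> within {-1<..<1})"
          unfolding has_vector_derivative_def by (rule has_derivative_at_withinI)
        have "norm (?N w (?c (x \<sigma>))) = (2 * \<bar>s w\<bar>) * norm (V (?c (x \<sigma>)))" by (simp add: abs_mult)
        also have "\<dots> \<le> (2 * \<eta>) * B" using sZ[OF w] B(2)[OF cin] by (intro mult_mono) auto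
        also have "\<dots> \<le> \<rho> / 2" using \<eta>(3) by simp
        finally show "onorm (\<lambda>h. h *\<^sub>R ?N w (?c (x \<sigma>))) \<le> \<rho> / 2" by (rule onorm_scaleR_le)
      qed (use \<tau> in auto)
      also have "\<dots> \<le> (\<rho> / 2) * 1" using \<tau> \<rho> by (intro mult_left_mono) auto
      finally have "dist (x \<tau>) (b w) \<le> \<rho> / 2" by (simp add: x(1) dist_norm)
      moreover have "dist (b w) z0 < \<rho> / 2" using bY(1) w ZY by (auto simp: dist_commute)
      ultimately show ?thesis
        using dist_triangle[of "x \<tau>" z0 "b w"] by (simp add: dist_commute)
    qed
    then have "?c (x \<tau>) = x \<tau>" if "\<bar>\<tau>\<bar> < 1" for \<tau>
      using that by (intro closest_point_self) (auto simp: less_imp_le)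
    then show ?thesis using x in_ball by metis
  qed
  define x where "x w = (SOME x. x 0 = b w \<and>
    (\<forall>\<tau>. \<bar>\<tau>\<bar> < 1 \<longrightarrow> x \<tau> \<in> ball z0 \<rho> \<and> (x has_vector_derivative ?N w (x \<tau>)) (at \<tau>)))" for w
  have x: "x w 0 = b w" "\<bar>\<tau>\<bar> < 1 \<Longrightarrow> x w \<tau> \<in> ball z0 \<rho>"
    "\<bar>\<tau>\<bar> < 1 \<Longrightarrow> (x w has_vector_derivative ?N w (x w \<tau>)) (at \<tau>)" if "w \<in> Z" for w \<tau>
    using someI_ex[OF ex[OF that]] unfolding x_def by auto
  have xU: "x w \<tau> \<in> U" if "w \<in> Z" "\<bar>\<tau>\<bar> < 1" for w \<tau>
    using x(2)[OF that] \<rho>(2) by (auto simp: subset_iff)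
  let ?\<Omega> = "Z \<times> (UNIV :: real set) \<times> ball z0 \<rho>"
  let ?N' = "\<lambda>(w, \<tau>::real, x). ?N w x"
  have o\<Omega>: "open ?\<Omega>" using Z by (simp add: open_Times)
  have ode: "ode_family ?\<Omega> Z 1 ?N' b x"
    unfolding ode_family_def using o\<Omega> Z x lipN by (auto simp: less_imp_le)
  have sN: "smooth_on ?N' ?\<Omega>"
  proof -
    have "smooth_on (\<lambda>p. s (fst p)) ?\<Omega>"
      by (rule smooth_on_compose[OF o\<Omega> Z(1) _ smooth_on_bounded_linear[OF bounded_linear_fst] smooth_on_subset[OF ss ZY]]) auto
    moreover have "smooth_on (\<lambda>p. V (snd (snd p))) ?\<Omega>"
      by (rule smooth_on_compose[OF o\<Omega> U(1) _ smooth_on_bounded_linear[OF bounded_linear_snd_comp[OF bounded_linear_snd]] V])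
        (use \<rho>(2) in \<open>auto simp: subset_iff\<close>)
    ultimately have "smooth_on (\<lambda>p. (2 * s (fst p)) *\<^sub>R V (snd (snd p))) ?\<Omega>"
      by (intro smooth_on_scaleR smooth_on_mult smooth_on_const o\<Omega>)
    then show ?thesis by (simp add: split_beta')
  qed
  define \<Phi> where "\<Phi> w = x w (1/2)" for w
  have "Ck_on k \<Phi> Z" for k
  proof -
    have "Ck_on k (\<lambda>(w, \<tau>). x w \<tau>) (Z \<times> {-1<..<1})"
      using ode_family_Ck[OF ode, of k] sN sb[OF Z(1)] unfolding smooth_on_def by auto
    then have "Ck_on k (\<lambda>w. (\<lambda>(w, \<tau>). x w \<tau>) (w, 1/2)) Z"
      by (rule Ck_on_compose[OF Z(1) open_Times[OF Z(1) open_greaterThanLessThan] _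
          Ck_on_Pair[OF Z(1) Ck_on_bounded_linear_id[OF bounded_linear_ident] Ck_on_const], rotated]) auto
    then show ?thesis by (simp add: \<Phi>_def[abs_def])
  qed
  then have s\<Phi>: "smooth_on \<Phi> Z" by (simp add: smooth_on_def)
  have ds: "(s has_derivative frechet_derivative s (at w)) (at w)" if "w \<in> Z" for w
    using smooth_on_has_derivative[OF ss] that ZY by blast
  have dV: "(V has_derivative ?DV p) (at p)" if "p \<in> U" for p
    using smooth_on_has_derivative[OF V that] .
  have dN: "frechet_derivative ?N' (at (w, \<tau>, p)) (v, h, y) =
      (2 * frechet_derivative s (at w) v) *\<^sub>R V p + (2 * s w) *\<^sub>R ?DV p y"
    if "w \<in> Z" "p \<in> U" for w \<tau> p v h y
  proof -
    have "(?N' has_derivative (\<lambda>(v, h, y). (2 * s w) *\<^sub>R ?DV p y + (2 * frechet_derivative s (at w) v) *\<^sub>R V p)) (at (w, \<tau>, p))"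
    proof -
      have 1: "((\<lambda>q. s (fst q)) has_derivative (\<lambda>q. frechet_derivative s (at w) (fst q))) (at (w, \<tau>, p))"
        using has_derivative_compose[OF has_derivative_fst[OF has_derivative_ident], of s _ "(w, \<tau>, p)"] ds[OF that(1)] by simp
      have 2: "((\<lambda>q. V (snd (snd q))) has_derivative (\<lambda>q. ?DV p (snd (snd q)))) (at (w, \<tau>, p))"
        using has_derivative_compose[OF has_derivative_snd[OF has_derivative_snd[OF has_derivative_ident]], of V _ "(w, \<tau>, p)"] dV[OF that(2)] by simp
      show ?thesis
        unfolding split_beta'
        by (auto intro!: derivative_eq_intros 1 2)
    qed
    from frechet_derivative_at[OF this] show ?thesis by (metis (no_types, lifting) add.commute prod.case)
  qed
  have d\<Phi>_t: "frechet_derivative \<Phi> (at w) (axis t 1) = V (\<Phi> w)" if w: "w \<in> Z" for w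
  proof -
    let ?l = "\<lambda>h. w + h *\<^sub>R axis t 1"
    let ?Z = "?l -` Z"
    have lin: "bounded_linear (\<lambda>h::real. h *\<^sub>R (axis t 1 :: real ^ 'n))" by (rule bounded_linear_scaleR_left)
    have dl: "(?l has_derivative (\<lambda>h. h *\<^sub>R axis t 1)) (at h)" for h
      by (auto intro!: derivative_eq_intros)
    have Z': "open ?Z" by (intro open_vimage Z continuous_intros)
    have bl: "b (?l h) = b w" for h by (simp add: b_def vec_eq_iff axis_def)
    have sl: "s (?l h) = s w + h" for h by (simp add: s_def bl)
    let ?M = "\<lambda>(h, \<tau>::real, x). (2 * (s w + h)) *\<^sub>R V x"
    let ?\<Omega>' = "?Z \<times> (UNIV :: real set) \<times> ball z0 \<rho>"
    have o\<Omega>': "open ?\<Omega>'" using Z' by (simp add: open_Times)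
    \<comment> \<open>Along the t-direction the starting point stays fixed and the flow time grows
      by h, so the family has the single parameter h.\<close>
    have "ode_family ?\<Omega>' ?Z 1 ?M (\<lambda>h. b w) (\<lambda>h. x (?l h))"
      unfolding ode_family_def using o\<Omega>' Z' x lipN bl sl by (auto simp: less_imp_le simp flip: sl)
    note ode' = this
    have sM: "smooth_on ?M ?\<Omega>'"
    proof -
      have "smooth_on (\<lambda>p. V (snd (snd p))) ?\<Omega>'"
        by (rule smooth_on_compose[OF o\<Omega>' U(1) _ smooth_on_bounded_linear[OF bounded_linear_snd_comp[OF bounded_linear_snd]] V])
          (use \<rho>(2) in \<open>auto simp: subset_iff\<close>)
      then have "smooth_on (\<lambda>p. (2 * (s w + fst p)) *\<^sub>R V (snd (snd p))) ?\<Omega>'"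
        by (intro smooth_on_scaleR smooth_on_mult smooth_on_add smooth_on_const
            smooth_on_bounded_linear[OF bounded_linear_fst] o\<Omega>')
      then show ?thesis by (simp add: split_beta')
    qed
    have dM: "frechet_derivative ?M (at (0, \<tau>, p)) (v, h, y) = (2 * v) *\<^sub>R V p + (2 * s w) *\<^sub>R ?DV p y"
      if "p \<in> U" for \<tau> p v h y
    proof -
      have 2: "((\<lambda>q. V (snd (snd q))) has_derivative (\<lambda>q. ?DV p (snd (snd q)))) (at (0::real, \<tau>::real, p))"
        using has_derivative_compose[OF has_derivative_snd[OF has_derivative_snd[OF has_derivative_ident]], of V _ "(0, \<tau>, p)"] dV[OF that] by simp
      have "(?M has_derivative (\<lambda>(v, h, y). (2 * s w) *\<^sub>R ?DV p y + (2 * v) *\<^sub>R V p)) (at (0, \<tau>, p))"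
        unfolding split_beta' by (auto intro!: derivative_eq_intros 2)
      from frechet_derivative_at[OF this] show ?thesis by (metis (no_types, lifting) add.commute prod.case)
    qed
    have "((\<lambda>h. x (?l h) (1/2)) has_derivative (\<lambda>v. (v * (2 * (1/2))) *\<^sub>R V (x w (1/2)))) (at 0)"
    \<comment> \<open>A field is carried along by its own flow, so V along the solution solves the
      homogeneous variational equation; the factor 2\<tau> accounts for the changed speed.\<close>
    proof (rule ode_family_differentiable[OF ode', where W = "\<lambda>v \<tau>. (v * (2 * \<tau>)) *\<^sub>R V (x w \<tau>)"])
      show "Ck_on (Suc 0) ?M ?\<Omega>'" using sM unfolding smooth_on_def by blast
      show "Ck_on (Suc 0) (\<lambda>h. b w) ?Z" by (rule Ck_on_const)
      show "0 \<in> ?Z" using w by simp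
      show "(v * (2 * 0)) *\<^sub>R V (x w 0) = frechet_derivative (\<lambda>h. b w) (at 0) v" for v :: real
        by (simp add: frechet_derivative_const)
      show "linear (\<lambda>v. (v * (2 * (1 / 2))) *\<^sub>R V (x w (1 / 2)))"
        by (intro linearI) (auto simp: algebra_simps)
      fix v \<tau> :: real assume \<tau>: "\<bar>\<tau>\<bar> < 1"
      have "((\<lambda>\<tau>. V (x w \<tau>)) has_vector_derivative ?DV (x w \<tau>) (?N w (x w \<tau>))) (at \<tau>)"
        using has_derivative_compose[OF x(3)[OF w \<tau>, unfolded has_vector_derivative_def] dV[OF xU[OF w \<tau>]]]
          linear_scale[OF has_derivative_linear[OF dV[OF xU[OF w \<tau>]]]]
        by (simp add: has_vector_derivative_def)
      then have "((\<lambda>\<tau>. (v * (2 * \<tau>)) *\<^sub>R V (x w \<tau>)) has_vector_derivative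
          (v * (2 * \<tau>)) *\<^sub>R ?DV (x w \<tau>) (?N w (x w \<tau>)) + (2 * v) *\<^sub>R V (x w \<tau>)) (at \<tau>)"
        by (auto intro!: derivative_eq_intros)
      moreover have "(v * (2 * \<tau>)) *\<^sub>R ?DV (x w \<tau>) (?N w (x w \<tau>)) = (2 * s w) *\<^sub>R ?DV (x w \<tau>) ((v * (2 * \<tau>)) *\<^sub>R V (x w \<tau>))"
        using linear_scale[OF has_derivative_linear[OF dV[OF xU[OF w \<tau>]]]] by (simp add: mult_ac)
      ultimately show "((\<lambda>\<tau>. (v * (2 * \<tau>)) *\<^sub>R V (x w \<tau>)) has_vector_derivative
          frechet_derivative ?M (at (0, \<tau>, x (?l 0) \<tau>)) (v, 0, (v * (2 * \<tau>)) *\<^sub>R V (x w \<tau>))) (at \<tau>)"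
        using dM[OF xU[OF w \<tau>]] by (simp add: add.commute)
    qed auto
    then have 1: "((\<lambda>h. \<Phi> (?l h)) has_derivative (\<lambda>v. v *\<^sub>R V (\<Phi> w))) (at 0)"
      by (simp add: \<Phi>_def)
    have "((\<lambda>h. \<Phi> (?l h)) has_derivative (\<lambda>v. frechet_derivative \<Phi> (at w) (v *\<^sub>R axis t 1))) (at 0)"
      using has_derivative_compose[OF dl[of 0], of \<Phi>] smooth_on_has_derivative[OF s\<Phi> w] by simp
    from fun_cong[OF has_derivative_unique[OF 1 this], of 1] show ?thesis by simp
  qed
  have xw0: "x w0 \<tau> = z0" if \<tau>: "\<bar>\<tau>\<bar> < 1" for \<tau>
  proof -
    have "x w0 \<tau> = x w0 0"
    proof (rule has_derivative_zero_unique[of "{-1<..<1}" "x w0"])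
      fix \<sigma> :: real assume "\<sigma> \<in> {-1<..<1}"
      then have "\<bar>\<sigma>\<bar> < 1" by auto
      from x(3)[OF Z(2) this] show "(x w0 has_derivative (\<lambda>h. 0)) (at \<sigma> within {-1<..<1})"
        unfolding has_vector_derivative_def by (simp add: sw0 has_derivative_at_withinI)
    qed (use \<tau> in auto)
    then show ?thesis using x(1)[OF Z(2)] bw0 by simp
  qed
  \<comment> \<open>At w0 the speed vanishes, the solution rests at z0, and the variational equation
    has a constant right-hand side that integrates explicitly.\<close>
  have d\<Phi>0: "frechet_derivative \<Phi> (at w0) v = b' v + frechet_derivative s (at w0) v *\<^sub>R V z0" for v
  proof -
    let ?W = "\<lambda>v \<tau>. b' v + (2 * \<tau> * frechet_derivative s (at w0) v) *\<^sub>R V z0"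
    have "((\<lambda>w. x w (1/2)) has_derivative (\<lambda>v. ?W v (1/2))) (at w0)"
    proof (rule ode_family_differentiable[OF ode])
      show "Ck_on (Suc 0) ?N' ?\<Omega>" "Ck_on (Suc 0) b Z"
        using sN sb[OF Z(1)] unfolding smooth_on_def by blast+
      show "?W v 0 = frechet_derivative b (at w0) v" for v
        using frechet_derivative_at[OF db] by simp
      show "linear (\<lambda>v. ?W v (1/2))"
        using lb' has_derivative_linear[OF ds[OF Z(2)]]
        by (intro linearI) (auto simp: linear_add linear_scale algebra_simps)
      fix v and \<tau> :: real assume \<tau>: "\<bar>\<tau>\<bar> < 1"
      have "(?W v has_vector_derivative (2 * frechet_derivative s (at w0) v) *\<^sub>R V z0) (at \<tau>)"
        by (auto intro!: derivative_eq_intros)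
      then show "(?W v has_vector_derivative frechet_derivative ?N' (at (w0, \<tau>, x w0 \<tau>)) (v, 0, ?W v \<tau>)) (at \<tau>)"
        using dN[OF Z(2) xU[OF Z(2) \<tau>]] by (simp add: xw0[OF \<tau>] sw0)
    qed (use Z in auto)
    from frechet_derivative_at[OF this] show ?thesis by (simp add: \<Phi>_def[abs_def] fun_eq_iff)
  qed
  have \<Phi>w0: "\<Phi> w0 = z0" by (simp add: \<Phi>_def xw0)
  \<comment> \<open>The image of \<open>b'\<close> has no t-component while V has one, so both
    summands of the derivative vanish separately; the derivative of s then reduces to
    \<open>v $ t\<close>.\<close>
  have inj: "v = 0" if "frechet_derivative \<Phi> (at w0) v = 0" for v
  proof -
    let ?c = "frechet_derivative s (at w0) v"
    have 1: "b' v + ?c *\<^sub>R V z0 = 0" using that d\<Phi>0 by simp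
    then have "(b' v + ?c *\<^sub>R V z0) $ t = 0" by simp
    then have c: "?c = 0" using Vt by (simp add: b'_def)
    then have b0: "b' v = 0" using 1 by simp
    have "frechet_derivative s (at w0) v = v $ t"
    proof -
      have "(T has_derivative frechet_derivative T (at (b w0))) (at (b w0))"
        using smooth_on_has_derivative[OF T(1) U(2)] bw0 by simp
      from has_derivative_compose[OF db this]
      have "(s has_derivative (\<lambda>v. v $ t - frechet_derivative T (at (b w0)) (b' v))) (at w0)"
        unfolding s_def[abs_def]
        by (intro has_derivative_diff bounded_linear_imp_has_derivative bounded_linear_vec_nth)
      from frechet_derivative_at[OF this]
      have "frechet_derivative s (at w0) v = v $ t - frechet_derivative T (at z0) (b' v)"
        by (metis bw0)
      then show ?thesis
        using linear_0[OF has_derivative_linear[OF smooth_on_has_derivative[OF T(1) U(2)]]] b0 by simp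
    qed
    with c have "v $ t = 0" by simp
    moreover have "v $ \<alpha> = 0" if "\<alpha> \<noteq> t" for \<alpha>
      using b0 that by (simp add: b'_def vec_eq_iff) metis
    ultimately show "v = 0" by (simp add: vec_eq_iff) metis
  qed
  have T\<Phi>: "T (\<Phi> w) = w $ t" if w: "w \<in> Z" for w
  proof -
    let ?f = "\<lambda>\<tau>. T (x w \<tau>) - 2 * s w * \<tau>"
    have "?f (1/2) = ?f 0"
    proof (rule has_derivative_zero_unique[of "{-1<..<1}" ?f])
      fix \<sigma> :: real assume "\<sigma> \<in> {-1<..<1}"
      then have \<sigma>: "\<bar>\<sigma>\<bar> < 1" by auto
      note p = xU[OF w \<sigma>]
      have dT: "(T has_derivative frechet_derivative T (at (x w \<sigma>))) (at (x w \<sigma>))"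
        using smooth_on_has_derivative[OF T(1) p] .
      have "frechet_derivative T (at (x w \<sigma>)) (h *\<^sub>R ?N w (x w \<sigma>)) = h * (2 * s w)" for h
        using TV[OF p] linear_scale[OF has_derivative_linear[OF dT]] by simp
      with has_derivative_compose[OF x(3)[OF w \<sigma>, unfolded has_vector_derivative_def] dT]
      have "((\<lambda>\<tau>. T (x w \<tau>)) has_derivative (\<lambda>h. h * (2 * s w))) (at \<sigma>)" by simp
      then have "(?f has_derivative (\<lambda>h. h * (2 * s w) - 2 * s w * h)) (at \<sigma>)"
        by (auto intro!: derivative_eq_intros)
      then show "(?f has_derivative (\<lambda>h. 0)) (at \<sigma> within {-1<..<1})"
        by (simp add: mult.commute has_derivative_at_withinI)
    qed auto
    then show ?thesis using x(1)[OF w] by (simp add: \<Phi>_def s_def field_simps)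
  qed
  obtain U' V' \<Psi> where IFT: "open U'" "U' \<subseteq> Z" "w0 \<in> U'" "open V'" "homeomorphism U' V' \<Phi> \<Psi>" "smooth_on \<Psi> V'"
    by (rule smooth_inverse_function[OF Z s\<Phi> inj])
  obtain r where r: "r > 0" "ball w0 r \<subseteq> U'" using IFT(1,3) open_contains_ball by blast
  \<comment> \<open>The l1-norm bounds the Euclidean norm, so a cube of this half-width fits into
    the ball of radius r.\<close>
  define d where "d = r / (2 * real CARD('n))"
  have d: "d > 0" using r by (simp add: d_def)
  define Q where "Q = {w. \<bar>w $ t\<bar> < d \<and> (\<forall>\<alpha>. \<alpha> \<noteq> t \<longrightarrow> \<bar>w $ \<alpha> - z0 $ \<alpha>\<bar> < d)}"
  have Q_eq: "Q = {w. \<forall>\<alpha>. \<bar>w $ \<alpha> - w0 $ \<alpha>\<bar> < d}"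
    unfolding Q_def by (auto simp: w0_def)
  have QU': "Q \<subseteq> U'"
  proof
    fix w assume "w \<in> Q"
    then have w: "\<bar>w $ \<alpha> - w0 $ \<alpha>\<bar> < d" for \<alpha> unfolding Q_eq by blast
    have "norm (w - w0) \<le> (\<Sum>\<alpha>\<in>UNIV. \<bar>(w - w0) $ \<alpha>\<bar>)" by (rule norm_le_l1_cart)
    also have "\<dots> \<le> (\<Sum>\<alpha>\<in>(UNIV::'n set). d)" using w by (intro sum_mono) (simp add: less_imp_le)
    also have "\<dots> = r / 2" by (simp add: d_def)
    finally have "w \<in> ball w0 r" using r by (simp add: dist_norm norm_minus_commute)
    then show "w \<in> U'" using r by blast
  qed
  have oQ: "open Q"
    unfolding Q_eq Collect_all_eq
    by (intro open_INT ballI open_Collect_less continuous_intros) auto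
  define E where "E = V' \<inter> \<Psi> -` Q"
  have h: "\<And>w. w \<in> U' \<Longrightarrow> \<Psi> (\<Phi> w) = w" "\<And>y. y \<in> V' \<Longrightarrow> \<Phi> (\<Psi> y) = y" "\<Phi> ` U' = V'" "\<Psi> ` V' = U'"
    "continuous_on U' \<Phi>" "continuous_on V' \<Psi>"
    using IFT(5) by (auto simp: homeomorphism_def)
  have E: "open E" unfolding E_def by (rule continuous_open_preimage[OF h(6) IFT(4) oQ])
  have E_eq: "E = \<Phi> ` Q"
  proof
    show "E \<subseteq> \<Phi> ` Q"
    proof
      fix y assume "y \<in> E"
      then have "y = \<Phi> (\<Psi> y)" "\<Psi> y \<in> Q" using h(2) by (auto simp: E_def)
      then show "y \<in> \<Phi> ` Q" by (rule image_eqI)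
    qed
    show "\<Phi> ` Q \<subseteq> E"
    proof (rule image_subsetI)
      fix w assume "w \<in> Q"
      then have "w \<in> U'" using QU' by blast
      then show "\<Phi> w \<in> E" using h(1,3) \<open>w \<in> Q\<close> by (auto simp: E_def)
    qed
  qed
  have \<Phi>U: "\<Phi> w \<in> U" if "w \<in> Z" for w using xU[OF that, of "1/2"] by (simp add: \<Phi>_def)
  have QZ: "Q \<subseteq> Z" using QU' IFT(2) by blast
  have EU: "E \<subseteq> U" unfolding E_eq using QZ \<Phi>U by blast
  have "w0 \<in> Q" using d by (simp add: Q_eq)
  then have z0E: "z0 \<in> E" unfolding E_eq using \<Phi>w0 by (metis imageI)
  have hom: "homeomorphism Q E \<Phi> \<Psi>"
    by (rule homeomorphism_of_subsets[OF IFT(5) QU' _ E_eq[symmetric]]) (auto simp: E_def)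
  have s1: "smooth_on \<Phi> Q" by (rule smooth_on_subset[OF s\<Phi> QZ])
  have s2: "smooth_on \<Psi> E" by (rule smooth_on_subset[OF IFT(6)]) (simp add: E_def)
  have "frechet_derivative \<Phi> (at w) (axis t 1) = V (\<Phi> w) \<and> T (\<Phi> w) = w $ t"
    if "\<bar>w $ t\<bar> < d" "\<forall>\<alpha>. \<alpha> \<noteq> t \<longrightarrow> \<bar>w $ \<alpha> - z0 $ \<alpha>\<bar> < d" for w
  proof -
    have "w \<in> Z" using QZ that by (auto simp: Q_def)
    then show ?thesis using d\<Phi>_t T\<Phi> by blast
  qed
  then show thesis
    using that[OF d E EU z0E hom[unfolded Q_def] s1[unfolded Q_def] s2] by blast
qed

section \<open>Differential calculus in a chart\<close>

locale chart_calculus =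
  fixes X :: "'a topology" and c :: "('a, 'n::finite) chart"
  assumes chart: "is_chart X c"
begin

abbreviation "D \<equiv> chart_dom c"
abbreviation sm :: "('a \<Rightarrow> real) \<Rightarrow> bool" where "sm f \<equiv> smooth_in_chart c f"

lemma open_img: "open (chart_img c)"
  using chart by (simp add: is_chart_def)

lemma inj_chart: "inj_on (chart_map c) D"
proof -
  have "inj_on (chart_map c) (topspace (subtopology X D))"
    using chart homeomorphic_imp_injective_map unfolding is_chart_def by blast
  moreover have "D \<subseteq> topspace X"
    using chart openin_subset unfolding is_chart_def by blast
  ultimately show ?thesis by (simp add: Int_absorb1)
qed

lemma chart_inv_map: "x \<in> D \<Longrightarrow> chart_inv c (chart_map c x) = x"
  unfolding chart_inv_def using inj_chart by (rule inv_into_f_f)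

lemma chart_map_inv: "z \<in> chart_img c \<Longrightarrow> chart_map c (chart_inv c z) = z"
  unfolding chart_inv_def chart_img_def by (rule f_inv_into_f)

lemma chart_inv_in: "z \<in> chart_img c \<Longrightarrow> chart_inv c z \<in> D"
  unfolding chart_inv_def chart_img_def by (rule inv_into_into)

lemma chart_map_in: "x \<in> D \<Longrightarrow> chart_map c x \<in> chart_img c"
  unfolding chart_img_def by (rule imageI)

text \<open>Tensor identities hold on the chart domain only; since its image is open they may be
  differentiated there.\<close>

lemma pd_cong:
  assumes "\<And>y. y \<in> D \<Longrightarrow> f y = h y" "x \<in> D"
  shows "pd c i f x = pd c i h x"
proof -
  have eq: "(f \<circ> chart_inv c) z = (h \<circ> chart_inv c) z" if "z \<in> chart_img c" for z
    using assms(1) chart_inv_in[OF that] by simp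
  have "((f \<circ> chart_inv c) has_derivative F) (at (chart_map c x)) \<longleftrightarrow>
      ((h \<circ> chart_inv c) has_derivative F) (at (chart_map c x))" for F
    using has_derivative_transform_within_open[OF _ open_img chart_map_in[OF assms(2)]] eq by metis
  then show ?thesis by (simp add: pd_def frechet_derivative_def)
qed

lemma sm_cong: "(\<And>y. y \<in> D \<Longrightarrow> f y = h y) \<Longrightarrow> sm f \<Longrightarrow> sm h"
  unfolding smooth_in_chart_def
  by (rule smooth_on_cong[OF open_img, of "f \<circ> chart_inv c"]) (auto simp: chart_inv_in)

lemma sm_add: "sm f \<Longrightarrow> sm h \<Longrightarrow> sm (\<lambda>x. f x + h x)"
  unfolding smooth_in_chart_def o_def by (rule smooth_on_add[OF open_img])

lemma sm_diff: "sm f \<Longrightarrow> sm h \<Longrightarrow> sm (\<lambda>x. f x - h x)"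
  unfolding smooth_in_chart_def o_def by (rule smooth_on_diff[OF open_img])

lemma sm_mult: "sm f \<Longrightarrow> sm h \<Longrightarrow> sm (\<lambda>x. f x * h x)"
  unfolding smooth_in_chart_def o_def by (rule smooth_on_mult[OF open_img])

lemma sm_const: "sm (\<lambda>x. a)"
  unfolding smooth_in_chart_def o_def by (rule smooth_on_const)

lemma sm_sum: "(\<And>i. i \<in> I \<Longrightarrow> sm (f i)) \<Longrightarrow> sm (\<lambda>x. \<Sum>i\<in>I. f i x)"
  unfolding smooth_in_chart_def o_def by (rule smooth_on_sum[OF open_img])

lemma sm_divide_const: "sm f \<Longrightarrow> sm (\<lambda>x. f x / a)"
  using sm_mult[OF _ sm_const, of f "inverse a"] by (simp add: divide_inverse)

lemma sm_inverse: "sm f \<Longrightarrow> (\<And>x. x \<in> D \<Longrightarrow> f x \<noteq> 0) \<Longrightarrow> sm (\<lambda>x. inverse (f x))"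
  unfolding smooth_in_chart_def o_def using smooth_on_inverse[OF open_img] chart_inv_in by blast

lemma pd_at_inv: "z \<in> chart_img c \<Longrightarrow>
    pd c i f (chart_inv c z) = frechet_derivative (f \<circ> chart_inv c) (at z) (axis i 1)"
  by (simp add: pd_def chart_map_inv)

lemma sm_pd: "sm f \<Longrightarrow> sm (pd c i f)"
proof -
  assume "sm f"
  then have "smooth_on (\<lambda>z. frechet_derivative (f \<circ> chart_inv c) (at z) (axis i 1)) (chart_img c)"
    unfolding smooth_in_chart_def by (rule smooth_on_frechet_derivative)
  then show ?thesis
    unfolding smooth_in_chart_def
    by (rule smooth_on_cong[OF open_img, rotated]) (simp add: pd_at_inv)
qed

lemma has_derivative_in_chart:
  "sm f \<Longrightarrow> x \<in> D \<Longrightarrow> ((\<lambda>z. f (chart_inv c z)) has_derivative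
      frechet_derivative (f \<circ> chart_inv c) (at (chart_map c x))) (at (chart_map c x))"
  using smooth_on_has_derivative[of "f \<circ> chart_inv c" "chart_img c" "chart_map c x"] chart_map_in
  by (simp add: smooth_in_chart_def o_def)

lemma pd_eqI:
  "((\<lambda>z. f (chart_inv c z)) has_derivative F) (at (chart_map c x)) \<Longrightarrow> pd c i f x = F (axis i 1)"
  unfolding pd_def o_def by (simp add: frechet_derivative_at[symmetric])

lemma pd_add: "sm f \<Longrightarrow> sm h \<Longrightarrow> x \<in> D \<Longrightarrow> pd c i (\<lambda>x. f x + h x) x = pd c i f x + pd c i h x"
  using has_derivative_add[OF has_derivative_in_chart has_derivative_in_chart, of f x h]
  by (subst pd_eqI[of "\<lambda>x. f x + h x"]) (auto simp: pd_def o_def)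

lemma pd_diff: "sm f \<Longrightarrow> sm h \<Longrightarrow> x \<in> D \<Longrightarrow> pd c i (\<lambda>x. f x - h x) x = pd c i f x - pd c i h x"
  using has_derivative_diff[OF has_derivative_in_chart has_derivative_in_chart, of f x h]
  by (subst pd_eqI[of "\<lambda>x. f x - h x"]) (auto simp: pd_def o_def)

lemma pd_mult:
  "sm f \<Longrightarrow> sm h \<Longrightarrow> x \<in> D \<Longrightarrow> pd c i (\<lambda>x. f x * h x) x = pd c i f x * h x + f x * pd c i h x"
  using has_derivative_mult[OF has_derivative_in_chart has_derivative_in_chart, of f x h]
  by (subst pd_eqI[of "\<lambda>x. f x * h x"]) (auto simp: pd_def o_def chart_inv_map add.commute)

lemma pd_const: "pd c i (\<lambda>x. a) x = 0"
  by (subst pd_eqI[of "\<lambda>x. a" "\<lambda>v. 0"]) auto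

lemma pd_cmult: "sm f \<Longrightarrow> x \<in> D \<Longrightarrow> pd c i (\<lambda>x. a * f x) x = a * pd c i f x"
  by (simp add: pd_mult sm_const pd_const)

lemma pd_divide_const: "sm f \<Longrightarrow> x \<in> D \<Longrightarrow> pd c i (\<lambda>x. f x / a) x = pd c i f x / a"
  using pd_cmult[of f x i "inverse a"] by (simp add: divide_inverse mult.commute)

lemma pd_minus: "sm f \<Longrightarrow> x \<in> D \<Longrightarrow> pd c i (\<lambda>x. - f x) x = - pd c i f x"
  using pd_cmult[of f x i "-1"] by simp

lemma sm_minus: "sm f \<Longrightarrow> sm (\<lambda>x. - f x)"
  using sm_mult[OF sm_const, of f "-1"] by simp

lemma pd_sum:
  "(\<And>j. j \<in> I \<Longrightarrow> sm (f j)) \<Longrightarrow> x \<in> D \<Longrightarrow> pd c i (\<lambda>x. \<Sum>j\<in>I. f j x) x = (\<Sum>j\<in>I. pd c i (f j) x)"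
proof (induction I rule: infinite_finite_induct)
  case (insert j I)
  then show ?case by (simp add: pd_add sm_sum)
qed (simp_all add: pd_const)

lemma pd_commute:
  assumes "sm f" "x \<in> D"
  shows "pd c i (pd c j f) x = pd c j (pd c i f) x"
proof -
  let ?F = "f \<circ> chart_inv c"
  have eq: "pd c i (pd c j f) x = frechet_derivative (\<lambda>z. frechet_derivative ?F (at z) (axis j 1))
      (at (chart_map c x)) (axis i 1)" for i j
  proof -
    have "smooth_on (\<lambda>z. frechet_derivative ?F (at z) (axis j 1)) (chart_img c)"
      using assms(1) unfolding smooth_in_chart_def by (rule smooth_on_frechet_derivative)
    from smooth_on_has_derivative[OF this chart_map_in[OF assms(2)]]
    have "((\<lambda>z. pd c j f (chart_inv c z)) has_derivative
        frechet_derivative (\<lambda>z. frechet_derivative ?F (at z) (axis j 1)) (at (chart_map c x))) (at (chart_map c x))"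
      by (rule has_derivative_transform_within_open[OF _ open_img chart_map_in[OF assms(2)]])
        (simp add: pd_at_inv)
    then show ?thesis by (rule pd_eqI)
  qed
  show ?thesis
    unfolding eq using assms(1)
    by (intro frechet_derivative_commute[OF open_img chart_map_in[OF assms(2)]])
      (simp add: smooth_in_chart_def)
qed

end


section \<open>Curvature identities\<close>

lemma sum_delta_mult:
  fixes f :: "'n::finite \<Rightarrow> real"
  shows "(\<Sum>s\<in>UNIV. (if i = s then 1 else 0) * f s) = f i" "(\<Sum>s\<in>UNIV. (if s = i then 1 else 0) * f s) = f i"
    "(\<Sum>s\<in>UNIV. f s * (if i = s then 1 else 0)) = f i" "(\<Sum>s\<in>UNIV. f s * (if s = i then 1 else 0)) = f i"
  by (simp_all add: if_distrib if_distribR sum.delta sum.delta' cong: if_cong)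

text \<open>In a full contraction a matrix acting on the inverse metric is shifted to its transpose
  acting on the tensor. Applied to the Christoffel symbols, this makes traces commute with covariant
  differentiation.\<close>

lemma sum_adjoint1:
  fixes A H T :: "'n::finite \<Rightarrow> 'n \<Rightarrow> real"
  shows "(\<Sum>j\<in>UNIV. \<Sum>l\<in>UNIV. (\<Sum>s\<in>UNIV. A j s * H s l) * T j l) =
    (\<Sum>j\<in>UNIV. \<Sum>l\<in>UNIV. H j l * (\<Sum>s\<in>UNIV. A s j * T s l))"
proof -
  have "(\<Sum>j\<in>UNIV. \<Sum>l\<in>UNIV. (\<Sum>s\<in>UNIV. A j s * H s l) * T j l) =
      (\<Sum>j\<in>UNIV. \<Sum>l\<in>UNIV. \<Sum>s\<in>UNIV. H s l * (A j s * T j l))"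
    unfolding sum_distrib_right by (intro sum.cong refl) (simp add: ac_simps)
  also have "\<dots> = (\<Sum>j\<in>UNIV. \<Sum>s\<in>UNIV. \<Sum>l\<in>UNIV. H s l * (A j s * T j l))"
    by (intro sum.cong refl sum.swap)
  also have "\<dots> = (\<Sum>s\<in>UNIV. \<Sum>j\<in>UNIV. \<Sum>l\<in>UNIV. H s l * (A j s * T j l))"
    by (rule sum.swap)
  also have "\<dots> = (\<Sum>s\<in>UNIV. \<Sum>l\<in>UNIV. \<Sum>j\<in>UNIV. H s l * (A j s * T j l))"
    by (intro sum.cong refl sum.swap)
  finally show ?thesis by (simp add: sum_distrib_left)
qed

lemma sum_adjoint2:
  fixes A H T :: "'n::finite \<Rightarrow> 'n \<Rightarrow> real"
  shows "(\<Sum>j\<in>UNIV. \<Sum>l\<in>UNIV. (\<Sum>s\<in>UNIV. A l s * H j s) * T j l) =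
    (\<Sum>j\<in>UNIV. \<Sum>l\<in>UNIV. H j l * (\<Sum>s\<in>UNIV. A s l * T j s))"
proof (rule sum.cong[OF refl])
  fix j
  have "(\<Sum>l\<in>UNIV. (\<Sum>s\<in>UNIV. A l s * H j s) * T j l) = (\<Sum>l\<in>UNIV. \<Sum>s\<in>UNIV. H j s * (A l s * T j l))"
    unfolding sum_distrib_right by (intro sum.cong refl) (simp add: ac_simps)
  also have "\<dots> = (\<Sum>s\<in>UNIV. \<Sum>l\<in>UNIV. H j s * (A l s * T j l))"
    by (rule sum.swap)
  finally show "(\<Sum>l\<in>UNIV. (\<Sum>s\<in>UNIV. A l s * H j s) * T j l) = (\<Sum>l\<in>UNIV. H j l * (\<Sum>s\<in>UNIV. A s l * T j s))"
    by (simp add: sum_distrib_left)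
qed

text \<open>Take the cyclic identity once for each choice of the first index. Up to sign only six
  components occur, each in two of the four identities, and a signed sum leaves twice the difference
  of the two sides.\<close>

lemma curvature_pair_symmetry:
  fixes R :: "'n \<Rightarrow> 'n \<Rightarrow> 'n \<Rightarrow> 'n \<Rightarrow> real"
  assumes a: "\<And>j k l m. R j k m l = - R j k l m" and b: "\<And>j k l m. R k j l m = - R j k l m"
    and cyc: "\<And>j k l m. R j k l m + R j l m k + R j m k l = 0"
  shows "R j k l m = R l m j k"
proof -
  have "R k l m j = - R k l j m" "R k m j l = - R m k j l" "R k j l m = - R j k l m"
    "R l j k m = R j l m k" "R l k m j = R k l j m"
    "R m j k l = - R j m k l" "R m k l j = - R m k j l" "R m l j k = - R l m j k"
    using a[of k l j m] b[of m k j l] b[of j k l m] b[of j l k m] a[of j l m k] b[of k l m j] a[of k l j m]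
      b[of j m k l] a[of m k j l] b[of l m j k] by simp_all
  then show ?thesis
    using cyc[of j k l m] cyc[of k l m j] cyc[of l m j k] cyc[of m j k l] by simp
qed

lemma matrix_diff_ldistrib: "(A :: real ^ 'n ^ 'm) ** (B - C) = A ** B - A ** C"
  by (simp add: vec_eq_iff matrix_matrix_mult_def right_diff_distrib sum_subtractf)

lemma matrix_add_rdistrib: "((A :: real ^ 'n ^ 'm) + A') ** B = A ** B + A' ** B"
  by (simp add: vec_eq_iff matrix_matrix_mult_def distrib_right sum.distrib)

lemma matrix_diff_rdistrib: "((A :: real ^ 'n ^ 'm) - A') ** B = A ** B - A' ** B"
  by (simp add: vec_eq_iff matrix_matrix_mult_def left_diff_distrib sum_subtractf)

lemma transpose_add: "transpose ((A :: real ^ 'n ^ 'm) + B) = transpose A + transpose B"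
  by (simp add: vec_eq_iff transpose_def)

lemma transpose_diff: "transpose ((A :: real ^ 'n ^ 'm) - B) = transpose A - transpose B"
  by (simp add: vec_eq_iff transpose_def)

lemmas matrix_ring = matrix_add_ldistrib matrix_diff_ldistrib matrix_add_rdistrib matrix_diff_rdistrib
  matrix_mul_assoc transpose_add transpose_diff matrix_transpose_mul

section \<open>The Levi-Civita connection in a chart\<close>

locale metric_chart = chart_calculus X c for X :: "'a topology" and c :: "('a, 'n::finite) chart" +
  fixes g :: "('a, 'n) bilinear_field"
  assumes smooth_g: "smooth_in_chart c (g c)"
    and sym_g: "x \<in> chart_dom c \<Longrightarrow> transpose (g c x) = g c x"
    and inv_g: "x \<in> chart_dom c \<Longrightarrow> invertible (g c x)"
begin

abbreviation G :: "'n \<Rightarrow> 'n \<Rightarrow> 'a \<Rightarrow> real" where "G i j x \<equiv> g c x $ i $ j"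
abbreviation H :: "'n \<Rightarrow> 'n \<Rightarrow> 'a \<Rightarrow> real" where "H i j x \<equiv> ginv g c x $ i $ j"
abbreviation \<Gamma> :: "'n \<Rightarrow> 'n \<Rightarrow> 'n \<Rightarrow> 'a \<Rightarrow> real" where "\<Gamma> \<equiv> christoffel g c"
abbreviation \<delta> :: "'n \<Rightarrow> 'n \<Rightarrow> real" where "\<delta> i j \<equiv> (if i = j then 1 else 0)"

lemma G_sym: "x \<in> D \<Longrightarrow> G i j x = G j i x"
  using arg_cong[OF sym_g, of x "\<lambda>M. M $ j $ i"] by (simp add: transpose_def)

lemma HG: "x \<in> D \<Longrightarrow> (\<Sum>s\<in>UNIV. H i s x * G s j x) = \<delta> i j"
  using matrix_inv_inverse(2)[OF inv_g, of x] by (simp add: ginv_def vec_eq_iff matrix_matrix_mult_def mat_def)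

lemma GH: "x \<in> D \<Longrightarrow> (\<Sum>s\<in>UNIV. G i s x * H s j x) = \<delta> i j"
  using matrix_inv_inverse(1)[OF inv_g, of x] by (simp add: ginv_def vec_eq_iff matrix_matrix_mult_def mat_def)

lemma H_sym: "x \<in> D \<Longrightarrow> H i j x = H j i x"
proof -
  assume x: "x \<in> D"
  let ?M = "g c x" and ?N = "matrix_inv (g c x)"
  have "transpose ?N ** ?M = mat 1"
    using matrix_inv_inverse(1)[OF inv_g[OF x]] sym_g[OF x] matrix_transpose_mul[of ?M ?N] by simp
  then have "transpose ?N = ?N"
  proof -
    assume "transpose ?N ** ?M = mat 1"
    then have "?N = (transpose ?N ** ?M) ** ?N" by simp
    also have "\<dots> = transpose ?N"
      unfolding matrix_mul_assoc[symmetric] matrix_inv_inverse(1)[OF inv_g[OF x]] by simp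
    finally show ?thesis by simp
  qed
  from arg_cong[OF this, of "\<lambda>M. M $ j $ i"] show ?thesis by (simp add: ginv_def transpose_def)
qed

lemma sm_G: "sm (G i j)"
  unfolding smooth_in_chart_def o_def
  by (intro smooth_on_vec_nth open_img smooth_g[unfolded smooth_in_chart_def o_def])

lemma sm_H: "sm (H i j)"
proof -
  have "smooth_on (\<lambda>z. matrix_inv (g c (chart_inv c z))) (chart_img c)"
    using smooth_g inv_g chart_inv_in unfolding smooth_in_chart_def o_def
    by (intro smooth_on_matrix_inv[OF open_img]) auto
  then show ?thesis
    unfolding smooth_in_chart_def o_def ginv_def by (intro smooth_on_vec_nth open_img)
qed

lemma sm_\<Gamma>: "sm (\<Gamma> k i j)"
  unfolding christoffel_def
  by (intro sm_divide_const sm_sum sm_mult sm_add sm_diff sm_pd sm_H sm_G)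

lemmas sm_intros = sm_add sm_diff sm_mult sm_sum sm_minus sm_const sm_divide_const sm_pd sm_G sm_H sm_\<Gamma>

lemma pd_G_sym: "x \<in> D \<Longrightarrow> pd c k (G i j) x = pd c k (G j i) x"
  by (rule pd_cong) (auto intro: G_sym)

lemma \<Gamma>_sym: "x \<in> D \<Longrightarrow> \<Gamma> k i j x = \<Gamma> k j i x"
  unfolding christoffel_def using pd_G_sym[of x] by (simp add: add.commute)

lemma \<Gamma>_lower:
  assumes x: "x \<in> D"
  shows "(\<Sum>s\<in>UNIV. \<Gamma> s k i x * G s j x) = (pd c k (G i j) x + pd c i (G k j) x - pd c j (G k i) x) / 2"
proof -
  define Q where "Q l = pd c k (G i l) x + pd c i (G k l) x - pd c l (G k i) x" for l
  have "(\<Sum>s\<in>UNIV. \<Gamma> s k i x * G s j x) = (\<Sum>s\<in>UNIV. \<Sum>l\<in>UNIV. H s l x * Q l * G s j x) / 2"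
    by (simp add: christoffel_def Q_def sum_divide_distrib sum_distrib_right)
  also have "(\<Sum>s\<in>UNIV. \<Sum>l\<in>UNIV. H s l x * Q l * G s j x) = (\<Sum>l\<in>UNIV. \<Sum>s\<in>UNIV. H s l x * Q l * G s j x)"
    by (rule sum.swap)
  also have "\<dots> = (\<Sum>l\<in>UNIV. (\<Sum>s\<in>UNIV. H l s x * G s j x) * Q l)"
  proof (intro sum.cong refl)
    fix l
    have "H s l x * Q l * G s j x = H l s x * G s j x * Q l" for s
      using H_sym[OF x, of s l] by simp
    then show "(\<Sum>s\<in>UNIV. H s l x * Q l * G s j x) = (\<Sum>s\<in>UNIV. H l s x * G s j x) * Q l"
      by (simp only: sum_distrib_right)
  qed
  also have "\<dots> = Q j" by (simp only: HG[OF x] sum_delta_mult)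
  finally show ?thesis by (simp add: Q_def)
qed

lemma metric_compatible:
  assumes x: "x \<in> D"
  shows "pd c k (G i j) x = (\<Sum>s\<in>UNIV. \<Gamma> s k i x * G s j x) + (\<Sum>s\<in>UNIV. \<Gamma> s k j x * G i s x)"
proof -
  have "(\<Sum>s\<in>UNIV. \<Gamma> s k j x * G i s x) = (\<Sum>s\<in>UNIV. \<Gamma> s k j x * G s i x)"
    by (intro sum.cong refl) (simp add: G_sym[OF x, of i])
  then show ?thesis
    using pd_G_sym[OF x, of k j i] by (simp add: \<Gamma>_lower[OF x] field_simps)
qed

text \<open>Differentiating H G = 1 gives dH = - H dG H. Inserting dG = A^T G + G A, with A the
  matrix of Christoffel symbols, cancels every inner product of G and H.\<close>

lemma inverse_metric_compatible:
  assumes x: "x \<in> D"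
  shows "pd c k (H i j) x = - (\<Sum>s\<in>UNIV. \<Gamma> i k s x * H s j x) - (\<Sum>s\<in>UNIV. \<Gamma> j k s x * H i s x)"
proof -
  let ?Hm = "ginv g c x" and ?Gm = "g c x" and ?A = "\<chi> a b. \<Gamma> a k b x"
    and ?DH = "\<chi> a b. pd c k (H a b) x" and ?DG = "\<chi> a b. pd c k (G a b) x"
  have HG1: "?Hm ** ?Gm = mat 1" and GH1: "?Gm ** ?Hm = mat 1"
    using matrix_inv_inverse[OF inv_g[OF x]] by (simp_all add: ginv_def)
  have DG: "?DG = transpose ?A ** ?Gm + ?Gm ** ?A"
    by (simp add: vec_eq_iff matrix_matrix_mult_def transpose_def metric_compatible[OF x] mult.commute)
  have "?DH ** ?Gm + ?Hm ** ?DG = 0"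
  proof -
    have "(\<Sum>s\<in>UNIV. pd c k (H a s) x * G s b x) + (\<Sum>s\<in>UNIV. H a s x * pd c k (G s b) x) = 0" for a b
    proof -
      have "pd c k (\<lambda>x. \<Sum>s\<in>UNIV. H a s x * G s b x) x = pd c k (\<lambda>x. \<delta> a b) x"
        by (rule pd_cong[OF _ x]) (rule HG)
      then show ?thesis
        by (simp add: pd_sum pd_mult pd_const sm_intros x sum.distrib)
    qed
    then show ?thesis by (simp add: vec_eq_iff matrix_matrix_mult_def)
  qed
  then have "(?DH ** ?Gm + ?Hm ** ?DG) ** ?Hm = 0" by simp
  then have "?DH ** (?Gm ** ?Hm) + ?Hm ** ?DG ** ?Hm = 0"
    by (simp add: matrix_ring)
  then have "?DH = - (?Hm ** ?DG ** ?Hm)"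
    by (simp add: GH1 eq_neg_iff_add_eq_0)
  also have "?Hm ** ?DG ** ?Hm = ?Hm ** transpose ?A ** (?Gm ** ?Hm) + (?Hm ** ?Gm) ** ?A ** ?Hm"
    unfolding DG by (simp add: matrix_ring)
  also have "\<dots> = ?Hm ** transpose ?A + ?A ** ?Hm"
    by (simp add: GH1 HG1)
  finally have "?DH $ i $ j = - ((?Hm ** transpose ?A) $ i $ j) - (?A ** ?Hm) $ i $ j"
    by simp
  then show ?thesis
    by (simp add: matrix_matrix_mult_def transpose_def mult.commute)
qed

section \<open>The Riemann tensor and its symmetries\<close>

text \<open>The mixed tensor \<open>R\<^sup>e\<^sub>k\<^sub>l\<^sub>m\<close>.\<close>

definition Rm :: "'n \<Rightarrow> 'n \<Rightarrow> 'n \<Rightarrow> 'n \<Rightarrow> 'a \<Rightarrow> real" where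
  "Rm e k l m x = pd c l (\<Gamma> e m k) x - pd c m (\<Gamma> e l k) x +
    (\<Sum>s\<in>UNIV. \<Gamma> e l s x * \<Gamma> s m k x - \<Gamma> e m s x * \<Gamma> s l k x)"

lemma sm_Rm: "sm (Rm e k l m)"
  unfolding Rm_def by (intro sm_intros)

lemma riemann_Rm: "riemann g c j k l m x = (\<Sum>e\<in>UNIV. G j e x * Rm e k l m x)"
  by (simp add: riemann_def Rm_def)

lemma Rm_riemann:
  assumes x: "x \<in> D"
  shows "Rm e k l m x = (\<Sum>j\<in>UNIV. H e j x * riemann g c j k l m x)"
proof -
  have "(\<Sum>j\<in>UNIV. H e j x * riemann g c j k l m x) = (\<Sum>j\<in>UNIV. \<Sum>s\<in>UNIV. H e j x * G j s x * Rm s k l m x)"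
    by (simp add: riemann_Rm sum_distrib_left mult.assoc)
  also have "\<dots> = (\<Sum>s\<in>UNIV. \<Sum>j\<in>UNIV. H e j x * G j s x * Rm s k l m x)"
    by (rule sum.swap)
  also have "\<dots> = (\<Sum>s\<in>UNIV. \<delta> e s * Rm s k l m x)"
    by (simp add: HG[OF x] flip: sum_distrib_right)
  finally show ?thesis by (simp add: sum_delta_mult)
qed

lemma Rm_antisym: "Rm e k m l x = - Rm e k l m x"
  by (simp add: Rm_def sum_subtractf)

lemma riemann_antisym1: "riemann g c j k m l x = - riemann g c j k l m x"
  unfolding riemann_Rm by (subst Rm_antisym) (simp add: sum_negf)

lemma pd_\<Gamma>_sym: "x \<in> D \<Longrightarrow> pd c l (\<Gamma> e m k) x = pd c l (\<Gamma> e k m) x"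
  by (rule pd_cong) (auto intro: \<Gamma>_sym)

lemma first_bianchi_mixed:
  assumes x: "x \<in> D"
  shows "Rm e k l m x + Rm e l m k x + Rm e m k l x = 0"
  unfolding Rm_def sum_subtractf
  using pd_\<Gamma>_sym[OF x, of _ e k l] pd_\<Gamma>_sym[OF x, of _ e l m] pd_\<Gamma>_sym[OF x, of _ e m k]
    \<Gamma>_sym[OF x, of _ k l] \<Gamma>_sym[OF x, of _ l m] \<Gamma>_sym[OF x, of _ m k]
  by simp

lemma first_bianchi:
  assumes x: "x \<in> D"
  shows "riemann g c j k l m x + riemann g c j l m k x + riemann g c j m k l x = 0"
proof -
  have "(\<Sum>e\<in>UNIV. G j e x * (Rm e k l m x + Rm e l m k x + Rm e m k l x)) = 0"
    by (simp add: first_bianchi_mixed[OF x])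
  then show ?thesis by (simp add: riemann_Rm sum.distrib distrib_left)
qed

text \<open>Matrix-valued connection coefficients, their derivatives and the curvature. In this form
  the curvature is d\<Gamma> plus a commutator, and the index identities below become identities in
  a noncommutative ring.\<close>

definition \<Gamma>m :: "'a \<Rightarrow> 'n \<Rightarrow> real ^ 'n ^ 'n" where "\<Gamma>m x l = (\<chi> e k. \<Gamma> e l k x)"
definition D\<Gamma>m :: "'a \<Rightarrow> 'n \<Rightarrow> 'n \<Rightarrow> real ^ 'n ^ 'n" where "D\<Gamma>m x l m = (\<chi> e k. pd c l (\<Gamma> e m k) x)"
definition Rmm :: "'a \<Rightarrow> 'n \<Rightarrow> 'n \<Rightarrow> real ^ 'n ^ 'n" where "Rmm x l m = (\<chi> e k. Rm e k l m x)"

lemma Rmm_eq: "Rmm x l m = D\<Gamma>m x l m - D\<Gamma>m x m l + \<Gamma>m x l ** \<Gamma>m x m - \<Gamma>m x m ** \<Gamma>m x l"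
  by (simp add: vec_eq_iff Rmm_def Rm_def D\<Gamma>m_def \<Gamma>m_def matrix_matrix_mult_def sum_subtractf)

text \<open>The compatibility equation dG = A^T G + G A, differentiated once more; what remains is
  to compare the two orders of differentiation.\<close>

lemma second_covariant_derivative_metric:
  assumes x: "x \<in> D"
  defines "DG \<equiv> \<lambda>l. transpose (\<Gamma>m x l) ** g c x + g c x ** \<Gamma>m x l"
  shows "(\<chi> i j. pd c l (pd c m (G i j)) x) =
    transpose (D\<Gamma>m x l m) ** g c x + transpose (\<Gamma>m x m) ** DG l + DG l ** \<Gamma>m x m + g c x ** D\<Gamma>m x l m"
proof -
  have DG: "DG l $ i $ j = pd c l (G i j) x" for l i j
    by (simp add: DG_def metric_compatible[OF x] \<Gamma>m_def matrix_matrix_mult_def transpose_def mult.commute)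
  have "pd c l (pd c m (G i j)) x = (\<Sum>s\<in>UNIV. pd c l (\<Gamma> s m i) x * G s j x + \<Gamma> s m i x * pd c l (G s j) x) +
      (\<Sum>s\<in>UNIV. pd c l (\<Gamma> s m j) x * G i s x + \<Gamma> s m j x * pd c l (G i s) x)" for i j
  proof -
    have "pd c l (pd c m (G i j)) x = pd c l (\<lambda>x. (\<Sum>s\<in>UNIV. \<Gamma> s m i x * G s j x) + (\<Sum>s\<in>UNIV. \<Gamma> s m j x * G i s x)) x"
      by (rule pd_cong[OF _ x]) (rule metric_compatible)
    then show ?thesis by (simp add: pd_add pd_sum pd_mult sm_intros x)
  qed
  then show ?thesis
    by (simp add: vec_eq_iff matrix_matrix_mult_def transpose_def D\<Gamma>m_def \<Gamma>m_def DG sum.distrib mult.commute)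
qed

text \<open>Second partial derivatives of the metric commute. In their difference the mixed products
  of two connection matrices around G cancel, and the rest assembles into R^T G + G R = 0.\<close>

lemma riemann_antisym2:
  assumes x: "x \<in> D"
  shows "riemann g c k j l m x = - riemann g c j k l m x"
proof -
  let ?G = "g c x"
  have "(\<chi> i j. pd c l (pd c m (G i j)) x) = (\<chi> i j. pd c m (pd c l (G i j)) x)"
    using pd_commute[OF sm_G x] by (simp add: vec_eq_iff)
  from this[unfolded second_covariant_derivative_metric[OF x]]
  have "transpose (Rmm x l m) ** ?G + ?G ** Rmm x l m = 0"
    unfolding Rmm_eq by (simp add: matrix_ring algebra_simps)
  then have "(transpose (Rmm x l m) ** ?G) $ j $ k + (?G ** Rmm x l m) $ j $ k = 0"
    by (metis vector_add_component zero_index)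
  moreover have "(\<Sum>e\<in>UNIV. Rm e j l m x * G e k x) = riemann g c k j l m x"
    unfolding riemann_Rm by (intro sum.cong refl) (simp add: G_sym[OF x, of k])
  ultimately show ?thesis
    by (simp add: matrix_matrix_mult_def transpose_def Rmm_def riemann_Rm)
qed

lemma riemann_pair:
  assumes x: "x \<in> D"
  shows "riemann g c j k l m x = riemann g c l m j k x"
  by (rule curvature_pair_symmetry[of "\<lambda>j k l m. riemann g c j k l m x"])
    (rule riemann_antisym1, rule riemann_antisym2[OF x], rule first_bianchi[OF x])

text \<open>\<open>B\<close> is dR plus the commutator of connection and curvature. The Christoffel
  terms for the two form indices are left out, since by symmetry of the connection they cancel in
  the cyclic sum. With R = d\<Gamma> plus a commutator, only commuting partial derivatives and ring
  algebra remain.\<close>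

lemma second_bianchi:
  assumes x: "x \<in> D"
  defines "B \<equiv> \<lambda>e k i l m. pd c i (Rm e k l m) x + (\<Sum>s\<in>UNIV. \<Gamma> e i s x * Rm s k l m x)
      - (\<Sum>s\<in>UNIV. Rm e s l m x * \<Gamma> s i k x)"
  shows "B e k i l m + B e k l m i + B e k m i l = 0"
proof -
  let ?DD = "\<lambda>i l m. \<chi> e k. pd c i (pd c l (\<Gamma> e m k)) x"
  let ?DR = "\<lambda>i l m. \<chi> e k. pd c i (Rm e k l m) x"
  have DR: "?DR i l m = ?DD i l m - ?DD i m l + D\<Gamma>m x i l ** \<Gamma>m x m + \<Gamma>m x l ** D\<Gamma>m x i m
      - D\<Gamma>m x i m ** \<Gamma>m x l - \<Gamma>m x m ** D\<Gamma>m x i l" for i l m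
    by (simp add: vec_eq_iff Rm_def[abs_def] pd_add pd_diff pd_sum pd_mult sm_intros x
        matrix_matrix_mult_def D\<Gamma>m_def \<Gamma>m_def sum.distrib sum_subtractf)
  have DD: "?DD i l m = ?DD l i m" for i l m
    using pd_commute[OF sm_\<Gamma> x] by (simp add: vec_eq_iff)
  let ?B = "\<lambda>i l m. ?DR i l m + \<Gamma>m x i ** Rmm x l m - Rmm x l m ** \<Gamma>m x i"
  have "?B i l m + ?B l m i + ?B m i l = 0"
    unfolding DR Rmm_eq using DD[of i l m] DD[of l m i] DD[of m i l]
    by (simp add: matrix_ring algebra_simps)
  then have "(?B i l m + ?B l m i + ?B m i l) $ e $ k = 0" by (metis zero_index)
  then show ?thesis
    by (simp add: B_def matrix_matrix_mult_def Rmm_def \<Gamma>m_def)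
qed

section \<open>Covariant derivatives, divergences and traces\<close>

text \<open>\<open>cov2 T k i j\<close> is \<open>\<nabla>\<^sub>k T\<^sub>i\<^sub>j\<close>, \<open>div1 Y k\<close> is \<open>\<nabla>\<^sub>m Y\<^sub>k\<^sup>m\<close>, and \<open>div3 T j k l\<close> is \<open>\<nabla>\<^sub>m T\<^sub>j\<^sub>k\<^sub>l\<^sup>m\<close>.\<close>

definition cov2 :: "('n \<Rightarrow> 'n \<Rightarrow> 'a \<Rightarrow> real) \<Rightarrow> 'n \<Rightarrow> 'n \<Rightarrow> 'n \<Rightarrow> 'a \<Rightarrow> real" where
  "cov2 T k i j x = pd c k (T i j) x - (\<Sum>s\<in>UNIV. \<Gamma> s k i x * T s j x) - (\<Sum>s\<in>UNIV. \<Gamma> s k j x * T i s x)"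

definition div1 :: "('n \<Rightarrow> 'n \<Rightarrow> 'a \<Rightarrow> real) \<Rightarrow> 'n \<Rightarrow> 'a \<Rightarrow> real" where
  "div1 Y k x = (\<Sum>m\<in>UNIV. pd c m (Y k m) x - (\<Sum>s\<in>UNIV. \<Gamma> s m k x * Y s m x) + (\<Sum>s\<in>UNIV. \<Gamma> m m s x * Y k s x))"

definition div3 :: "('n \<Rightarrow> 'n \<Rightarrow> 'n \<Rightarrow> 'n \<Rightarrow> 'a \<Rightarrow> real) \<Rightarrow> 'n \<Rightarrow> 'n \<Rightarrow> 'n \<Rightarrow> 'a \<Rightarrow> real" where
  "div3 T j k l x = (\<Sum>m\<in>UNIV. pd c m (T j k l m) x - (\<Sum>s\<in>UNIV. \<Gamma> s m j x * T s k l m x)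
     - (\<Sum>s\<in>UNIV. \<Gamma> s m k x * T j s l m x) - (\<Sum>s\<in>UNIV. \<Gamma> s m l x * T j k s m x)
     + (\<Sum>s\<in>UNIV. \<Gamma> m m s x * T j k l s x))"

lemma cov2_metric: "x \<in> D \<Longrightarrow> cov2 G k i j x = 0"
  by (simp add: cov2_def metric_compatible)

lemma cov2_cong:
  "(\<And>i j y. y \<in> D \<Longrightarrow> T i j y = T' i j y) \<Longrightarrow> x \<in> D \<Longrightarrow> cov2 T k i j x = cov2 T' k i j x"
  unfolding cov2_def using pd_cong[of "T i j" "T' i j" x k] by simp

lemma div3_cong:
  assumes "\<And>j k l m y. y \<in> D \<Longrightarrow> T j k l m y = T' j k l m y" "x \<in> D"
  shows "div3 T j k l x = div3 T' j k l x"
  unfolding div3_def using assms pd_cong[of "T j k l _" "T' j k l _" x] by simp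

lemma div1_cong:
  assumes "\<And>k m y. y \<in> D \<Longrightarrow> T k m y = T' k m y" "x \<in> D"
  shows "div1 T k x = div1 T' k x"
  unfolding div1_def using assms pd_cong[of "T k _" "T' k _" x] by simp

lemma div3_add_scale:
  assumes "\<And>j k l m. sm (T j k l m)" "\<And>j k l m. sm (T' j k l m)" "x \<in> D"
  shows "div3 (\<lambda>j k l m x. a * T j k l m x + b * T' j k l m x) j k l x = a * div3 T j k l x + b * div3 T' j k l x"
  by (simp add: div3_def pd_add pd_cmult sm_mult sm_const assms sum.distrib sum_distrib_left
      sum_subtractf algebra_simps)

lemma div3_swap: "div3 (\<lambda>j k l m. T k j l m) j k l x = div3 T k j l x"
  by (simp add: div3_def algebra_simps)

lemma div3_metric:
  assumes Y: "\<And>k m. sm (Y k m)" and x: "x \<in> D"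
  shows "div3 (\<lambda>j k l m x. G j l x * Y k m x) j k l x = G j l x * div1 Y k x"
proof -
  have "pd c m (\<lambda>x. G j l x * Y k m x) x - (\<Sum>s\<in>UNIV. \<Gamma> s m j x * (G s l x * Y k m x))
     - (\<Sum>s\<in>UNIV. \<Gamma> s m k x * (G j l x * Y s m x)) - (\<Sum>s\<in>UNIV. \<Gamma> s m l x * (G j s x * Y k m x))
     + (\<Sum>s\<in>UNIV. \<Gamma> m m s x * (G j l x * Y k s x)) =
     G j l x * (pd c m (Y k m) x - (\<Sum>s\<in>UNIV. \<Gamma> s m k x * Y s m x) + (\<Sum>s\<in>UNIV. \<Gamma> m m s x * Y k s x))" for m
  proof -
    have 1: "(\<Sum>s\<in>UNIV. \<Gamma> s m j x * (G s l x * Y k m x)) = (\<Sum>s\<in>UNIV. \<Gamma> s m j x * G s l x) * Y k m x"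
      "(\<Sum>s\<in>UNIV. \<Gamma> s m l x * (G j s x * Y k m x)) = (\<Sum>s\<in>UNIV. \<Gamma> s m l x * G j s x) * Y k m x"
      "(\<Sum>s\<in>UNIV. \<Gamma> s m k x * (G j l x * Y s m x)) = G j l x * (\<Sum>s\<in>UNIV. \<Gamma> s m k x * Y s m x)"
      "(\<Sum>s\<in>UNIV. \<Gamma> m m s x * (G j l x * Y k s x)) = G j l x * (\<Sum>s\<in>UNIV. \<Gamma> m m s x * Y k s x)"
      by (simp_all add: sum_distrib_left sum_distrib_right mult_ac)
    show ?thesis
      unfolding 1 pd_mult[OF sm_G Y x] metric_compatible[OF x] by (simp add: algebra_simps)
  qed
  then show ?thesis by (simp add: div3_def div1_def sum_distrib_left)
qed

text \<open>The Kronecker tensor is parallel, as its two connection terms cancel, and contracting it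
  with the index of differentiation leaves a plain covariant derivative. Together with
  \<open>div3_metric\<close> this treats both kinds of Ricci terms in the Weyl tensor.\<close>

lemma div3_delta:
  assumes P: "\<And>k m. sm (P k m)" and x: "x \<in> D"
  shows "div3 (\<lambda>j k l m x. \<delta> j m * P k l x) j k l x = cov2 P j k l x"
proof -
  have 1: "(\<Sum>s\<in>UNIV. \<Gamma> s m j x * (\<delta> s m * P k l x)) = \<Gamma> m m j x * P k l x"
    "(\<Sum>s\<in>UNIV. \<Gamma> m m s x * (\<delta> j s * P k l x)) = \<Gamma> m m j x * P k l x"
    "(\<Sum>s\<in>UNIV. \<Gamma> s m k x * (\<delta> j m * P s l x)) = \<delta> j m * (\<Sum>s\<in>UNIV. \<Gamma> s m k x * P s l x)"
    "(\<Sum>s\<in>UNIV. \<Gamma> s m l x * (\<delta> j m * P k s x)) = \<delta> j m * (\<Sum>s\<in>UNIV. \<Gamma> s m l x * P k s x)" for m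
  proof -
    have "(\<Sum>s\<in>UNIV. \<Gamma> s m j x * (\<delta> s m * P k l x)) = (\<Sum>s\<in>UNIV. if s = m then \<Gamma> s m j x * P k l x else 0)"
      "(\<Sum>s\<in>UNIV. \<Gamma> m m s x * (\<delta> j s * P k l x)) = (\<Sum>s\<in>UNIV. if j = s then \<Gamma> m m s x * P k l x else 0)"
      by (intro sum.cong refl, simp)+
    then show "(\<Sum>s\<in>UNIV. \<Gamma> s m j x * (\<delta> s m * P k l x)) = \<Gamma> m m j x * P k l x"
      "(\<Sum>s\<in>UNIV. \<Gamma> m m s x * (\<delta> j s * P k l x)) = \<Gamma> m m j x * P k l x" by simp_all
  qed (auto simp: sum_distrib_left)
  have "div3 (\<lambda>j k l m x. \<delta> j m * P k l x) j k l x = (\<Sum>m\<in>UNIV. \<delta> j m * cov2 P m k l x)"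
    unfolding div3_def 1 cov2_def pd_cmult[OF P x]
    by (intro sum.cong refl) (simp add: algebra_simps)
  then show ?thesis by (simp only: sum_delta_mult)
qed

text \<open>The derivative of the inverse metric contributes exactly the connection terms that the
  covariant derivative of the tensor carries.\<close>

lemma contract_cov2:
  assumes T: "\<And>i j. sm (T i j)" and x: "x \<in> D"
  shows "(\<Sum>i\<in>UNIV. \<Sum>j\<in>UNIV. H i j x * cov2 T k i j x) = pd c k (\<lambda>x. \<Sum>i\<in>UNIV. \<Sum>j\<in>UNIV. H i j x * T i j x) x"
proof -
  have "pd c k (\<lambda>x. \<Sum>i\<in>UNIV. \<Sum>j\<in>UNIV. H i j x * T i j x) x =
      (\<Sum>i\<in>UNIV. \<Sum>j\<in>UNIV. pd c k (H i j) x * T i j x + H i j x * pd c k (T i j) x)"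
    by (simp add: pd_sum pd_mult sm_intros T x)
  also have "\<dots> = (\<Sum>i\<in>UNIV. \<Sum>j\<in>UNIV. H i j x * pd c k (T i j) x)
      - (\<Sum>i\<in>UNIV. \<Sum>j\<in>UNIV. (\<Sum>s\<in>UNIV. \<Gamma> i k s x * H s j x) * T i j x)
      - (\<Sum>i\<in>UNIV. \<Sum>j\<in>UNIV. (\<Sum>s\<in>UNIV. \<Gamma> j k s x * H i s x) * T i j x)"
    by (simp only: inverse_metric_compatible[OF x] sum.distrib sum_subtractf sum_negf algebra_simps
        flip: sum_distrib_right) (simp add: algebra_simps sum.distrib sum_subtractf sum_negf)
  also have "\<dots> = (\<Sum>i\<in>UNIV. \<Sum>j\<in>UNIV. H i j x * cov2 T k i j x)"
    unfolding sum_adjoint1 sum_adjoint2 by (simp add: cov2_def right_diff_distrib sum_subtractf)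
  finally show ?thesis by simp
qed

lemma contract_div3:
  assumes T: "\<And>j k l m. sm (T j k l m)" and x: "x \<in> D"
  shows "(\<Sum>j\<in>UNIV. \<Sum>l\<in>UNIV. H j l x * div3 T j k l x) = div1 (\<lambda>k m x. \<Sum>j\<in>UNIV. \<Sum>l\<in>UNIV. H j l x * T j k l m x) k x"
proof -
  have pull: "(\<Sum>s\<in>UNIV. f s * (\<Sum>j\<in>UNIV. \<Sum>l\<in>UNIV. H j l x * h s j l)) =
      (\<Sum>j\<in>UNIV. \<Sum>l\<in>UNIV. H j l x * (\<Sum>s\<in>UNIV. f s * h s j l))" for f and h :: "'n \<Rightarrow> 'n \<Rightarrow> 'n \<Rightarrow> real"
  proof -
    have "(\<Sum>s\<in>UNIV. f s * (\<Sum>j\<in>UNIV. \<Sum>l\<in>UNIV. H j l x * h s j l)) =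
        (\<Sum>s\<in>UNIV. \<Sum>j\<in>UNIV. \<Sum>l\<in>UNIV. H j l x * (f s * h s j l))"
      unfolding sum_distrib_left by (intro sum.cong refl) (simp add: ac_simps)
    also have "\<dots> = (\<Sum>j\<in>UNIV. \<Sum>s\<in>UNIV. \<Sum>l\<in>UNIV. H j l x * (f s * h s j l))"
      by (rule sum.swap)
    also have "\<dots> = (\<Sum>j\<in>UNIV. \<Sum>l\<in>UNIV. \<Sum>s\<in>UNIV. H j l x * (f s * h s j l))"
      by (intro sum.cong refl sum.swap)
    finally show ?thesis by (simp add: sum_distrib_left)
  qed
  let ?q = "\<lambda>j l m. pd c m (T j k l m) x - (\<Sum>s\<in>UNIV. \<Gamma> s m j x * T s k l m x)
     - (\<Sum>s\<in>UNIV. \<Gamma> s m k x * T j s l m x) - (\<Sum>s\<in>UNIV. \<Gamma> s m l x * T j k s m x)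
     + (\<Sum>s\<in>UNIV. \<Gamma> m m s x * T j k l s x)"
  have "(\<Sum>j\<in>UNIV. \<Sum>l\<in>UNIV. H j l x * div3 T j k l x) = (\<Sum>j\<in>UNIV. \<Sum>l\<in>UNIV. \<Sum>m\<in>UNIV. H j l x * ?q j l m)"
    by (simp add: div3_def sum_distrib_left)
  also have "\<dots> = (\<Sum>j\<in>UNIV. \<Sum>m\<in>UNIV. \<Sum>l\<in>UNIV. H j l x * ?q j l m)"
    by (intro sum.cong refl sum.swap)
  also have "\<dots> = (\<Sum>m\<in>UNIV. \<Sum>j\<in>UNIV. \<Sum>l\<in>UNIV. H j l x * ?q j l m)"
    by (rule sum.swap)
  also have "\<dots> = div1 (\<lambda>k m x. \<Sum>j\<in>UNIV. \<Sum>l\<in>UNIV. H j l x * T j k l m x) k x"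
    unfolding div1_def
  proof (intro sum.cong refl)
    fix m
    have "(\<Sum>j\<in>UNIV. \<Sum>l\<in>UNIV. H j l x * cov2 (\<lambda>j l. T j k l m) m j l x) =
        pd c m (\<lambda>x. \<Sum>j\<in>UNIV. \<Sum>l\<in>UNIV. H j l x * T j k l m x) x"
      by (rule contract_cov2[OF T x])
    then show "(\<Sum>j\<in>UNIV. \<Sum>l\<in>UNIV. H j l x * ?q j l m) =
        pd c m (\<lambda>x. \<Sum>j\<in>UNIV. \<Sum>l\<in>UNIV. H j l x * T j k l m x) x
        - (\<Sum>s\<in>UNIV. \<Gamma> s m k x * (\<Sum>j\<in>UNIV. \<Sum>l\<in>UNIV. H j l x * T j s l m x))
        + (\<Sum>s\<in>UNIV. \<Gamma> m m s x * (\<Sum>j\<in>UNIV. \<Sum>l\<in>UNIV. H j l x * T j k l s x))"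
      unfolding pull by (simp add: cov2_def algebra_simps sum.distrib sum_subtractf)
  qed
  finally show ?thesis .
qed

lemma div1_raise:
  assumes T: "\<And>i j. sm (T i j)" and x: "x \<in> D"
  shows "div1 (\<lambda>k m x. \<Sum>e\<in>UNIV. T k e x * H e m x) k x = (\<Sum>m\<in>UNIV. \<Sum>e\<in>UNIV. H e m x * cov2 T m k e x)"
  unfolding div1_def
proof (intro sum.cong refl)
  fix m
  show "pd c m (\<lambda>x. \<Sum>e\<in>UNIV. T k e x * H e m x) x - (\<Sum>s\<in>UNIV. \<Gamma> s m k x * (\<Sum>e\<in>UNIV. T s e x * H e m x))
      + (\<Sum>s\<in>UNIV. \<Gamma> m m s x * (\<Sum>e\<in>UNIV. T k e x * H e s x)) = (\<Sum>e\<in>UNIV. H e m x * cov2 T m k e x)"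
  proof -
    have 1: "pd c m (\<lambda>x. \<Sum>e\<in>UNIV. T k e x * H e m x) x = (\<Sum>e\<in>UNIV. pd c m (T k e) x * H e m x)
        - (\<Sum>e\<in>UNIV. T k e x * (\<Sum>s\<in>UNIV. \<Gamma> e m s x * H s m x)) - (\<Sum>e\<in>UNIV. T k e x * (\<Sum>s\<in>UNIV. \<Gamma> m m s x * H e s x))"
      by (simp add: pd_sum pd_mult sm_intros T x inverse_metric_compatible algebra_simps sum.distrib sum_subtractf sum_negf)
    have 2: "(\<Sum>s\<in>UNIV. \<Gamma> m m s x * (\<Sum>e\<in>UNIV. T k e x * H e s x)) = (\<Sum>e\<in>UNIV. T k e x * (\<Sum>s\<in>UNIV. \<Gamma> m m s x * H e s x))"
      unfolding sum_distrib_left by (subst sum.swap) (intro sum.cong refl, simp add: ac_simps)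
    have 3: "(\<Sum>e\<in>UNIV. T k e x * (\<Sum>s\<in>UNIV. \<Gamma> e m s x * H s m x)) = (\<Sum>e\<in>UNIV. H e m x * (\<Sum>s\<in>UNIV. \<Gamma> s m e x * T k s x))"
      unfolding sum_distrib_left by (subst sum.swap) (intro sum.cong refl, simp add: ac_simps)
    have 4: "(\<Sum>s\<in>UNIV. \<Gamma> s m k x * (\<Sum>e\<in>UNIV. T s e x * H e m x)) = (\<Sum>e\<in>UNIV. H e m x * (\<Sum>s\<in>UNIV. \<Gamma> s m k x * T s e x))"
      unfolding sum_distrib_left by (subst sum.swap) (intro sum.cong refl, simp add: ac_simps)
    show ?thesis
      unfolding 1 2 3 4 cov2_def by (simp add: right_diff_distrib sum_subtractf mult.commute)
  qed
qed

section \<open>Ricci tensor, contracted Bianchi identity and the divergence of the Weyl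
  tensor\<close>

abbreviation Ric :: "'n \<Rightarrow> 'n \<Rightarrow> 'a \<Rightarrow> real" where "Ric \<equiv> ricci g c"
abbreviation Rs :: "'a \<Rightarrow> real" where "Rs \<equiv> scalar_curvature g c"

lemma ricci_Rm:
  assumes x: "x \<in> D"
  shows "Ric k m x = (\<Sum>l\<in>UNIV. Rm l k l m x)"
proof -
  have "Ric k m x = (\<Sum>l\<in>UNIV. \<Sum>j\<in>UNIV. H l j x * riemann g c j k l m x)"
    unfolding ricci_def by (subst sum.swap) (simp add: H_sym[OF x])
  then show ?thesis by (simp add: Rm_riemann[OF x])
qed

lemma sm_ricci: "sm (Ric k m)"
  by (rule sm_cong[of "\<lambda>x. \<Sum>l\<in>UNIV. Rm l k l m x"]) (auto simp: ricci_Rm intro: sm_sum sm_Rm)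

lemma sm_scalar: "sm Rs"
  unfolding scalar_curvature_def by (intro sm_intros sm_ricci)

lemma ricci_sym:
  assumes x: "x \<in> D"
  shows "Ric k m x = Ric m k x"
proof -
  have "Ric k m x = (\<Sum>j\<in>UNIV. \<Sum>l\<in>UNIV. H l j x * riemann g c l m j k x)"
    unfolding ricci_def by (simp add: riemann_pair[OF x, of _ k] H_sym[OF x])
  also have "\<dots> = Ric m k x"
    unfolding ricci_def by (rule sum.swap)
  finally show ?thesis .
qed

text \<open>The second Bianchi identity, traced over the upper index and one index of
  differentiation; the other two cyclic terms turn into derivatives of the Ricci tensor.\<close>

lemma div_Rm:
  assumes x: "x \<in> D"
  shows "div3 (\<lambda>j k l m. Rm m l j k) j k l x = cov2 Ric j l k x - cov2 Ric k l j x"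
proof -
  let ?B = "\<lambda>e k i l m. pd c i (Rm e k l m) x + (\<Sum>s\<in>UNIV. \<Gamma> e i s x * Rm s k l m x)
      - (\<Sum>s\<in>UNIV. Rm e s l m x * \<Gamma> s i k x)"
  have bi: "(\<Sum>m\<in>UNIV. ?B m l m j k) + (\<Sum>m\<in>UNIV. ?B m l j k m) + (\<Sum>m\<in>UNIV. ?B m l k m j) = 0"
    using second_bianchi[OF x, where k = l and l = j and m = k] by (simp flip: sum.distrib)
  have tr: "(\<Sum>m\<in>UNIV. \<Sum>s\<in>UNIV. Rm m s k' m x * f s) = - (\<Sum>s\<in>UNIV. Ric s k' x * f s)"
    "(\<Sum>m\<in>UNIV. \<Sum>s\<in>UNIV. Rm m s m k' x * f s) = (\<Sum>s\<in>UNIV. Ric s k' x * f s)" for k' and f :: "'n \<Rightarrow> real"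
  proof -
    show 2: "(\<Sum>m\<in>UNIV. \<Sum>s\<in>UNIV. Rm m s m k' x * f s) = (\<Sum>s\<in>UNIV. Ric s k' x * f s)"
      by (subst sum.swap) (simp add: ricci_Rm[OF x] sum_distrib_right)
    show "(\<Sum>m\<in>UNIV. \<Sum>s\<in>UNIV. Rm m s k' m x * f s) = - (\<Sum>s\<in>UNIV. Ric s k' x * f s)"
      unfolding 2[symmetric] by (subst Rm_antisym) (simp add: sum_negf)
  qed
  have pdR: "(\<Sum>m\<in>UNIV. pd c i (Rm m l m k') x) = pd c i (Ric l k') x"
    "(\<Sum>m\<in>UNIV. pd c i (Rm m l k' m) x) = - pd c i (Ric l k') x" for i k'
  proof -
    have "pd c i (\<lambda>x. \<Sum>m\<in>UNIV. Rm m l m k' x) x = pd c i (Ric l k') x"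
      by (rule pd_cong[OF _ x]) (simp add: ricci_Rm)
    then show 1: "(\<Sum>m\<in>UNIV. pd c i (Rm m l m k') x) = pd c i (Ric l k') x"
      by (simp add: pd_sum sm_Rm x)
    have "pd c i (Rm m l k' m) x = - pd c i (Rm m l m k') x" for m
    proof -
      have "pd c i (Rm m l k' m) x = pd c i (\<lambda>y. - Rm m l m k' y) x"
        by (rule pd_cong[OF _ x]) (rule Rm_antisym)
      then show ?thesis by (simp add: pd_minus sm_Rm x)
    qed
    then show "(\<Sum>m\<in>UNIV. pd c i (Rm m l k' m) x) = - pd c i (Ric l k') x"
      by (simp add: sum_negf 1)
  qed
  \<comment> \<open>The full divergence contains connection terms on the form indices, which
    \<open>?B\<close> omits. After renaming they cancel the terms on the upper index in the other
    two cyclic summands.\<close>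
  have g1: "(\<Sum>m\<in>UNIV. \<Sum>s\<in>UNIV. \<Gamma> s m j x * Rm m l s k x) = - (\<Sum>m\<in>UNIV. \<Sum>s\<in>UNIV. \<Gamma> m j s x * Rm s l k m x)"
  proof -
    have "(\<Sum>m\<in>UNIV. \<Sum>s\<in>UNIV. \<Gamma> s m j x * Rm m l s k x) = (\<Sum>m\<in>UNIV. \<Sum>s\<in>UNIV. \<Gamma> m s j x * Rm s l m k x)"
      by (rule sum.swap)
    then show ?thesis by (simp add: \<Gamma>_sym[OF x, of _ _ j] Rm_antisym[of _ l _ k] sum_negf)
  qed
  have g2: "(\<Sum>m\<in>UNIV. \<Sum>s\<in>UNIV. \<Gamma> s m k x * Rm m l j s x) = - (\<Sum>m\<in>UNIV. \<Sum>s\<in>UNIV. \<Gamma> m k s x * Rm s l m j x)"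
  proof -
    have "(\<Sum>m\<in>UNIV. \<Sum>s\<in>UNIV. \<Gamma> s m k x * Rm m l j s x) = (\<Sum>m\<in>UNIV. \<Sum>s\<in>UNIV. \<Gamma> m s k x * Rm s l j m x)"
      by (rule sum.swap)
    then show ?thesis by (simp add: \<Gamma>_sym[OF x, of _ _ k] Rm_antisym[of _ l j] sum_negf)
  qed
  have "div3 (\<lambda>j k l m. Rm m l j k) j k l x = (\<Sum>m\<in>UNIV. ?B m l m j k)
      - (\<Sum>m\<in>UNIV. \<Sum>s\<in>UNIV. \<Gamma> s m j x * Rm m l s k x) - (\<Sum>m\<in>UNIV. \<Sum>s\<in>UNIV. \<Gamma> s m k x * Rm m l j s x)"
    by (simp add: div3_def sum.distrib sum_subtractf mult.commute)
  also have "(\<Sum>m\<in>UNIV. ?B m l m j k) = pd c j (Ric l k) x - (\<Sum>m\<in>UNIV. \<Sum>s\<in>UNIV. \<Gamma> m j s x * Rm s l k m x)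
      - (\<Sum>s\<in>UNIV. Ric s k x * \<Gamma> s j l x) - pd c k (Ric l j) x
      - (\<Sum>m\<in>UNIV. \<Sum>s\<in>UNIV. \<Gamma> m k s x * Rm s l m j x) + (\<Sum>s\<in>UNIV. Ric s j x * \<Gamma> s k l x)"
    using bi by (simp add: sum.distrib sum_subtractf tr pdR)
  finally show ?thesis
    unfolding g1 g2 by (simp add: cov2_def mult.commute \<Gamma>_sym[OF x, of _ j k])
qed

lemma contract_Rm:
  assumes x: "x \<in> D"
  shows "(\<Sum>j\<in>UNIV. \<Sum>l\<in>UNIV. H j l x * Rm m l j k x) = - (\<Sum>e\<in>UNIV. Ric k e x * H e m x)"
proof -
  have "(\<Sum>j\<in>UNIV. \<Sum>l\<in>UNIV. H j l x * Rm m l j k x) =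
      (\<Sum>j\<in>UNIV. \<Sum>l\<in>UNIV. \<Sum>e\<in>UNIV. H m e x * (H j l x * riemann g c e l j k x))"
    unfolding Rm_riemann[OF x] sum_distrib_left by (intro sum.cong refl) (simp add: ac_simps)
  also have "\<dots> = (\<Sum>j\<in>UNIV. \<Sum>e\<in>UNIV. \<Sum>l\<in>UNIV. H m e x * (H j l x * riemann g c e l j k x))"
    by (intro sum.cong refl sum.swap)
  also have "\<dots> = (\<Sum>e\<in>UNIV. \<Sum>j\<in>UNIV. \<Sum>l\<in>UNIV. H m e x * (H j l x * riemann g c e l j k x))"
    by (rule sum.swap)
  also have "\<dots> = (\<Sum>e\<in>UNIV. H m e x * (\<Sum>j\<in>UNIV. \<Sum>l\<in>UNIV. H j l x * riemann g c e l j k x))"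
    by (simp add: sum_distrib_left)
  also have "\<dots> = (\<Sum>e\<in>UNIV. H m e x * - Ric e k x)"
  proof (intro sum.cong refl arg_cong2[where f = "(*)"])
    fix e
    have "(\<Sum>j\<in>UNIV. \<Sum>l\<in>UNIV. H j l x * riemann g c e l j k x) = (\<Sum>l\<in>UNIV. \<Sum>j\<in>UNIV. H l j x * - riemann g c l e j k x)"
      by (subst sum.swap) (simp add: H_sym[OF x] riemann_antisym2[OF x, of e])
    then show "(\<Sum>j\<in>UNIV. \<Sum>l\<in>UNIV. H j l x * riemann g c e l j k x) = - Ric e k x"
      by (simp add: ricci_def sum_negf)
  qed
  finally show ?thesis by (simp add: sum_negf ricci_sym[OF x, of k] H_sym[OF x, of m] mult.commute)
qed

text \<open>Tracing \<open>div_Rm\<close> once more, with d the divergence of Ricci, turns it into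
  -d = d - dR.\<close>

lemma contracted_bianchi:
  assumes x: "x \<in> D"
  shows "div1 (\<lambda>k m x. \<Sum>e\<in>UNIV. Ric k e x * H e m x) k x = pd c k Rs x / 2"
proof -
  let ?d = "div1 (\<lambda>k m x. \<Sum>e\<in>UNIV. Ric k e x * H e m x) k x"
  have "(\<Sum>j\<in>UNIV. \<Sum>l\<in>UNIV. H j l x * div3 (\<lambda>j k l m. Rm m l j k) j k l x) =
      div1 (\<lambda>k m x. \<Sum>j\<in>UNIV. \<Sum>l\<in>UNIV. H j l x * Rm m l j k x) k x"
    by (rule contract_div3[OF sm_Rm x])
  also have "\<dots> = div1 (\<lambda>k m x. - (\<Sum>e\<in>UNIV. Ric k e x * H e m x)) k x"
    by (rule div1_cong[OF _ x]) (simp add: contract_Rm)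
  also have "\<dots> = - ?d"
  proof -
    have "pd c m (\<lambda>x. - (\<Sum>e\<in>UNIV. Ric k e x * H e m x)) x = - pd c m (\<lambda>x. \<Sum>e\<in>UNIV. Ric k e x * H e m x) x" for m
      by (intro pd_minus sm_intros sm_ricci x)
    then show ?thesis by (simp add: div1_def sum_negf sum_subtractf sum.distrib)
  qed
  finally have 1: "(\<Sum>j\<in>UNIV. \<Sum>l\<in>UNIV. H j l x * cov2 Ric j l k x) - (\<Sum>j\<in>UNIV. \<Sum>l\<in>UNIV. H j l x * cov2 Ric k l j x) = - ?d"
    by (simp add: div_Rm[OF x] right_diff_distrib sum_subtractf)
  have "cov2 Ric j l k x = cov2 Ric j k l x" for j l
    using pd_cong[OF _ x, of "Ric l k" "Ric k l" j] by (simp add: cov2_def ricci_sym[OF x] ricci_sym)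
  then have 2: "(\<Sum>j\<in>UNIV. \<Sum>l\<in>UNIV. H j l x * cov2 Ric j l k x) = ?d"
    by (simp add: div1_raise[OF sm_ricci x] H_sym[OF x])
  have "(\<Sum>j\<in>UNIV. \<Sum>l\<in>UNIV. H j l x * cov2 Ric k l j x) = (\<Sum>l\<in>UNIV. \<Sum>j\<in>UNIV. H l j x * cov2 Ric k l j x)"
    by (subst sum.swap) (simp add: H_sym[OF x])
  also have "\<dots> = pd c k Rs x"
    unfolding scalar_curvature_def[abs_def] by (rule contract_cov2[OF sm_ricci x])
  finally show ?thesis using 1 2 by simp
qed

text \<open>\<open>P\<close> is n - 2 times the Schouten tensor: this choice of trace term absorbs
  the scalar curvature part of the Weyl tensor into the Ricci part. Pair symmetry moves the raised
  index of Riemann to the front, to fit \<open>div_Rm\<close>.\<close>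

lemma weyl_up_decomposition:
  assumes x: "x \<in> D"
  defines "n \<equiv> real CARD('n)"
  defines "P \<equiv> \<lambda>k l x. Ric k l x - Rs x / (2 * (n - 1)) * G k l x"
  assumes n: "n > 2"
  shows "weyl_up g c j k l m x = - Rm m l j k x - (1 / (n - 2)) *
    (G j l x * (\<Sum>e\<in>UNIV. P k e x * H e m x) - \<delta> j m * P k l x - (G k l x * (\<Sum>e\<in>UNIV. P j e x * H e m x) - \<delta> k m * P j l x))"
proof -
  have 1: "(\<Sum>e\<in>UNIV. riemann g c j k l e x * H e m x) = - Rm m l j k x"
  proof -
    have "riemann g c j k l e x = - riemann g c e l j k x" for e
      using riemann_pair[OF x, of j k l e] riemann_antisym2[OF x, of l e j k] by simp
    then show ?thesis by (simp add: Rm_riemann[OF x] sum_negf H_sym[OF x, of m] mult.commute)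
  qed
  have GHs: "(\<Sum>e\<in>UNIV. G a e x * (H e m x * b)) = \<delta> a m * b" for a b
    using GH[OF x, of a m] by (simp add: sum_distrib_right[symmetric] mult.assoc[symmetric] del: mult.assoc)
  have W: "weyl g c j k l e x = riemann g c j k l e x - (1 / (n - 2)) * (G j l x * P k e x - G j e x * P k l x - (G k l x * P j e x - G k e x * P j l x))" for e
  proof -
    have "n - 1 \<noteq> 0" "n - 2 \<noteq> 0" using n by auto
    then show ?thesis
      unfolding weyl_def P_def n_def[symmetric] by (simp add: divide_simps) (simp add: algebra_simps)
  qed
  have "weyl_up g c j k l m x = (\<Sum>e\<in>UNIV. riemann g c j k l e x * H e m x) - (1 / (n - 2)) *
      (G j l x * (\<Sum>e\<in>UNIV. P k e x * H e m x) - (\<Sum>e\<in>UNIV. G j e x * (H e m x * P k l x))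
       - (G k l x * (\<Sum>e\<in>UNIV. P j e x * H e m x) - (\<Sum>e\<in>UNIV. G k e x * (H e m x * P j l x))))"
    unfolding weyl_up_def W by (simp add: algebra_simps sum.distrib sum_subtractf sum_distrib_left sum_distrib_right sum_divide_distrib diff_divide_distrib add_divide_distrib)
  then show ?thesis unfolding 1 GHs .
qed

text \<open>The divergence of the Riemann part is the antisymmetrized derivative of Ricci, and that
  of the remaining part is -1/(n - 2) times the same expression in \<open>P\<close>, up to gradient
  terms that cancel. What is left is multiplied by 1 - 1/(n - 2), nonzero for n > 3.\<close>

theorem codazzi:
  assumes x: "x \<in> D"
  defines "n \<equiv> real CARD('n)"
  defines "P \<equiv> \<lambda>k l x. Ric k l x - Rs x / (2 * (n - 1)) * G k l x"
  assumes n: "n > 3"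
    and div: "(\<Sum>m\<in>UNIV. nabla_weyl_up g c m j k l m x) = 0"
  shows "cov2 P k j l x = cov2 P j k l x"
proof -
  define \<rho> where "\<rho> x = Rs x / (2 * (n - 1))" for x
  have P: "P k l x = Ric k l x - \<rho> x * G k l x" for k l x by (simp add: P_def \<rho>_def)
  have sm_\<rho>: "sm \<rho>" unfolding \<rho>_def[abs_def] by (intro sm_intros sm_scalar)
  have sm_P: "sm (P i j)" for i j unfolding P[abs_def] by (intro sm_intros sm_ricci sm_\<rho>)
  let ?Pu = "\<lambda>k m x. \<Sum>e\<in>UNIV. P k e x * H e m x"
  have sm_Pu: "sm (?Pu i j)" for i j by (intro sm_intros sm_P)
  \<comment> \<open>One half of the Ricci part, to be antisymmetrized in j and k; the explicit
    coefficients 1 and -1 put it into the shape of \<open>div3_add_scale\<close>.\<close>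
  define S1 where "S1 = (\<lambda>j k l m x. 1 * (G j l x * ?Pu k m x) + (-1) * (\<delta> j m * P k l x))"
  have sm_S1: "sm (S1 j k l m)" for j k l m unfolding S1_def by (intro sm_intros sm_P)
  let ?S = "\<lambda>j k l m x. 1 * S1 j k l m x + (-1) * S1 k j l m x"
  have sm_S: "sm (?S j k l m)" for j k l m by (intro sm_intros sm_S1)
  have S1: "div3 S1 j k l x = G j l x * div1 ?Pu k x - cov2 P j k l x" for j k l
    unfolding S1_def by (subst div3_add_scale) (simp_all add: div3_metric[OF sm_Pu x] div3_delta[OF sm_P x] sm_intros sm_P x)
  have S: "div3 ?S j k l x = div3 S1 j k l x - div3 S1 k j l x"
    by (subst div3_add_scale[OF sm_S1 sm_S1 x]) (simp add: div3_swap[of S1])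
  have "0 = div3 (weyl_up g c) j k l x"
    using div by (simp add: div3_def nabla_weyl_up_def)
  also have "\<dots> = div3 (\<lambda>j k l m x. (-1) * Rm m l j k x + (- (1 / (n - 2))) * ?S j k l m x) j k l x"
    by (rule div3_cong[OF _ x]) (use weyl_up_decomposition n in \<open>simp add: n_def P_def S1_def\<close>)
  also have "\<dots> = - div3 (\<lambda>j k l m. Rm m l j k) j k l x - (1 / (n - 2)) * div3 ?S j k l x"
    by (subst div3_add_scale[OF sm_Rm sm_S x]) simp
  finally have main: "cov2 Ric j l k x - cov2 Ric k l j x + (1 / (n - 2)) * ((G j l x * div1 ?Pu k x - cov2 P j k l x) - (G k l x * div1 ?Pu j x - cov2 P k j l x)) = 0"
    unfolding div_Rm[OF x] S S1 by simp
  have covP: "cov2 P i a b x = cov2 Ric i a b x - pd c i \<rho> x * G a b x" for i a b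
  proof -
    have "cov2 P i a b x = cov2 Ric i a b x - pd c i \<rho> x * G a b x - \<rho> x * cov2 G i a b x"
      unfolding cov2_def P by (simp add: pd_diff pd_mult sm_intros sm_ricci sm_\<rho> x algebra_simps sum_subtractf sum_distrib_left)
    then show ?thesis by (simp add: cov2_metric[OF x])
  qed
  have Rics: "cov2 Ric i a b x = cov2 Ric i b a x" for i a b
    using pd_cong[OF _ x, of "Ric a b" "Ric b a" i] by (simp add: cov2_def ricci_sym[OF x] ricci_sym)
  \<comment> \<open>Contracted Bianchi gives half the gradient of the scalar curvature, that is (n -
    1) d\<rho>, and the trace term takes away one d\<rho>. The factor n - 2 then cancels the
    denominator in \<open>main\<close>.\<close>
  have dP: "div1 ?Pu k x = (n - 2) * pd c k \<rho> x" for k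
  proof -
    have "div1 ?Pu k x = (\<Sum>m\<in>UNIV. \<Sum>e\<in>UNIV. H e m x * cov2 P m k e x)"
      by (rule div1_raise[OF sm_P x])
    also have "\<dots> = (\<Sum>m\<in>UNIV. \<Sum>e\<in>UNIV. H e m x * cov2 Ric m k e x) - (\<Sum>m\<in>UNIV. \<Sum>e\<in>UNIV. H e m x * (pd c m \<rho> x * G k e x))"
      unfolding covP by (simp add: right_diff_distrib sum_subtractf)
    also have "(\<Sum>m\<in>UNIV. \<Sum>e\<in>UNIV. H e m x * cov2 Ric m k e x) = pd c k Rs x / 2"
      unfolding contracted_bianchi[OF x, symmetric] by (rule div1_raise[OF sm_ricci x, symmetric])
    also have "(\<Sum>m\<in>UNIV. \<Sum>e\<in>UNIV. H e m x * (pd c m \<rho> x * G k e x)) = (\<Sum>m\<in>UNIV. \<delta> k m * pd c m \<rho> x)"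
      unfolding GH[OF x, symmetric] sum_distrib_right by (intro sum.cong refl) (simp add: ac_simps)
    also have "\<dots> = pd c k \<rho> x" by (simp only: sum_delta_mult)
    also have "pd c k Rs x = 2 * (n - 1) * pd c k \<rho> x"
      unfolding \<rho>_def[abs_def] pd_divide_const[OF sm_scalar x] using n by simp
    finally show ?thesis by (simp add: algebra_simps)
  qed
  have "cov2 Ric j l k x - cov2 Ric k l j x = (cov2 P j k l x + pd c j \<rho> x * G k l x) - (cov2 P k j l x + pd c k \<rho> x * G j l x)"
    using covP[of j k l] covP[of k j l] Rics[of j l k] Rics[of k l j] by simp
  from main[unfolded this dP]
  have "(1 - 1 / (n - 2)) * (cov2 P k j l x - cov2 P j k l x) = 0"
    using n by (simp add: field_simps)
  moreover have "1 - 1 / (n - 2) \<noteq> 0" using n by (simp add: field_simps)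
  ultimately have "cov2 P k j l x - cov2 P j k l x = 0" unfolding mult_eq_0_iff by blast
  then show ?thesis by simp
qed

end

section \<open>Perfect fluids with divergence-free Weyl tensor\<close>

lemma contraction_rules:
  fixes w :: "'i \<Rightarrow> real"
  shows "(\<Sum>j\<in>I. w j * (f j + h j)) = (\<Sum>j\<in>I. w j * f j) + (\<Sum>j\<in>I. w j * h j)"
    "(\<Sum>j\<in>I. w j * (f j - h j)) = (\<Sum>j\<in>I. w j * f j) - (\<Sum>j\<in>I. w j * h j)"
    "(\<Sum>j\<in>I. w j * (a * f j)) = a * (\<Sum>j\<in>I. w j * f j)"
    "(\<Sum>j\<in>I. w j * (f j * a)) = (\<Sum>j\<in>I. w j * f j) * a"
  by (simp_all add: sum.distrib sum_subtractf sum_distrib_left sum_distrib_right algebra_simps)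

lemma double_contraction_rules:
  fixes w :: "'i \<Rightarrow> 'j \<Rightarrow> real"
  shows "(\<Sum>j\<in>I. \<Sum>l\<in>J. w j l * (f j l + h j l)) = (\<Sum>j\<in>I. \<Sum>l\<in>J. w j l * f j l) + (\<Sum>j\<in>I. \<Sum>l\<in>J. w j l * h j l)"
    "(\<Sum>j\<in>I. \<Sum>l\<in>J. w j l * (f j l - h j l)) = (\<Sum>j\<in>I. \<Sum>l\<in>J. w j l * f j l) - (\<Sum>j\<in>I. \<Sum>l\<in>J. w j l * h j l)"
    "(\<Sum>j\<in>I. \<Sum>l\<in>J. w j l * (a * f j l)) = a * (\<Sum>j\<in>I. \<Sum>l\<in>J. w j l * f j l)"
    "(\<Sum>j\<in>I. \<Sum>l\<in>J. w j l * (f j l * a)) = (\<Sum>j\<in>I. \<Sum>l\<in>J. w j l * f j l) * a"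
  by (simp_all add: sum.distrib sum_subtractf sum_distrib_left sum_distrib_right algebra_simps)

text \<open>Pure linear algebra at a point: \<open>A\<close> and \<open>B\<close> stand for the differentials of the coefficients in
  \<open>P\<^sub>i\<^sub>j = \<alpha> g\<^sub>i\<^sub>j + \<beta> u\<^sub>i u\<^sub>j\<close>, and \<open>N\<close> for \<open>\<nabla>u\<close>; \<open>cod\<close> is the Codazzi equation for \<open>P\<close>.  Contracting it
  with \<open>u\<close> and with the metric determines \<open>N\<close>.\<close>

lemma codazzi_perfect_fluid:
  fixes G H N :: "'n::finite \<Rightarrow> 'n \<Rightarrow> real" and U V A B :: "'n \<Rightarrow> real" and \<beta> b :: real
  assumes \<beta>: "\<beta> \<noteq> 0" and n: "CARD('n) \<ge> 3"
    and H_sym: "\<And>i j. H i j = H j i" and HG: "\<And>i j. (\<Sum>s\<in>UNIV. H i s * G s j) = (if i = j then 1 else 0)"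
    and V: "\<And>j. V j = (\<Sum>l\<in>UNIV. H j l * U l)" and U: "\<And>j. U j = (\<Sum>l\<in>UNIV. G j l * V l)"
    and G_sym: "\<And>i j. G i j = G j i"
    and unit: "(\<Sum>j\<in>UNIV. V j * U j) = -1"
    and VN: "\<And>k. (\<Sum>l\<in>UNIV. V l * N k l) = 0"
    and dep: "\<And>k. B k = b * A k"
    and cod: "\<And>j k l. A k * G j l - A j * G k l + B k * (U j * U l) - B j * (U k * U l)
      + \<beta> * (N k j * U l - N j k * U l) + \<beta> * (U j * N k l - U k * N j l) = 0"
  defines "A' \<equiv> \<Sum>j\<in>UNIV. V j * A j"
  shows "N k l = - A' / \<beta> * (G k l + U k * U l)" "A k = - A' * U k"
proof -
  define B' where "B' = (\<Sum>j\<in>UNIV. V j * B j)"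
  define a where "a l = (\<Sum>j\<in>UNIV. V j * N j l)" for l
  define \<theta> where "\<theta> = (\<Sum>j\<in>UNIV. \<Sum>l\<in>UNIV. H j l * N j l)"
  have VG: "(\<Sum>j\<in>UNIV. V j * G j l) = U l" "(\<Sum>j\<in>UNIV. V j * G l j) = U l" for l
    unfolding U by (intro sum.cong refl, simp add: G_sym mult.commute)+
  \<comment> \<open>First contraction, with u in the index j. Here \<open>a\<close> is the
    acceleration and \<theta> the divergence of u; terms with u contracted into the second slot of
    \<open>N\<close> vanish by \<open>VN\<close>.\<close>
  have "(\<Sum>j\<in>UNIV. V j * (A k * G j l - A j * G k l + B k * (U j * U l) - B j * (U k * U l)
      + \<beta> * (N k j * U l - N j k * U l) + \<beta> * (U j * N k l - U k * N j l))) = 0" for k l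
    unfolding cod by simp
  then have 3: "A k * U l - A' * G k l + B k * (- U l) - B' * (U k * U l)
      + \<beta> * (0 - a k * U l) + \<beta> * (- N k l - U k * a l) = 0" for k l
    by (simp only: contraction_rules VG VN unit a_def[symmetric] A'_def[symmetric] B'_def[symmetric]) simp
  have Va: "(\<Sum>l\<in>UNIV. V l * a l) = 0"
  proof -
    have "(\<Sum>l\<in>UNIV. V l * a l) = (\<Sum>l\<in>UNIV. \<Sum>j\<in>UNIV. V j * (V l * N j l))"
      unfolding a_def sum_distrib_left by (intro sum.cong refl) (simp add: ac_simps)
    also have "\<dots> = (\<Sum>j\<in>UNIV. V j * (\<Sum>l\<in>UNIV. V l * N j l))"
      unfolding sum_distrib_left by (rule sum.swap)
    finally show ?thesis by (simp add: VN)
  qed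
  \<comment> \<open>Second contraction with u, now in l. The factors 0 and -1 are spelled out so
    that each summand matches a contraction rule.\<close>
  have "(\<Sum>l\<in>UNIV. V l * (A k * U l - A' * G k l + B k * (- 1 * U l) - B' * (U k * U l)
      + \<beta> * (0 * U l - a k * U l) + \<beta> * (- 1 * N k l - U k * a l))) = 0" for k
    using 3[of k] by simp
  then have 4: "- A k - A' * U k + B k + B' * U k + \<beta> * a k = 0" for k
    by (simp only: contraction_rules VG VN unit Va) (simp add: algebra_simps)
  have 5: "\<beta> * N k l = - A' * G k l - A' * U k * U l - \<beta> * U k * a l" for k l
  proof -
    have "(- A k - A' * U k + B k + B' * U k + \<beta> * a k) * U l = 0" using 4[of k] by simp
    then show ?thesis using 3[of k l] by (simp add: algebra_simps)
  qed
  have HGtr: "(\<Sum>j\<in>UNIV. \<Sum>l\<in>UNIV. H j l * G j l) = real CARD('n)"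
  proof -
    have "(\<Sum>j\<in>UNIV. \<Sum>l\<in>UNIV. H j l * G j l) = (\<Sum>j\<in>UNIV. \<Sum>l\<in>UNIV. H j l * G l j)"
      by (intro sum.cong refl) (simp add: G_sym)
    then show ?thesis by (simp add: HG)
  qed
  have HfU: "(\<Sum>j\<in>UNIV. \<Sum>l\<in>UNIV. H j l * (f j * U l)) = (\<Sum>j\<in>UNIV. V j * f j)" for f
    unfolding V sum_distrib_right by (intro sum.cong refl) (simp add: ac_simps)
  have HUf: "(\<Sum>j\<in>UNIV. \<Sum>l\<in>UNIV. H j l * (U j * f l)) = (\<Sum>j\<in>UNIV. V j * f j)" for f
    unfolding V sum_distrib_right by (subst sum.swap) (intro sum.cong refl, simp add: H_sym ac_simps)
  have HfG: "(\<Sum>j\<in>UNIV. \<Sum>l\<in>UNIV. H j l * (f j * G k l)) = f k" for f k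
  proof -
    have "(\<Sum>j\<in>UNIV. \<Sum>l\<in>UNIV. H j l * (f j * G k l)) = (\<Sum>j\<in>UNIV. (\<Sum>l\<in>UNIV. H j l * G l k) * f j)"
      unfolding sum_distrib_right by (intro sum.cong refl) (simp add: G_sym[of k] ac_simps)
    then show ?thesis by (simp add: HG if_distrib if_distribR sum.delta cong: if_cong)
  qed
  \<comment> \<open>The metric trace over j and l, independent of the contractions with u; it brings
    in the dimension and \<theta>.\<close>
  have "(\<Sum>j\<in>UNIV. \<Sum>l\<in>UNIV. H j l * (A k * G j l - A j * G k l + B k * (U j * U l) - B j * U l * U k
      + \<beta> * (N k j * U l - N j k * U l) + \<beta> * (U j * N k l - U k * N j l))) = 0" for k
  proof -
    have "A k * G j l - A j * G k l + B k * (U j * U l) - B j * U l * U k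
      + \<beta> * (N k j * U l - N j k * U l) + \<beta> * (U j * N k l - U k * N j l) = 0" for j l
      using cod[of k j l] by (simp add: ac_simps)
    then show ?thesis by simp
  qed
  then have 2: "A k * real CARD('n) - A k + B k * (-1) - B' * U k + \<beta> * (0 - a k) + \<beta> * (0 - U k * \<theta>) = 0" for k
    by (simp only: double_contraction_rules HGtr HfG HUf HfU VN unit a_def[symmetric] B'_def[symmetric] \<theta>_def[symmetric])
  have \<theta>: "\<beta> * \<theta> = - (real CARD('n) - 1) * A'"
  proof -
    have "\<beta> * \<theta> = (\<Sum>j\<in>UNIV. \<Sum>l\<in>UNIV. H j l * (\<beta> * N j l))"
      by (simp only: double_contraction_rules \<theta>_def)
    also have "\<dots> = (\<Sum>j\<in>UNIV. \<Sum>l\<in>UNIV. H j l * ((- A') * G j l - A' * (U j * U l) - \<beta> * (U j * a l)))"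
      unfolding 5 by (simp add: mult.assoc)
    also have "\<dots> = - A' * real CARD('n) - A' * (-1) - \<beta> * 0"
      by (simp only: double_contraction_rules HGtr HUf unit Va)
    finally show ?thesis by (simp add: algebra_simps)
  qed
  have A: "A k = - A' * U k" for k
  proof -
    have "\<beta> * (U k * \<theta>) = U k * (- (real CARD('n) - 1) * A')" unfolding \<theta>[symmetric] by simp
    then have "(real CARD('n) - 2) * (A k + A' * U k) = 0"
      using 2[of k] 4[of k] by (simp add: algebra_simps)
    then show ?thesis using n by simp
  qed
  have "B' = b * A'" unfolding B'_def A'_def dep by (simp only: contraction_rules)
  \<comment> \<open>Proportional differentials make \<open>B k + B' * U k\<close> a multiple of
    \<open>A k + A' * U k\<close>, hence zero, and only the acceleration survives in the double
    contraction. This is where the equation of state acts.\<close>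
  then have "\<beta> * a k = 0" for k using 4[of k] A[of k] dep[of k] by (simp add: algebra_simps)
  then have a0: "a k = 0" for k using \<beta> by simp
  show "N k l = - A' / \<beta> * (G k l + U k * U l)"
    using 5[of k l] \<beta> by (simp add: a0 field_simps)
  show "A k = - A' * U k" by (rule A)
qed

text \<open>The equation of state appears only through its infinitesimal trace, dp = b d\<mu> at
  each point; no regularity is asked of b as a function of the point.\<close>

locale fluid_chart = metric_chart X c g for X :: "'a topology" and c :: "('a, 'n::finite) chart" and g +
  fixes u :: "('a, 'n) vector_field" and \<kappa> :: real and p \<mu> :: "'a \<Rightarrow> real"
  assumes dim: "CARD('n) \<ge> 4" and kappa: "\<kappa> \<noteq> 0"
    and smooth_u: "smooth_in_chart c (u c)" and sm_p: "smooth_in_chart c p" and sm_\<mu>: "smooth_in_chart c \<mu>"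
    and unit_u: "x \<in> chart_dom c \<Longrightarrow> (\<Sum>j\<in>UNIV. u c x $ j * flat g u c x $ j) = -1"
    and einstein: "x \<in> chart_dom c \<Longrightarrow> ricci g c i j x - 1/2 * scalar_curvature g c x * g c x $ i $ j
               = \<kappa> * fluid_stress g u p \<mu> c i j x"
    and state: "x \<in> chart_dom c \<Longrightarrow> \<exists>b. \<forall>i. pd c i p x = b * pd c i \<mu> x"
    and nonzero: "x \<in> chart_dom c \<Longrightarrow> p x + \<mu> x \<noteq> 0"
    and div_weyl: "x \<in> chart_dom c \<Longrightarrow> (\<Sum>m\<in>UNIV. nabla_weyl_up g c m j k l m x) = 0"
begin

abbreviation V :: "'n \<Rightarrow> 'a \<Rightarrow> real" where "V i x \<equiv> u c x $ i"
abbreviation U :: "'n \<Rightarrow> 'a \<Rightarrow> real" where "U i x \<equiv> flat g u c x $ i"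
abbreviation N :: "'n \<Rightarrow> 'n \<Rightarrow> 'a \<Rightarrow> real" where "N \<equiv> nabla_form g c (flat g u)"

lemma U_eq: "U i x = (\<Sum>j\<in>UNIV. G i j x * V j x)"
  by (simp add: flat_def matrix_vector_mult_def)

lemma V_eq: "x \<in> D \<Longrightarrow> V i x = (\<Sum>j\<in>UNIV. H i j x * U j x)"
proof -
  assume x: "x \<in> D"
  have "ginv g c x *v flat g u c x = u c x"
    using matrix_inv_inverse(2)[OF inv_g[OF x]] by (simp add: flat_def ginv_def matrix_vector_mul_assoc)
  then show ?thesis by (metis (no_types, lifting) matrix_vector_mult_def sum.cong vec_lambda_beta)
qed

lemma sm_V: "sm (V i)"
  using smooth_u smooth_on_vec_nth[OF open_img] unfolding smooth_in_chart_def o_def by blast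

lemma sm_U: "sm (U i)"
  unfolding U_eq by (intro sm_intros sm_V)

text \<open>\<open>\<alpha>\<close> and \<open>\<beta>\<close> will be the coefficients of g and of
  u tensor u in \<open>P\<close>, \<open>\<alpha>'\<close> is the derivative of
  \<open>\<alpha>\<close> along u, and \<open>\<phi>\<close> is the value that the algebraic lemma
  forces on the torse-forming coefficient; the divergence of u is then (n - 1) \<phi>.\<close>

definition \<alpha> :: "'a \<Rightarrow> real" where "\<alpha> x = \<kappa> * \<mu> x / (real CARD('n) - 1)"
definition \<beta> :: "'a \<Rightarrow> real" where "\<beta> x = \<kappa> * (p x + \<mu> x)"
definition P :: "'n \<Rightarrow> 'n \<Rightarrow> 'a \<Rightarrow> real" where
  "P k l x = Ric k l x - Rs x / (2 * (real CARD('n) - 1)) * G k l x"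
definition \<alpha>' :: "'a \<Rightarrow> real" where "\<alpha>' x = (\<Sum>j\<in>UNIV. V j x * pd c j \<alpha> x)"
definition \<phi> :: "'a \<Rightarrow> real" where "\<phi> x = - \<alpha>' x / \<beta> x"

lemma sm_\<alpha>: "sm \<alpha>" unfolding \<alpha>_def[abs_def] by (intro sm_intros sm_\<mu>)
lemma sm_\<beta>: "sm \<beta>" unfolding \<beta>_def[abs_def] by (intro sm_intros sm_\<mu> sm_p)
lemma sm_\<alpha>': "sm \<alpha>'" unfolding \<alpha>'_def[abs_def] by (intro sm_intros sm_V sm_\<alpha>)
lemma \<beta>_nonzero: "x \<in> D \<Longrightarrow> \<beta> x \<noteq> 0" using kappa nonzero by (simp add: \<beta>_def)

lemma sm_\<phi>: "sm \<phi>"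
proof -
  have "sm (\<lambda>x. - \<alpha>' x * inverse (\<beta> x))"
    by (intro sm_intros sm_inverse sm_\<alpha>' sm_\<beta> \<beta>_nonzero)
  then show ?thesis unfolding \<phi>_def[abs_def] by (simp add: divide_inverse)
qed

lemma trace_metric: "x \<in> D \<Longrightarrow> (\<Sum>i\<in>UNIV. \<Sum>j\<in>UNIV. H i j x * G i j x) = real CARD('n)"
proof -
  assume x: "x \<in> D"
  have "(\<Sum>i\<in>UNIV. \<Sum>j\<in>UNIV. H i j x * G i j x) = (\<Sum>i\<in>UNIV. \<Sum>j\<in>UNIV. H i j x * G j i x)"
    by (intro sum.cong refl) (simp add: G_sym[OF x])
  then show ?thesis by (simp add: HG[OF x])
qed

lemma contract_U: "x \<in> D \<Longrightarrow> (\<Sum>i\<in>UNIV. \<Sum>j\<in>UNIV. H i j x * (f i * U j x)) = (\<Sum>i\<in>UNIV. V i x * f i)"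
  unfolding V_eq sum_distrib_right by (intro sum.cong refl) (simp add: ac_simps)

lemma contract_U': "x \<in> D \<Longrightarrow> (\<Sum>i\<in>UNIV. \<Sum>j\<in>UNIV. H i j x * (U i x * f j)) = (\<Sum>i\<in>UNIV. V i x * f i)"
  unfolding V_eq sum_distrib_right
  by (subst sum.swap) (intro sum.cong refl, simp add: H_sym[of x] ac_simps)

text \<open>Tracing Einstein's equations expresses the scalar curvature through p and \<mu>. After
  substitution the pressure drops out of the coefficient of g.\<close>

lemma P_eq:
  assumes x: "x \<in> D"
  shows "P k l x = \<alpha> x * G k l x + \<beta> x * (U k x * U l x)"
proof -
  let ?n = "real CARD('n)"
  have n: "?n - 1 \<noteq> 0" "?n - 2 \<noteq> 0" using dim by auto
  have Ric: "Ric i j x = (1/2 * Rs x + \<kappa> * p x) * G i j x + \<beta> x * (U i x * U j x)" for i j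
    using einstein[OF x, of i j] by (simp add: fluid_stress_def \<beta>_def algebra_simps)
  have "Rs x = (\<Sum>i\<in>UNIV. \<Sum>j\<in>UNIV. H i j x * ((1/2 * Rs x + \<kappa> * p x) * G i j x + \<beta> x * (U i x * U j x)))"
    unfolding Ric[symmetric] by (simp add: scalar_curvature_def)
  also have "\<dots> = (1/2 * Rs x + \<kappa> * p x) * ?n + \<beta> x * (-1)"
    by (simp only: double_contraction_rules trace_metric[OF x] contract_U[OF x] unit_u[OF x])
  finally have R: "Rs x * (?n - 2) = 2 * \<kappa> * (\<mu> x - (?n - 1) * p x)"
    by (simp add: \<beta>_def algebra_simps)
  have "1/2 * Rs x + \<kappa> * p x - Rs x / (2 * (?n - 1)) = (Rs x * (?n - 2) + 2 * \<kappa> * (?n - 1) * p x) / (2 * (?n - 1))"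
    using n by (simp add: field_simps)
  also have "\<dots> = \<alpha> x" unfolding R using n by (simp add: \<alpha>_def field_simps)
  finally show ?thesis unfolding P_def Ric by (simp add: algebra_simps)
qed

lemma cov2_UU:
  assumes x: "x \<in> D"
  shows "cov2 (\<lambda>i j x. U i x * U j x) k i j x = N k i x * U j x + U i x * N k j x"
  by (simp add: cov2_def nabla_form_def pd_mult sm_U x algebra_simps sum_distrib_left)

lemma cov2_scale_add:
  assumes "sm f" "sm h" "\<And>i j. sm (S i j)" "\<And>i j. sm (T i j)" "x \<in> D"
  shows "cov2 (\<lambda>i j x. f x * S i j x + h x * T i j x) k i j x =
    pd c k f x * S i j x + f x * cov2 S k i j x + (pd c k h x * T i j x + h x * cov2 T k i j x)"
  by (simp add: cov2_def pd_add pd_mult sm_mult assms algebra_simps sum.distrib sum_distrib_left)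

text \<open>Derivative of the constant square of u, written as a trace so that
  \<open>contract_cov2\<close> applies.\<close>

lemma V_N:
  assumes x: "x \<in> D"
  shows "(\<Sum>l\<in>UNIV. V l x * N k l x) = 0"
proof -
  have UU: "sm (\<lambda>x. U i x * U j x)" for i j by (intro sm_intros sm_U)
  have "(\<Sum>i\<in>UNIV. \<Sum>j\<in>UNIV. H i j x * cov2 (\<lambda>i j x. U i x * U j x) k i j x) =
      pd c k (\<lambda>x. \<Sum>i\<in>UNIV. \<Sum>j\<in>UNIV. H i j x * (U i x * U j x)) x"
    by (rule contract_cov2[OF UU x])
  also have "\<dots> = pd c k (\<lambda>x. -1) x"
    by (rule pd_cong[OF _ x]) (simp only: contract_U unit_u)
  finally have "(\<Sum>i\<in>UNIV. \<Sum>j\<in>UNIV. H i j x * (N k i x * U j x + U i x * N k j x)) = 0"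
    by (simp add: cov2_UU[OF x] pd_const)
  then show ?thesis
    by (simp only: double_contraction_rules contract_U[OF x] contract_U'[OF x])
qed

lemma state_proportional:
  assumes x: "x \<in> D"
  obtains b where "\<And>i. pd c i \<beta> x = b * pd c i \<alpha> x"
proof -
  obtain b where b: "\<And>i. pd c i p x = b * pd c i \<mu> x" using state[OF x] by blast
  have n: "real CARD('n) - 1 \<noteq> 0" using dim by auto
  have "pd c i \<beta> x = (b + 1) * (real CARD('n) - 1) * pd c i \<alpha> x" for i
  proof -
    have "pd c i \<alpha> x = \<kappa> * pd c i \<mu> x / (real CARD('n) - 1)"
      unfolding \<alpha>_def[abs_def] by (simp add: pd_divide_const pd_cmult sm_intros sm_\<mu> x)
    moreover have "pd c i \<beta> x = \<kappa> * (pd c i p x + pd c i \<mu> x)"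
      unfolding \<beta>_def[abs_def] by (simp add: pd_add pd_cmult sm_intros sm_\<mu> sm_p x)
    ultimately show ?thesis using n by (simp add: b field_simps)
  qed
  then show thesis by (rule that)
qed

theorem torse_forming:
  assumes x: "x \<in> D"
  shows "N k l x = \<phi> x * (G k l x + U k x * U l x)" "pd c k \<alpha> x = - \<alpha>' x * U k x"
proof -
  obtain b where b: "\<And>i. pd c i \<beta> x = b * pd c i \<alpha> x"
    using state_proportional[OF x] by metis
  have covP: "cov2 P k i j x = pd c k \<alpha> x * G i j x + pd c k \<beta> x * (U i x * U j x) + \<beta> x * (N k i x * U j x + U i x * N k j x)" for k i j
  proof -
    have "cov2 P k i j x = cov2 (\<lambda>i j x. \<alpha> x * G i j x + \<beta> x * (U i x * U j x)) k i j x"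
      by (rule cov2_cong[OF _ x]) (rule P_eq)
    also have "\<dots> = pd c k \<alpha> x * G i j x + \<alpha> x * cov2 G k i j x
        + (pd c k \<beta> x * (U i x * U j x) + \<beta> x * cov2 (\<lambda>i j x. U i x * U j x) k i j x)"
      by (rule cov2_scale_add[OF sm_\<alpha> sm_\<beta> sm_G _ x]) (intro sm_intros sm_U)
    finally show ?thesis by (simp add: cov2_metric[OF x] cov2_UU[OF x])
  qed
  have cod: "cov2 P k j l x = cov2 P j k l x" for j k l
    unfolding P_def[abs_def] using dim by (intro codazzi[OF x] div_weyl[OF x]) auto
  have cod': "pd c k \<alpha> x * G j l x - pd c j \<alpha> x * G k l x + pd c k \<beta> x * (U j x * U l x) - pd c j \<beta> x * (U k x * U l x)
      + \<beta> x * (N k j x * U l x - N j k x * U l x) + \<beta> x * (U j x * N k l x - U k x * N j l x) = 0" for j k l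
    using cod[of k j l] unfolding covP by (simp add: algebra_simps)
  have n3: "CARD('n) \<ge> 3" using dim by simp
  note alg = codazzi_perfect_fluid[where G = "\<lambda>i j. G i j x" and H = "\<lambda>i j. H i j x" and N = "\<lambda>i j. N i j x" and
      U = "\<lambda>i. U i x" and V = "\<lambda>i. V i x" and A = "\<lambda>i. pd c i \<alpha> x" and B = "\<lambda>i. pd c i \<beta> x" and \<beta> = "\<beta> x",
      OF \<beta>_nonzero[OF x] n3 H_sym[OF x] HG[OF x] V_eq[OF x] U_eq G_sym[OF x] unit_u[OF x] V_N[OF x] b cod']
  show "N k l x = \<phi> x * (G k l x + U k x * U l x)"
    using alg(1)[of k l] by (simp add: \<phi>_def \<alpha>'_def)
  show "pd c k \<alpha> x = - \<alpha>' x * U k x"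
    using alg(2)[of k] by (simp add: \<alpha>'_def)
qed

lemma pd_\<beta>_parallel: "x \<in> D \<Longrightarrow> \<exists>b. \<forall>k. pd c k \<beta> x = b * U k x"
proof -
  assume x: "x \<in> D"
  obtain b where "\<And>i. pd c i \<beta> x = b * pd c i \<alpha> x" using state_proportional[OF x] by metis
  then show ?thesis using torse_forming(2)[OF x] by (intro exI[of _ "b * - \<alpha>' x"]) simp
qed

lemma N_sym: "x \<in> D \<Longrightarrow> N k l x = N l k x"
  by (simp add: torse_forming G_sym[of x k l])

lemma U_closed:
  assumes x: "x \<in> D"
  shows "pd c k (U l) x = pd c l (U k) x"
  using N_sym[OF x, of k l] by (simp add: nabla_form_def \<Gamma>_sym[OF x, of _ k l])

text \<open>Since the torse-forming expression is symmetric, the normalization identity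
  \<open>V_N\<close> can be read in the other index.\<close>

lemma geodesic:
  assumes x: "x \<in> D"
  shows "(\<Sum>k\<in>UNIV. V k x * N k j x) = 0"
  unfolding N_sym[OF x, of _ j] by (rule V_N[OF x])

text \<open>From d\<alpha> = - \<alpha>' u with u closed, commuting second derivatives give
  d\<alpha>' \<and> u = 0, and contracting with u makes d\<alpha>' a multiple of u. The equation of
  state does the same for d\<beta>. Differentiating \<beta> \<phi> = - \<alpha>' then transfers the
  property to \<phi>.\<close>

lemma pd_\<phi>_parallel:
  assumes x: "x \<in> D"
  obtains \<psi> where "\<And>k. pd c k \<phi> x = \<psi> * U k x"
proof -
  have "pd c j (pd c k \<alpha>) x = - pd c j \<alpha>' x * U k x - \<alpha>' x * pd c j (U k) x" for j k
  proof -
    have "pd c j (pd c k \<alpha>) x = pd c j (\<lambda>x. - \<alpha>' x * U k x) x"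
      by (rule pd_cong[OF _ x]) (rule torse_forming(2))
    then show ?thesis by (simp add: pd_mult pd_minus sm_intros sm_\<alpha>' sm_U x)
  qed
  then have sym: "pd c j \<alpha>' x * U k x = pd c k \<alpha>' x * U j x" for j k
    using pd_commute[OF sm_\<alpha> x, of j k] U_closed[OF x, of j k] by simp
  define a where "a = - (\<Sum>k\<in>UNIV. V k x * pd c k \<alpha>' x)"
  have a: "pd c j \<alpha>' x = a * U j x" for j
  proof -
    have "(\<Sum>k\<in>UNIV. V k x * (pd c j \<alpha>' x * U k x)) = (\<Sum>k\<in>UNIV. V k x * (pd c k \<alpha>' x * U j x))"
      unfolding sym by simp
    then have "pd c j \<alpha>' x * (-1) = (- a) * U j x"
      by (simp only: contraction_rules unit_u[OF x] a_def minus_minus)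
    then show ?thesis by simp
  qed
  obtain b where b: "\<And>k. pd c k \<beta> x = b * U k x" using pd_\<beta>_parallel[OF x] by blast
  have "pd c k \<beta> x * \<phi> x + \<beta> x * pd c k \<phi> x = - pd c k \<alpha>' x" for k
  proof -
    have "pd c k (\<lambda>x. \<beta> x * \<phi> x) x = pd c k (\<lambda>x. - \<alpha>' x) x"
      by (rule pd_cong[OF _ x]) (simp add: \<phi>_def \<beta>_nonzero)
    then show ?thesis by (simp add: pd_mult pd_minus sm_\<beta> sm_\<phi> sm_\<alpha>' x)
  qed
  then have "pd c k \<phi> x = (- a - b * \<phi> x) / \<beta> x * U k x" for k
    unfolding a b using \<beta>_nonzero[OF x] by (simp add: field_simps)
  then show thesis by (rule that)
qed

text \<open>Second partial derivatives of u cancel, and the derivatives and products of Christoffel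
  symbols that multiply u are by definition the curvature.\<close>

lemma ricci_identity:
  assumes x: "x \<in> D"
  shows "cov2 N l m k x - cov2 N m l k x = - (\<Sum>e\<in>UNIV. Rm e k l m x * U e x)"
proof -
  have pdN: "pd c l (N m k) x = pd c l (pd c m (U k)) x - (\<Sum>s\<in>UNIV. pd c l (\<Gamma> s m k) x * U s x) - (\<Sum>s\<in>UNIV. \<Gamma> s m k x * pd c l (U s) x)" for l m
    unfolding nabla_form_def[abs_def]
    by (simp add: pd_diff pd_sum pd_mult sm_intros sm_U x sum.distrib)
  have N: "(\<Sum>s\<in>UNIV. \<Gamma> s l k x * N m s x) = (\<Sum>s\<in>UNIV. \<Gamma> s l k x * pd c m (U s) x) - (\<Sum>e\<in>UNIV. (\<Sum>s\<in>UNIV. \<Gamma> e m s x * \<Gamma> s l k x) * U e x)" for l m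
  proof -
    have "(\<Sum>s\<in>UNIV. \<Gamma> s l k x * (\<Sum>e\<in>UNIV. \<Gamma> e m s x * U e x)) = (\<Sum>e\<in>UNIV. (\<Sum>s\<in>UNIV. \<Gamma> e m s x * \<Gamma> s l k x) * U e x)"
      unfolding sum_distrib_left sum_distrib_right by (subst sum.swap) (intro sum.cong refl, simp add: ac_simps)
    then show ?thesis by (simp add: nabla_form_def right_diff_distrib sum_subtractf)
  qed
  show ?thesis
    unfolding cov2_def pdN N Rm_def
    using pd_commute[OF sm_U x, of l m k]
    by (simp add: \<Gamma>_sym[OF x, of _ l m] algebra_simps sum.distrib sum_subtractf)
qed

lemma cov2_N:
  assumes x: "x \<in> D"
  shows "cov2 N l m k x = pd c l \<phi> x * (G m k x + U m x * U k x) + \<phi> x * (N l m x * U k x + U m x * N l k x)"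
proof -
  have "cov2 N l m k x = cov2 (\<lambda>m k x. \<phi> x * G m k x + \<phi> x * (U m x * U k x)) l m k x"
    by (rule cov2_cong[OF _ x]) (simp add: torse_forming algebra_simps)
  also have "\<dots> = pd c l \<phi> x * G m k x + \<phi> x * cov2 G l m k x
      + (pd c l \<phi> x * (U m x * U k x) + \<phi> x * cov2 (\<lambda>m k x. U m x * U k x) l m k x)"
    by (rule cov2_scale_add[OF sm_\<phi> sm_\<phi> sm_G _ x]) (intro sm_intros sm_U)
  finally show ?thesis by (simp add: cov2_metric[OF x] cov2_UU[OF x] algebra_simps)
qed

text \<open>By the Ricci identity the Riemann tensor contracted with u is \<xi> times the
  alternating expression in u and g, and so are the \<open>P\<close> terms with their own
  coefficient. The trace of the first relation evaluates the Ricci tensor on u in terms of \<xi>;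
  comparison with Einstein's equations shows that the coefficients are opposite.\<close>

theorem weyl_annihilates:
  assumes x: "x \<in> D"
  shows "(\<Sum>m\<in>UNIV. weyl_up g c j k l m x * U m x) = 0"
proof -
  let ?n = "real CARD('n)"
  have n: "?n - 1 \<noteq> 0" "?n - 2 \<noteq> 0" "?n > 2" using dim by auto
  obtain \<psi> where \<psi>: "\<And>k. pd c k \<phi> x = \<psi> * U k x" using pd_\<phi>_parallel[OF x] by metis
  define \<xi> where "\<xi> = \<psi> - \<phi> x * \<phi> x"
  have RmU: "(\<Sum>e\<in>UNIV. Rm e k l m x * U e x) = \<xi> * (U m x * G l k x) - \<xi> * (U l x * G m k x)" for k l m
    using ricci_identity[OF x, of l m k] unfolding cov2_N[OF x] \<psi> torse_forming[OF x] \<xi>_def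
    by (simp add: algebra_simps G_sym[OF x, of m l])
  have PV: "(\<Sum>m\<in>UNIV. (\<Sum>e\<in>UNIV. P k e x * H e m x) * U m x) = (\<alpha> x - \<beta> x) * U k x" for k
  proof -
    have "(\<Sum>m\<in>UNIV. (\<Sum>e\<in>UNIV. P k e x * H e m x) * U m x) = (\<Sum>e\<in>UNIV. V e x * P k e x)"
      unfolding V_eq[OF x] sum_distrib_right by (subst sum.swap) (intro sum.cong refl, simp add: ac_simps)
    also have "\<dots> = \<alpha> x * (\<Sum>e\<in>UNIV. V e x * G k e x) + \<beta> x * (U k x * (\<Sum>e\<in>UNIV. V e x * U e x))"
      unfolding P_eq[OF x] by (simp only: contraction_rules)
    also have "(\<Sum>e\<in>UNIV. V e x * G k e x) = U k x" by (simp add: U_eq mult.commute)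
    finally show ?thesis by (simp add: unit_u[OF x] algebra_simps)
  qed
  define t where "t = Rs x / (2 * (?n - 1))"
  have t: "t * (?n - 2) = \<alpha> x * ?n - \<beta> x"
  proof -
    have "(\<Sum>i\<in>UNIV. \<Sum>j\<in>UNIV. H i j x * P i j x) = Rs x - t * ?n"
      unfolding P_def t_def by (simp only: double_contraction_rules trace_metric[OF x] scalar_curvature_def)
    moreover have "(\<Sum>i\<in>UNIV. \<Sum>j\<in>UNIV. H i j x * P i j x) = \<alpha> x * ?n + \<beta> x * (-1)"
      unfolding P_eq[OF x] by (simp only: double_contraction_rules trace_metric[OF x] contract_U[OF x] unit_u[OF x])
    moreover have "t * (?n - 2) = Rs x - t * ?n" using n by (simp add: t_def field_simps)
    ultimately show ?thesis by simp
  qed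
  \<comment> \<open>Both sides express minus the Ricci tensor applied to u: once by tracing
    \<open>RmU\<close>, once from the known form of \<open>P\<close>.\<close>
  have trace: "\<xi> * (?n - 1) * U k x = - (t + \<alpha> x - \<beta> x) * U k x" for k
  proof -
    have swap: "(\<Sum>m\<in>UNIV. (\<Sum>j\<in>UNIV. \<Sum>l\<in>UNIV. H j l x * Rm m l j k x) * U m x) =
        (\<Sum>j\<in>UNIV. \<Sum>l\<in>UNIV. H j l x * (\<Sum>m\<in>UNIV. Rm m l j k x * U m x))"
    proof -
      have "(\<Sum>m\<in>UNIV. (\<Sum>j\<in>UNIV. \<Sum>l\<in>UNIV. H j l x * Rm m l j k x) * U m x) =
          (\<Sum>m\<in>UNIV. \<Sum>j\<in>UNIV. \<Sum>l\<in>UNIV. H j l x * (Rm m l j k x * U m x))"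
        unfolding sum_distrib_right by (intro sum.cong refl) (simp add: ac_simps)
      also have "\<dots> = (\<Sum>j\<in>UNIV. \<Sum>m\<in>UNIV. \<Sum>l\<in>UNIV. H j l x * (Rm m l j k x * U m x))"
        by (rule sum.swap)
      also have "\<dots> = (\<Sum>j\<in>UNIV. \<Sum>l\<in>UNIV. \<Sum>m\<in>UNIV. H j l x * (Rm m l j k x * U m x))"
        by (intro sum.cong refl sum.swap)
      finally show ?thesis by (simp add: sum_distrib_left)
    qed
    have HGU: "(\<Sum>j\<in>UNIV. \<Sum>l\<in>UNIV. H j l x * (U j x * G k l x)) = U k x"
      unfolding contract_U'[OF x] by (simp add: U_eq mult.commute)
    have "(\<Sum>m\<in>UNIV. (\<Sum>j\<in>UNIV. \<Sum>l\<in>UNIV. H j l x * Rm m l j k x) * U m x) =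
        (\<Sum>j\<in>UNIV. \<Sum>l\<in>UNIV. H j l x * (\<xi> * (U k x * G j l x) - \<xi> * (U j x * G k l x)))"
      unfolding swap RmU by (rule refl)
    also have "\<dots> = \<xi> * (U k x * ?n) - \<xi> * U k x"
      by (simp only: double_contraction_rules trace_metric[OF x] HGU)
    also have "(\<Sum>m\<in>UNIV. (\<Sum>j\<in>UNIV. \<Sum>l\<in>UNIV. H j l x * Rm m l j k x) * U m x) = - (\<Sum>e\<in>UNIV. V e x * Ric k e x)"
    proof -
      have "(\<Sum>m\<in>UNIV. (\<Sum>e\<in>UNIV. Ric k e x * H e m x) * U m x) = (\<Sum>e\<in>UNIV. V e x * Ric k e x)"
        unfolding V_eq[OF x] sum_distrib_right by (subst sum.swap) (intro sum.cong refl, simp add: ac_simps)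
      then show ?thesis by (simp add: contract_Rm[OF x] sum_negf)
    qed
    also have "(\<Sum>e\<in>UNIV. V e x * Ric k e x) = (\<Sum>e\<in>UNIV. V e x * (t * G k e x + (\<alpha> x * G k e x + \<beta> x * (U k x * U e x))))"
    proof (intro sum.cong refl arg_cong2[where f = "(*)"])
      fix e show "Ric k e x = t * G k e x + (\<alpha> x * G k e x + \<beta> x * (U k x * U e x))"
        using P_eq[OF x, of k e] unfolding P_def t_def by simp
    qed
    also have "\<dots> = t * (\<Sum>e\<in>UNIV. V e x * G k e x) + (\<alpha> x * (\<Sum>e\<in>UNIV. V e x * G k e x) + \<beta> x * (U k x * (-1)))"
      by (simp only: contraction_rules unit_u[OF x])
    also have "(\<Sum>e\<in>UNIV. V e x * G k e x) = U k x" by (simp add: U_eq mult.commute)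
    finally show ?thesis by (simp add: algebra_simps)
  qed
  have "\<exists>k. U k x \<noteq> 0"
  proof (rule ccontr)
    assume "\<nexists>k. U k x \<noteq> 0"
    then show False using unit_u[OF x] by simp
  qed
  then have "\<xi> * (?n - 1) = - (t + \<alpha> x - \<beta> x)"
    using trace by (metis mult_cancel_right)
  \<comment> \<open>Multiplying by n - 2 allows \<open>t\<close> to be replaced; the outcome is
    divisible by n - 1 and leaves \<xi> free of the scalar curvature.\<close>
  then have "(?n - 2) * (\<xi> * (?n - 1)) = (?n - 2) * - (t + \<alpha> x - \<beta> x)" by (rule arg_cong)
  then have "(?n - 1) * (\<xi> * (?n - 2) + (2 * \<alpha> x - \<beta> x)) = 0"
    using t by (simp add: algebra_simps)
  then have "\<xi> * (?n - 2) + (2 * \<alpha> x - \<beta> x) = 0" using n(1) unfolding mult_eq_0_iff by blast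
  then have "\<xi> * (?n - 2) = - (2 * \<alpha> x - \<beta> x)" by linarith
  from eq_divide_imp[OF n(2) this]
  have \<xi>: "\<xi> = - (1 / (?n - 2)) * (2 * \<alpha> x - \<beta> x)"
    by (simp only: minus_divide_left[symmetric] mult_minus_left times_divide_eq_left mult_1_left)
  have W: "weyl_up g c j k l m x = (-1) * Rm m l j k x - (1 / (?n - 2)) *
    (G j l x * (\<Sum>e\<in>UNIV. P k e x * H e m x) - P k l x * \<delta> j m - (G k l x * (\<Sum>e\<in>UNIV. P j e x * H e m x) - P j l x * \<delta> k m))" for m
    using weyl_up_decomposition[OF x n(3), of j k l m] unfolding P_def[symmetric] by (simp add: mult.commute)
  have \<delta>U: "(\<Sum>m\<in>UNIV. U m x * \<delta> a m) = U a x" for a by (simp only: sum_delta_mult)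
  have "(\<Sum>m\<in>UNIV. weyl_up g c j k l m x * U m x) = (\<Sum>m\<in>UNIV. U m x * ((-1) * Rm m l j k x - (1 / (?n - 2)) *
    (G j l x * (\<Sum>e\<in>UNIV. P k e x * H e m x) - P k l x * \<delta> j m - (G k l x * (\<Sum>e\<in>UNIV. P j e x * H e m x) - P j l x * \<delta> k m))))"
    unfolding W by (simp only: mult.commute)
  also have "\<dots> = (-1) * (\<Sum>m\<in>UNIV. U m x * Rm m l j k x) - (1 / (?n - 2)) *
    (G j l x * (\<Sum>m\<in>UNIV. U m x * (\<Sum>e\<in>UNIV. P k e x * H e m x)) - P k l x * U j x - (G k l x * (\<Sum>m\<in>UNIV. U m x * (\<Sum>e\<in>UNIV. P j e x * H e m x)) - P j l x * U k x))"
    by (simp only: contraction_rules \<delta>U)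
  also have "\<dots> = (-1) * (\<xi> * (U k x * G j l x) - \<xi> * (U j x * G k l x)) - (1 / (?n - 2)) *
    (G j l x * ((\<alpha> x - \<beta> x) * U k x) - P k l x * U j x - (G k l x * ((\<alpha> x - \<beta> x) * U j x) - P j l x * U k x))"
    using RmU[of l j k] PV[of k] PV[of j] by (simp only: mult.commute[of "U _ x" "Rm _ _ _ _ x"] mult.commute[of "U _ x" "\<Sum>e\<in>UNIV. P _ e x * H e _ x"])
  also have "\<dots> = - (\<xi> + (1 / (?n - 2)) * (2 * \<alpha> x - \<beta> x)) * (U k x * G j l x - U j x * G k l x)"
    unfolding P_eq[OF x] by (simp add: algebra_simps)
  finally show ?thesis by (simp add: \<xi>)
qed

end

section \<open>Construction of the warped product chart\<close>

lemma is_chart_open_image: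
  assumes c: "is_chart X c" and S: "openin X S" "S \<subseteq> chart_dom c"
  shows "open (chart_map c ` S)"
proof -
  have "openin (subtopology X (chart_dom c)) S"
    using S by (auto simp: openin_subtopology)
  moreover have "open_map (subtopology X (chart_dom c)) (top_of_set (chart_img c)) (chart_map c)"
    using c homeomorphic_imp_open_map unfolding is_chart_def by blast
  ultimately have "openin (top_of_set (chart_img c)) (chart_map c ` S)"
    unfolding open_map_def by blast
  then show ?thesis
    using c openin_open_trans unfolding is_chart_def by blast
qed

text \<open>A transition map out of the new chart is an old one after \<Phi>, and a transition map
  into it is \<Psi> after an old one. Membership in the maximal atlas only asks for compatibility
  with the charts of \<open>A\<close>.\<close>

lemma chart_reparametrization:
  fixes X :: "'a topology" and A :: "('a, 'n::finite) chart set"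
  assumes c: "c \<in> charts X A" and A: "\<And>a. a \<in> A \<Longrightarrow> is_chart X a"
    and E: "open E" "E \<subseteq> chart_img c" and Q: "open Q" and hom: "homeomorphism Q E \<Phi> \<Psi>"
    and smooth: "smooth_on \<Phi> Q" "smooth_on \<Psi> E"
  defines "e \<equiv> ({x \<in> chart_dom c. chart_map c x \<in> E}, \<lambda>x. \<Psi> (chart_map c x))"
  shows "e \<in> charts X A" "chart_img e = Q" "\<And>w. w \<in> Q \<Longrightarrow> chart_inv e w = chart_inv c (\<Phi> w)"
proof -
  have cc: "is_chart X c" using c by (simp add: charts_def)
  interpret C: chart_calculus X c by unfold_locales (rule cc)
  have h: "\<And>w. w \<in> Q \<Longrightarrow> \<Psi> (\<Phi> w) = w" "\<And>y. y \<in> E \<Longrightarrow> \<Phi> (\<Psi> y) = y" "\<Phi> ` Q = E" "\<Psi> ` E = Q"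
    using hom by (auto simp: homeomorphism_def)
  have dom: "chart_dom e = {x \<in> chart_dom c. chart_map c x \<in> E}" and map: "chart_map e = (\<lambda>x. \<Psi> (chart_map c x))"
    by (simp_all add: e_def)
  have imc: "chart_map c ` chart_dom e = E"
  proof
    show "E \<subseteq> chart_map c ` chart_dom e"
    proof
      fix z assume "z \<in> E"
      then have "chart_inv c z \<in> chart_dom e" "chart_map c (chart_inv c z) = z"
        using E(2) C.chart_inv_in C.chart_map_inv by (auto simp: dom)
      then show "z \<in> chart_map c ` chart_dom e" by (metis imageI)
    qed
  qed (auto simp: dom)
  show img: "chart_img e = Q"
  proof -
    have "chart_img e = \<Psi> ` (chart_map c ` chart_dom e)"
      unfolding chart_img_def map image_image ..
    then show ?thesis by (simp add: imc h(4))
  qed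
  have domX: "chart_dom c \<subseteq> topspace X"
    using cc openin_subset unfolding is_chart_def by blast
  have homc: "homeomorphic_map (subtopology X (chart_dom c)) (top_of_set (chart_img c)) (chart_map c)"
    using cc by (simp add: is_chart_def)
  have op: "openin X (chart_dom e)"
  proof -
    have "openin (top_of_set (chart_img c)) E" using E by (simp add: openin_open_eq C.open_img)
    with homeomorphic_imp_continuous_map[OF homc]
    have "openin (subtopology X (chart_dom c)) {x \<in> topspace (subtopology X (chart_dom c)). chart_map c x \<in> E}"
      by (rule openin_continuous_map_preimage)
    moreover have "{x \<in> topspace (subtopology X (chart_dom c)). chart_map c x \<in> E} = chart_dom e"
      using domX by (auto simp: dom)
    ultimately show ?thesis
      using cc openin_trans_full unfolding is_chart_def by metis
  qed
  have e: "is_chart X e"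
  proof -
    have "homeomorphic_map (subtopology (subtopology X (chart_dom c)) (chart_dom e)) (subtopology (top_of_set (chart_img c)) E) (chart_map c)"
    proof (rule homeomorphic_map_subtopologies[OF homc])
      have "topspace (subtopology X (chart_dom c)) \<inter> chart_dom e = chart_dom e" using domX by (auto simp: dom)
      moreover have "topspace (top_of_set (chart_img c)) \<inter> E = E" using E(2) by auto
      ultimately show "chart_map c ` (topspace (subtopology X (chart_dom c)) \<inter> chart_dom e) =
          topspace (top_of_set (chart_img c)) \<inter> E" by (simp only: imc)
    qed
    moreover have "subtopology (subtopology X (chart_dom c)) (chart_dom e) = subtopology X (chart_dom e)"
      by (simp add: subtopology_subtopology dom Int_absorb1 Collect_restrict)
    moreover have "subtopology (top_of_set (chart_img c)) E = top_of_set E"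
      using E(2) by (simp add: subtopology_subtopology Int_absorb1)
    ultimately have 1: "homeomorphic_map (subtopology X (chart_dom e)) (top_of_set E) (chart_map c)" by simp
    have 2: "homeomorphic_map (top_of_set E) (top_of_set Q) \<Psi>"
      unfolding homeomorphic_map_maps
    proof
      have "continuous_on E \<Psi>" "continuous_on Q \<Phi>" using hom by (auto simp: homeomorphism_def)
      moreover have "\<Psi> ` E \<subseteq> Q" "\<Phi> ` Q \<subseteq> E" using h(3,4) by simp_all
      ultimately show "homeomorphic_maps (top_of_set E) (top_of_set Q) \<Psi> \<Phi>"
        using h(1,2) by (simp add: homeomorphic_maps_def image_subset_iff_funcset)
    qed
    have "homeomorphic_map (subtopology X (chart_dom e)) (top_of_set Q) (chart_map e)"
      using homeomorphic_map_compose[OF 1 2] by (simp add: map o_def)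
    then show ?thesis using op Q by (simp add: is_chart_def img)
  qed
  interpret E: chart_calculus X e by unfold_locales (rule e)
  show inv: "chart_inv e w = chart_inv c (\<Phi> w)" if w: "w \<in> Q" for w
  proof -
    have z: "\<Phi> w \<in> E" using h(3) w by blast
    then have x: "chart_inv c (\<Phi> w) \<in> chart_dom e" "chart_map c (chart_inv c (\<Phi> w)) = \<Phi> w"
      using E(2) C.chart_inv_in C.chart_map_inv by (auto simp: dom)
    then have "chart_map e (chart_inv c (\<Phi> w)) = w" by (simp add: map h(1)[OF w])
    then show ?thesis using E.chart_inv_map[OF x(1)] by simp
  qed
  have "compatible e a" if a: "a \<in> A" for a
    unfolding compatible_def
  proof
    have ca: "compatible c a" using c a by (simp add: charts_def)
    have ac: "is_chart X a" by (rule A[OF a])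
    interpret A: chart_calculus X a by unfold_locales (rule ac)
    let ?S = "chart_dom e \<inter> chart_dom a"
    have S: "openin X ?S" using op ac by (auto simp: is_chart_def)
    have S': "openin X (chart_dom c \<inter> chart_dom a)" using cc ac by (auto simp: is_chart_def)
    have o1: "open (chart_map e ` ?S)" "open (chart_map a ` ?S)"
      "open (chart_map c ` (chart_dom c \<inter> chart_dom a))"
      using is_chart_open_image[OF e S] is_chart_open_image[OF ac S] is_chart_open_image[OF cc S'] by auto
    have sub: "chart_map e ` ?S \<subseteq> Q" using img by (auto simp: chart_img_def)
    have "smooth_on (\<lambda>w. (chart_map a \<circ> chart_inv c) (\<Phi> w)) (chart_map e ` ?S)"
    proof (rule smooth_on_compose[OF o1(1,3) _ smooth_on_subset[OF smooth(1) sub]])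
      show "\<Phi> ` chart_map e ` ?S \<subseteq> chart_map c ` (chart_dom c \<inter> chart_dom a)"
        using h(2) by (auto simp: dom map)
      show "smooth_on (chart_map a \<circ> chart_inv c) (chart_map c ` (chart_dom c \<inter> chart_dom a))"
        using ca by (simp add: compatible_def)
    qed
    then show "smooth_on (chart_map a \<circ> chart_inv e) (chart_map e ` ?S)"
      by (rule smooth_on_cong[OF o1(1), rotated]) (use inv sub in auto)
    have "smooth_on (\<lambda>w. \<Psi> ((chart_map c \<circ> chart_inv a) w)) (chart_map a ` ?S)"
    proof (rule smooth_on_compose[OF o1(2) E(1) _ _ smooth(2)])
      show "(chart_map c \<circ> chart_inv a) ` chart_map a ` ?S \<subseteq> E"
        using A.chart_inv_map by (auto simp: dom)
      have "smooth_on (chart_map c \<circ> chart_inv a) (chart_map a ` (chart_dom c \<inter> chart_dom a))"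
        using ca by (simp add: compatible_def)
      then show "smooth_on (chart_map c \<circ> chart_inv a) (chart_map a ` ?S)"
        by (rule smooth_on_subset) (auto simp: dom)
    qed
    then show "smooth_on (chart_map e \<circ> chart_inv a) (chart_map a ` ?S)"
      by (simp add: map o_def)
  qed
  then show "e \<in> charts X A" using e by (simp add: charts_def)
qed

lemma jacobian_mult:
  assumes W: "open W" "chart_map c x \<in> W" and eq: "\<And>w. w \<in> W \<Longrightarrow> chart_map d (chart_inv c w) = F w"
    and F: "(F has_derivative F') (at (chart_map c x))"
  shows "jacobian c d x *v v = F' v"
proof -
  have "pd c i (\<lambda>z. chart_map d z $ a) x = F' (axis i 1) $ a" for i a
  proof -
    have "((\<lambda>w. F w $ a) has_derivative (\<lambda>v. F' v $ a)) (at (chart_map c x))"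
      using F by (rule bounded_linear.has_derivative[OF bounded_linear_vec_nth])
    then have "((\<lambda>w. chart_map d (chart_inv c w) $ a) has_derivative (\<lambda>v. F' v $ a)) (at (chart_map c x))"
      by (rule has_derivative_transform_within_open[OF _ W]) (simp add: eq)
    from frechet_derivative_at[OF this] show ?thesis
      unfolding pd_def o_def by metis
  qed
  then have "jacobian c d x = matrix F'"
    by (simp add: jacobian_def matrix_def vec_eq_iff)
  then show ?thesis
    using fun_cong[OF matrix_vector_mul(2)[OF has_derivative_linear[OF F]]] by simp
qed

section \<open>Lorentzian linear algebra\<close>

lemma dot_transpose: "(x :: real ^ 'n) \<bullet> (transpose P *v y) = (P *v x) \<bullet> y"
  using dot_lmul_matrix[of y P x] by (simp add: transpose_matrix_vector inner_commute)

text \<open>A diagonal matrix of signs is its own inverse, so the determinant of the congruent form,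
  and with it that of G, is nonzero.\<close>

lemma lorentzian_signature_invertible:
  fixes G :: "real ^ 'n ^ 'n"
  assumes "lorentzian_signature G"
  shows "invertible G"
proof -
  obtain P :: "real ^ 'n ^ 'n" and t :: 'n where P: "transpose P ** G ** P = (\<chi> i j. if i \<noteq> j then 0 else if i = t then -1 else 1)" (is "_ = ?D")
    using assms unfolding lorentzian_signature_def by blast
  have "?D ** ?D = mat 1"
  proof -
    have "(\<Sum>k\<in>UNIV. ?D $ i $ k * ?D $ k $ j) = (if i = j then 1 else 0)" for i j
    proof -
      have "(\<Sum>k\<in>UNIV. ?D $ i $ k * ?D $ k $ j) = (\<Sum>k\<in>UNIV. if k = i then (if i = j then 1 else 0) else 0)"
        by (intro sum.cong refl) auto
      then show ?thesis by simp
    qed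
    then show ?thesis by (simp add: vec_eq_iff matrix_matrix_mult_def mat_def)
  qed
  from arg_cong[OF this, of det] have "det ?D * det ?D = 1" by (simp only: det_mul det_I)
  then have "det (transpose P ** G ** P) \<noteq> 0" unfolding P by auto
  then have "det G \<noteq> 0" by (simp add: det_mul)
  then show ?thesis by (simp add: invertible_det_nz)
qed

text \<open>The reverse Cauchy-Schwarz inequality: the orthogonal complement of a timelike vector is
  spacelike.\<close>

lemma lorentzian_signature_spacelike:
  fixes G :: "real ^ 'n ^ 'n"
  assumes sig: "lorentzian_signature G" and a: "a \<bullet> (G *v a) = -1"
    and orth: "a \<bullet> (G *v v) = 0" and v: "v \<noteq> 0"
  shows "v \<bullet> (G *v v) > 0"
proof -
  obtain P :: "real ^ 'n ^ 'n" and t :: 'n where P: "invertible P"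
    "transpose P ** G ** P = (\<chi> i j. if i \<noteq> j then 0 else if i = t then -1 else 1)" (is "_ = ?D")
    using sig unfolding lorentzian_signature_def by blast
  let ?a = "matrix_inv P *v a" and ?b = "matrix_inv P *v v"
  have Pab: "P *v ?a = a" "P *v ?b = v"
    by (simp_all add: matrix_vector_mul_assoc matrix_inv_inverse[OF P(1)])
  let ?S = "\<lambda>x y :: real ^ 'n. \<Sum>i\<in>UNIV - {t}. x $ i * y $ i"
  have form: "(P *v x) \<bullet> (G *v (P *v y)) = ?S x y - x $ t * y $ t" for x y
  proof -
    have "(P *v x) \<bullet> (G *v (P *v y)) = x \<bullet> ((transpose P ** G ** P) *v y)"
      unfolding matrix_vector_mul_assoc[symmetric] dot_transpose ..
    also have "\<dots> = (\<Sum>i\<in>UNIV. x $ i * (if i = t then - y $ i else y $ i))"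
    proof -
      have "(?D *v y) $ i = (if i = t then - y $ i else y $ i)" for i
      proof -
        have "(?D *v y) $ i = (\<Sum>j\<in>UNIV. ?D $ i $ j * y $ j)"
          by (simp only: matrix_vector_mult_def vec_lambda_beta)
        also have "\<dots> = (\<Sum>j\<in>UNIV. if j = i then (if i = t then - y $ i else y $ i) else 0)"
          by (intro sum.cong refl) auto
        finally show ?thesis by (simp only: sum.delta finite UNIV_I if_True)
      qed
      then show ?thesis unfolding P(2) by (simp add: inner_vec_def)
    qed
    also have "\<dots> = x $ t * (- y $ t) + (\<Sum>i\<in>UNIV - {t}. x $ i * (if i = t then - y $ i else y $ i))"
      by (subst sum.remove[of _ t]) auto
    also have "(\<Sum>i\<in>UNIV - {t}. x $ i * (if i = t then - y $ i else y $ i)) = ?S x y"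
      by (intro sum.cong) auto
    finally show ?thesis by simp
  qed
  have 1: "?S ?a ?a - ?a $ t * ?a $ t = -1" "?S ?a ?b = ?a $ t * ?b $ t"
    using form[of ?a ?a] form[of ?a ?b] a orth by (simp_all only: Pab)
  have vv: "v \<bullet> (G *v v) = ?S ?b ?b - ?b $ t * ?b $ t"
    using form[of ?b ?b] by (simp only: Pab)
  \<comment> \<open>Squared spatial lengths of the two vectors in the orthonormal frame, and the
    squared time component of the second. Orthogonality equates the spatial product with the product
    of time components, so Cauchy-Schwarz becomes (1 + \<alpha>) s \<le> \<alpha> \<beta>; a
    nonpositive square would mean \<beta> \<le> s, hence s = \<beta> = 0.\<close>
  define \<alpha> \<beta> s where "\<alpha> = ?S ?a ?a" and "\<beta> = ?S ?b ?b" and "s = (?b $ t)\<^sup>2"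
  have nn: "\<alpha> \<ge> 0" "\<beta> \<ge> 0" "s \<ge> 0" by (simp_all add: \<alpha>_def \<beta>_def s_def sum_nonneg)
  have "(?S ?a ?b)\<^sup>2 \<le> \<alpha> * \<beta>"
    using Cauchy_Schwarz_ineq_sum[of "\<lambda>i. ?a $ i" "\<lambda>i. ?b $ i" "UNIV - {t}"]
    by (simp add: \<alpha>_def \<beta>_def power2_eq_square)
  then have "(?a $ t)\<^sup>2 * s \<le> \<alpha> * \<beta>" unfolding 1(2) by (simp add: s_def power_mult_distrib)
  moreover have "(?a $ t)\<^sup>2 = 1 + \<alpha>" using 1(1) by (simp add: \<alpha>_def power2_eq_square)
  ultimately have le: "(1 + \<alpha>) * s \<le> \<alpha> * \<beta>" by simp
  show ?thesis
  proof (rule ccontr)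
    assume "\<not> v \<bullet> (G *v v) > 0"
    then have "\<beta> \<le> s" by (simp add: vv \<beta>_def s_def power2_eq_square)
    then have "\<alpha> * \<beta> \<le> \<alpha> * s" using nn by (simp add: mult_left_mono)
    then have "s = 0" using le nn by (simp add: algebra_simps)
    then have "\<beta> = 0" "?b $ t = 0" using \<open>\<beta> \<le> s\<close> nn by (simp_all add: s_def)
    then have "?b $ i = 0" for i
      unfolding \<beta>_def by (cases "i = t") (auto simp: sum_nonneg_eq_0_iff)
    then have "?b = 0" by (simp add: vec_eq_iff)
    then show False using Pab(2) v by simp
  qed
qed

section \<open>Integration along coordinate lines\<close>

lemma constant_along_segment:
  fixes f :: "'e::real_normed_vector \<Rightarrow> real"
  assumes "convex Q" "w \<in> Q" "w' \<in> Q" and f: "\<And>z. z \<in> Q \<Longrightarrow> (f has_derivative F z) (at z)"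
    and zero: "\<And>z. z \<in> Q \<Longrightarrow> F z (w' - w) = 0"
  shows "f w' = f w"
proof -
  let ?h = "\<lambda>s. f (w + s *\<^sub>R (w' - w))"
  have "?h 1 = ?h 0"
  proof (rule has_derivative_zero_unique[of "{0..1}" ?h])
    fix s :: real assume "s \<in> {0..1}"
    then have "w + s *\<^sub>R (w' - w) \<in> Q"
      using convexD_alt[OF assms(1-3), of s] by (simp add: algebra_simps)
    from has_real_derivative_along_line[OF f[OF this]] zero[OF this]
    show "(?h has_derivative (\<lambda>h. 0)) (at s within {0..1})"
      by (simp add: has_field_derivative_def lambda_zero has_derivative_at_withinI)
  qed auto
  then show ?thesis by simp
qed

text \<open>As an intersection of coordinate slabs the box is seen to be open and convex slab by
  slab. It is centred at 0 in the t-direction because the time potential vanishes at z0.\<close>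

lemma centred_box_eq:
  fixes z :: "real ^ 'n"
  shows "{w. \<bar>w $ t\<bar> < d \<and> (\<forall>\<alpha>. \<alpha> \<noteq> t \<longrightarrow> \<bar>w $ \<alpha> - z $ \<alpha>\<bar> < d)} =
    (\<Inter>\<alpha>. {w. \<bar>w $ \<alpha> - (if \<alpha> = t then 0 else z $ \<alpha>)\<bar> < d})"
proof (intro set_eqI iffI)
  fix w assume w: "w \<in> {w. \<bar>w $ t\<bar> < d \<and> (\<forall>\<alpha>. \<alpha> \<noteq> t \<longrightarrow> \<bar>w $ \<alpha> - z $ \<alpha>\<bar> < d)}"
  have "\<bar>w $ \<alpha> - (if \<alpha> = t then 0 else z $ \<alpha>)\<bar> < d" for \<alpha>
    using w by (cases "\<alpha> = t") simp_all
  then show "w \<in> (\<Inter>\<alpha>. {w. \<bar>w $ \<alpha> - (if \<alpha> = t then 0 else z $ \<alpha>)\<bar> < d})" by blast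
next
  fix w assume "w \<in> (\<Inter>\<alpha>. {w. \<bar>w $ \<alpha> - (if \<alpha> = t then 0 else z $ \<alpha>)\<bar> < d})"
  then have w: "\<bar>w $ \<alpha> - (if \<alpha> = t then 0 else z $ \<alpha>)\<bar> < d" for \<alpha> by blast
  have "\<bar>w $ t\<bar> < d" using w[of t] by simp
  moreover have "\<bar>w $ \<alpha> - z $ \<alpha>\<bar> < d" if "\<alpha> \<noteq> t" for \<alpha> using w[of \<alpha>] that by simp
  ultimately show "w \<in> {w. \<bar>w $ t\<bar> < d \<and> (\<forall>\<alpha>. \<alpha> \<noteq> t \<longrightarrow> \<bar>w $ \<alpha> - z $ \<alpha>\<bar> < d)}" by simp
qed

context chart_calculus
begin

lemma directional_derivative:
  assumes "sm f" "x \<in> D"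
  shows "frechet_derivative (f \<circ> chart_inv c) (at (chart_map c x)) v = (\<Sum>i\<in>UNIV. v $ i * pd c i f x)"
proof -
  let ?F = "frechet_derivative (f \<circ> chart_inv c) (at (chart_map c x))"
  have lin: "linear ?F" using has_derivative_in_chart[OF assms] has_derivative_linear by blast
  have "v = (\<Sum>i\<in>UNIV. v $ i *\<^sub>R axis i 1)"
    using basis_expansion[of v] by (simp add: scalar_mult_eq_scaleR)
  then have "?F v = (\<Sum>i\<in>UNIV. ?F (v $ i *\<^sub>R axis i 1))"
    by (metis (no_types, lifting) linear_sum[OF lin] sum.cong)
  then show ?thesis by (simp add: linear_scale[OF lin] pd_def)
qed

lemma constant_if_pd_zero:
  assumes f: "sm f" and Q: "convex (chart_img c)" and w: "w \<in> chart_img c" "w' \<in> chart_img c"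
    and zero: "\<And>x i. x \<in> D \<Longrightarrow> w $ i \<noteq> w' $ i \<Longrightarrow> pd c i f x = 0"
  shows "f (chart_inv c w') = f (chart_inv c w)"
proof (rule constant_along_segment[OF Q w])
  fix z assume z: "z \<in> chart_img c"
  show "((\<lambda>z. f (chart_inv c z)) has_derivative frechet_derivative (f \<circ> chart_inv c) (at z)) (at z)"
    using has_derivative_in_chart[OF f chart_inv_in[OF z]] chart_map_inv[OF z] by simp
  have "(w' - w) $ i * pd c i f (chart_inv c z) = 0" for i
    using zero[OF chart_inv_in[OF z], of i] by (cases "w $ i = w' $ i") auto
  then have "(\<Sum>i\<in>UNIV. (w' - w) $ i * pd c i f (chart_inv c z)) = 0" by (intro sum.neutral) blast
  then show "frechet_derivative (f \<circ> chart_inv c) (at z) (w' - w) = 0"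
    using directional_derivative[OF f chart_inv_in[OF z], of "w' - w"] unfolding chart_map_inv[OF z] by (simp only:)
qed

end

text \<open>In coordinates in which \<open>u = \<partial>\<^sub>t\<close> and its dual 1-form is \<open>-dt\<close>, the torse-forming equation
  reads \<open>\<partial>\<^sub>t g\<^sub>\<alpha>\<^sub>\<beta> = 2 \<phi> g\<^sub>\<alpha>\<^sub>\<beta>\<close> with \<open>\<phi>\<close> a function of \<open>t\<close> alone.  All entries of the spatial
  metric then evolve by the same factor, which can be read off from any diagonal entry.\<close>

proposition (in fluid_chart) warped_chart_comoving:
  fixes t :: 'n and z0 :: "real ^ 'n" and d :: real
  assumes d: "d > 0"
    and img: "chart_img c = {w. \<bar>w $ t\<bar> < d \<and> (\<forall>\<alpha>. \<alpha> \<noteq> t \<longrightarrow> \<bar>w $ \<alpha> - z0 $ \<alpha>\<bar> < d)}"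
    and u: "\<And>x. x \<in> D \<Longrightarrow> u c x = axis t 1" and flat: "\<And>x. x \<in> D \<Longrightarrow> flat g u c x = - axis t 1"
    and sig: "\<And>x. x \<in> D \<Longrightarrow> lorentzian_signature (g c x)"
  shows "warped_chart g c"
proof -
  have V: "V i x = \<delta> t i" and Ut: "U i x = - \<delta> t i" if "x \<in> D" for i x
    using u[OF that] flat[OF that] by (auto simp: axis_def)
  have Gt: "G i t x = - \<delta> t i" if "x \<in> D" for i x
    using U_eq[of x i] Ut[OF that, of i] by (simp add: V[OF that] sum_delta_mult del: if_split)
  have Ht: "H i t x = - \<delta> t i" if "x \<in> D" for i x
  proof -
    have "(\<Sum>j\<in>UNIV. H i j x * U j x) = - (\<Sum>j\<in>UNIV. H i j x * \<delta> t j)"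
      by (simp add: Ut[OF that] sum_negf)
    then show ?thesis using V_eq[OF that, of i] V[OF that, of i] unfolding sum_delta_mult by simp
  qed
  \<comment> \<open>As the entries of u and of the mixed metric are constant in these coordinates,
    the covariant derivative of u reduces to the Christoffel symbol with upper index t, which is
    half the t-derivative of the metric.\<close>
  have pdt: "pd c t (G \<alpha> \<beta>) x = 2 * \<phi> x * G \<alpha> \<beta> x" if x: "x \<in> D" and ab: "\<alpha> \<noteq> t" "\<beta> \<noteq> t" for \<alpha> \<beta> x
  proof -
    have pd0: "pd c k (G i t) x = 0" for i k
    proof -
      have "pd c k (G i t) x = pd c k (\<lambda>x. - \<delta> t i) x" by (rule pd_cong[OF _ x]) (rule Gt)
      then show ?thesis by (simp only: pd_const)
    qed
    have "pd c \<alpha> (U \<beta>) x = pd c \<alpha> (\<lambda>x. - \<delta> t \<beta>) x" by (rule pd_cong[OF _ x]) (rule Ut)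
    then have "N \<alpha> \<beta> x = - (\<Sum>s\<in>UNIV. \<Gamma> s \<alpha> \<beta> x * (- \<delta> t s))"
      by (simp add: nabla_form_def Ut[OF x] pd_const del: if_split)
    also have "\<dots> = \<Gamma> t \<alpha> \<beta> x" by (simp add: sum_negf sum_delta_mult del: if_split)
    also have "\<dots> = (\<Sum>l\<in>UNIV. (- \<delta> t l) * (pd c \<alpha> (G \<beta> l) x + pd c \<beta> (G \<alpha> l) x - pd c l (G \<alpha> \<beta>) x)) / 2"
      unfolding christoffel_def using Ht[OF x] H_sym[OF x, of t] by simp
    also have "\<dots> = - (pd c \<alpha> (G \<beta> t) x + pd c \<beta> (G \<alpha> t) x - pd c t (G \<alpha> \<beta>) x) / 2"
      by (simp only: mult_minus_left sum_negf sum_delta_mult)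
    finally have "N \<alpha> \<beta> x = pd c t (G \<alpha> \<beta>) x / 2" by (simp add: pd0)
    moreover have "N \<alpha> \<beta> x = \<phi> x * G \<alpha> \<beta> x"
      using torse_forming(1)[OF x, of \<alpha> \<beta>] ab by (simp add: Ut[OF x])
    ultimately show ?thesis by simp
  qed
  have pd\<phi>: "pd c \<alpha> \<phi> x = 0" if x: "x \<in> D" and "\<alpha> \<noteq> t" for \<alpha> x
  proof -
    obtain \<psi> where "\<And>k. pd c k \<phi> x = \<psi> * U k x" using pd_\<phi>_parallel[OF x] by metis
    then show ?thesis using that by (simp add: Ut[OF x])
  qed
  define W where "W = {w :: real ^ 'n. \<forall>\<alpha>. \<alpha> \<noteq> t \<longrightarrow> \<bar>w $ \<alpha> - z0 $ \<alpha>\<bar> < d}"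
  define I where "I = {-d<..<d}"
  have Q: "chart_img c = {z \<in> W. z $ t \<in> I}"
    unfolding img W_def I_def by auto
  \<comment> \<open>\<open>T s w\<close> moves w along its time line to time s; \<open>base\<close>
    is the centre of the box, whose time line serves for comparison.\<close>
  define T where "T s w = (\<chi> \<alpha>. if \<alpha> = t then s else w $ \<alpha>)" for s and w :: "real ^ 'n"
  define base where "base = (\<chi> \<alpha>. if \<alpha> = t then 0 else z0 $ \<alpha>)"
  have TQ: "T s w \<in> chart_img c" if "w \<in> W" "s \<in> I" for s w
    using that unfolding Q by (simp add: T_def W_def)
  have baseW: "base \<in> W" using d by (simp add: base_def W_def)
  have I0: "0 \<in> I" using d by (simp add: I_def)
  have convQ: "convex (chart_img c)"
  proof -
    have "chart_img c = (\<Inter>\<alpha>. {w. \<bar>w $ \<alpha> - (if \<alpha> = t then 0 else z0 $ \<alpha>)\<bar> < d})"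
      unfolding img by (rule centred_box_eq)
    moreover have "convex {w :: real ^ 'n. \<bar>w $ \<alpha> - r\<bar> < d}" for \<alpha> r
    proof -
      have "{w :: real ^ 'n. \<bar>w $ \<alpha> - r\<bar> < d} = (\<lambda>w. w $ \<alpha>) -` {r - d <..< r + d}" by auto
      moreover have "linear (\<lambda>w :: real ^ 'n. w $ \<alpha>)"
        by (intro bounded_linear.linear bounded_linear_vec_nth)
      ultimately show ?thesis by (simp add: convex_linear_vimage convex_real_interval)
    qed
    ultimately show ?thesis by (simp add: convex_INT)
  qed
  have oW: "open W"
  proof -
    have "W = (\<Inter>\<alpha>. {w. \<alpha> \<noteq> t \<longrightarrow> \<bar>w $ \<alpha> - z0 $ \<alpha>\<bar> < d})" by (simp add: W_def Collect_all_eq)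
    moreover have "open {w :: real ^ 'n. \<alpha> \<noteq> t \<longrightarrow> \<bar>w $ \<alpha> - z0 $ \<alpha>\<bar> < d}" for \<alpha>
      by (cases "\<alpha> = t") (auto intro!: open_Collect_less continuous_intros)
    ultimately show ?thesis by (auto intro!: open_INT)
  qed
  obtain a :: 'n where a: "a \<noteq> t"
  proof -
    have "card (UNIV - {t}) \<noteq> 0" using dim by simp
    then have "UNIV - {t} \<noteq> {}" by (metis card.empty)
    then show thesis using that by blast
  qed
  have pos: "v \<bullet> (g c x *v v) > 0" if x: "x \<in> D" and v: "v \<noteq> 0" "v $ t = 0" for v x
  proof (rule lorentzian_signature_spacelike[OF sig[OF x], of "axis t 1"])
    have row: "(g c x *v y) $ t = - y $ t" for y
    proof -
      have "(g c x *v y) $ t = (\<Sum>j\<in>UNIV. (- \<delta> t j) * y $ j)"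
        unfolding matrix_vector_mult_def using Gt[OF x] G_sym[OF x, of t] by simp
      then show ?thesis by (simp only: mult_minus_left sum_negf sum_delta_mult)
    qed
    have ax: "axis t 1 \<bullet> y = y $ t" for y :: "real ^ 'n" by (simp add: inner_axis')
    show "axis t 1 \<bullet> (g c x *v axis t 1) = -1" unfolding ax row by (simp add: axis_def)
    show "axis t 1 \<bullet> (g c x *v v) = 0" unfolding ax row v(2) by simp
  qed (rule v(1))
  have Gaa: "G a a x > 0" if "x \<in> D" for x
  proof -
    have "axis a 1 \<noteq> (0 :: real ^ 'n)" "axis a (1 :: real) $ t = 0"
      using a by (simp add: axis_eq_0_iff) (use a in \<open>simp add: axis_def\<close>)
    from pos[OF that this] show ?thesis
      by (simp add: inner_axis' matrix_vector_mult_basis column_def)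
  qed
  \<comment> \<open>A spatial diagonal entry along the central time line solves the same scalar
    equation as all the others. Its normalized root serves as the warping factor, and
    \<open>h\<close> is then the metric on the slice t = 0.\<close>
  define k where "k s = G a a (chart_inv c (T s base))" for s
  have kpos: "k s > 0" if "s \<in> I" for s
    unfolding k_def by (rule Gaa[OF chart_inv_in[OF TQ[OF baseW that]]])
  define q where "q s = sqrt (k s * inverse (k 0))" for s
  have Tlin: "T s w = T 0 w + s *\<^sub>R axis t 1" for s w
    by (simp add: T_def vec_eq_iff axis_def)
  have T0lin: "bounded_linear (T 0)"
    unfolding linear_conv_bounded_linear[symmetric] by (intro linearI) (auto simp: T_def vec_eq_iff)
  have oI: "open I" by (simp add: I_def)
  have sk: "smooth_on k I"
  proof -
    have "smooth_on (\<lambda>s. T 0 base + s *\<^sub>R axis t 1) I"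
      by (rule smooth_on_add[OF oI smooth_on_const smooth_on_bounded_linear[OF bounded_linear_scaleR_left]])
    then have "smooth_on (\<lambda>s. T s base) I" by (simp flip: Tlin)
    then show ?thesis
      unfolding k_def[abs_def]
      by (rule smooth_on_compose[OF oI open_img _ _ sm_G[of a a, unfolded smooth_in_chart_def o_def], rotated])
        (rule image_subsetI, rule TQ[OF baseW])
  qed
  have sq: "smooth_on q I"
    unfolding q_def[abs_def]
    by (rule smooth_on_sqrt[OF oI smooth_on_mult[OF oI sk smooth_on_const]]) (simp add: kpos I0)
  define h where "h w = g c (chart_inv c (T 0 w))" for w
  have sh: "smooth_on h W"
    unfolding h_def[abs_def]
    by (rule smooth_on_compose[OF oW open_img _ smooth_on_bounded_linear[OF T0lin]
          smooth_g[unfolded smooth_in_chart_def o_def]])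
      (rule image_subsetI, rule TQ[OF _ I0])
  have T_id: "T (w $ t) w = w" for w by (simp add: T_def vec_eq_iff)
  have evolve: "G \<alpha> \<beta> (chart_inv c w) = (q (w $ t))\<^sup>2 * h w $ \<alpha> $ \<beta>"
    if w: "w \<in> chart_img c" and ab: "\<alpha> \<noteq> t" "\<beta> \<noteq> t" for w \<alpha> \<beta>
  proof -
    have wW: "w \<in> W" "w $ t \<in> I" using w unfolding Q by auto
    have line: "((\<lambda>s. G i j (chart_inv c (T s y))) has_real_derivative 2 * \<phi> (chart_inv c (T s y)) * G i j (chart_inv c (T s y))) (at s)"
      if y: "y \<in> W" and s: "s \<in> I" and ij: "i \<noteq> t" "j \<noteq> t" for i j y s
    proof -
      let ?x = "chart_inv c (T s y)"
      note in_img = TQ[OF y s]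
      have "((\<lambda>z. G i j (chart_inv c z)) has_derivative frechet_derivative (G i j \<circ> chart_inv c) (at (T 0 y + s *\<^sub>R axis t 1))) (at (T 0 y + s *\<^sub>R axis t 1))"
        using has_derivative_in_chart[OF sm_G[of i j] chart_inv_in[OF in_img]] chart_map_inv[OF in_img] by (simp flip: Tlin)
      from has_real_derivative_along_line[OF this]
      have "((\<lambda>s. G i j (chart_inv c (T s y))) has_real_derivative frechet_derivative (G i j \<circ> chart_inv c) (at (T s y)) (axis t 1)) (at s)"
        by (simp flip: Tlin)
      moreover have "frechet_derivative (G i j \<circ> chart_inv c) (at (T s y)) (axis t 1) = pd c t (G i j) ?x"
        by (rule pd_at_inv[OF in_img, symmetric])
      ultimately show ?thesis using pdt[OF chart_inv_in[OF in_img] ij] by simp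
    qed
    \<comment> \<open>The two time lines pass through points that differ only in spatial
      coordinates, in which \<phi> does not vary; convexity of the box supplies the segment between
      them.\<close>
    have \<phi>eq: "\<phi> (chart_inv c (T s w)) = \<phi> (chart_inv c (T s base))" if s: "s \<in> I" for s
    proof (rule constant_if_pd_zero[OF sm_\<phi> convQ TQ[OF baseW s] TQ[OF wW(1) s]])
      show "pd c i \<phi> x = 0" if "x \<in> D" "T s base $ i \<noteq> T s w $ i" for x i
        using that pd\<phi>[of x i] by (cases "i = t") (simp_all add: T_def)
    qed
    \<comment> \<open>Numerator and denominator have the same logarithmic derivative 2 \<phi>, so
      the quotient is constant in time; this replaces solving the differential equation.\<close>
    let ?f = "\<lambda>s. G \<alpha> \<beta> (chart_inv c (T s w)) / k s"
    have "?f (w $ t) = ?f 0"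
    proof (rule has_derivative_zero_unique[of I ?f])
      fix s assume s: "s \<in> I"
      have "(?f has_real_derivative 0) (at s)"
        using DERIV_divide[OF line[OF wW(1) s ab] line[OF baseW s a a]] kpos[OF s] \<phi>eq[OF s]
        by (simp add: k_def)
      then show "(?f has_derivative (\<lambda>h. 0)) (at s within I)"
        by (simp add: has_field_derivative_def lambda_zero has_derivative_at_withinI)
    qed (use wW I0 in \<open>auto simp: I_def\<close>)
    then have "G \<alpha> \<beta> (chart_inv c w) / k (w $ t) = h w $ \<alpha> $ \<beta> / k 0"
      by (simp add: T_id h_def)
    then have "G \<alpha> \<beta> (chart_inv c w) = k (w $ t) * inverse (k 0) * h w $ \<alpha> $ \<beta>"
      using kpos[OF wW(2)] kpos[OF I0] by (simp add: field_simps)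
    moreover have "(q (w $ t))\<^sup>2 = k (w $ t) * inverse (k 0)"
      unfolding q_def using kpos[OF wW(2)] kpos[OF I0] by simp
    ultimately show ?thesis by simp
  qed
  show ?thesis
    unfolding warped_chart_def
  proof (intro exI conjI)
    show "open I" by (rule oI)
    show "is_interval I" by (simp add: I_def is_interval_oo)
    show "open W" by (rule oW)
    show "\<forall>y z. (\<forall>\<alpha>. \<alpha> \<noteq> t \<longrightarrow> y $ \<alpha> = z $ \<alpha>) \<longrightarrow> (y \<in> W \<longleftrightarrow> z \<in> W) \<and> h y = h z"
    proof (intro allI impI)
      fix y z :: "real ^ 'n" assume yz: "\<forall>\<alpha>. \<alpha> \<noteq> t \<longrightarrow> y $ \<alpha> = z $ \<alpha>"
      then have "T 0 y = T 0 z" by (simp add: T_def vec_eq_iff)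
      then show "(y \<in> W \<longleftrightarrow> z \<in> W) \<and> h y = h z" using yz by (simp add: W_def h_def)
    qed
    show "chart_img c = {z \<in> W. z $ t \<in> I}" by (rule Q)
    show "smooth_on q I" by (rule sq)
    show "\<forall>s\<in>I. q s > 0" unfolding q_def using kpos I0 by simp
    show "smooth_on h W" by (rule sh)
    show "\<forall>z\<in>W. transpose (h z) = h z \<and> (\<forall>v. v \<noteq> 0 \<and> v $ t = 0 \<longrightarrow> v \<bullet> (h z *v v) > 0)"
      unfolding h_def using sym_g[OF chart_inv_in[OF TQ[OF _ I0]]] pos[OF chart_inv_in[OF TQ[OF _ I0]]] by simp
    show "\<forall>x\<in>D. let z = chart_map c x in g c x $ t $ t = -1 \<and>
        (\<forall>\<alpha>. \<alpha> \<noteq> t \<longrightarrow> g c x $ t $ \<alpha> = 0 \<and> g c x $ \<alpha> $ t = 0) \<and>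
        (\<forall>\<alpha> \<beta>. \<alpha> \<noteq> t \<and> \<beta> \<noteq> t \<longrightarrow> g c x $ \<alpha> $ \<beta> = (q (z $ t))\<^sup>2 * h z $ \<alpha> $ \<beta>)"
    proof (rule ballI, unfold Let_def, intro conjI allI impI)
      fix x assume x: "x \<in> D"
      show "g c x $ t $ t = -1" using Gt[OF x, of t] by simp
      show "g c x $ \<alpha> $ t = 0" "g c x $ t $ \<alpha> = 0" if "\<alpha> \<noteq> t" for \<alpha>
        using Gt[OF x, of \<alpha>] G_sym[OF x, of t \<alpha>] that by auto
      fix \<alpha> \<beta> assume "\<alpha> \<noteq> t \<and> \<beta> \<noteq> t"
      then show "g c x $ \<alpha> $ \<beta> = (q (chart_map c x $ t))\<^sup>2 * h (chart_map c x) $ \<alpha> $ \<beta>"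
        using evolve[OF chart_map_in[OF x], of \<alpha> \<beta>] chart_inv_map[OF x] by simp
    qed
  qed
qed

section \<open>Proof of the theorem\<close>

text \<open>Since \<open>f\<close> is differentiable relative to the range of \<open>\<mu>\<close>, the chain rule applies to
  \<open>p = f \<circ> \<mu>\<close> even where that range is not a neighbourhood of the value of \<open>\<mu>\<close>.\<close>

lemma (in chart_calculus) equation_of_state_proportional:
  assumes p: "sm p" and \<mu>: "sm \<mu>" and f: "f differentiable_on (\<mu> ` topspace X)"
    and eq: "\<forall>x\<in>topspace X. p x = f (\<mu> x)" and x: "x \<in> D"
  shows "\<exists>b. \<forall>i. pd c i p x = b * pd c i \<mu> x"
proof -
  have DX: "D \<subseteq> topspace X" using chart openin_subset unfolding is_chart_def by blast
  let ?z = "chart_map c x" and ?m = "\<lambda>z. \<mu> (chart_inv c z)"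
  let ?M = "frechet_derivative (\<mu> \<circ> chart_inv c) (at ?z)"
  have m: "(?m has_derivative ?M) (at ?z within chart_img c)"
    using has_derivative_in_chart[OF \<mu> x] by (rule has_derivative_at_withinI)
  have mz: "?m ?z = \<mu> x" using chart_inv_map[OF x] by simp
  obtain F where F: "(f has_derivative F) (at (\<mu> x) within \<mu> ` topspace X)"
    using f x DX unfolding differentiable_on_def differentiable_def by blast
  have sub: "?m ` chart_img c \<subseteq> \<mu> ` topspace X" using chart_inv_in DX by blast
  have "((f \<circ> ?m) has_derivative (F \<circ> ?M)) (at ?z within chart_img c)"
    by (rule diff_chain_within[OF m]) (unfold mz, rule has_derivative_subset[OF F sub])
  then have "((f \<circ> ?m) has_derivative (F \<circ> ?M)) (at ?z)"
    using at_within_open[OF chart_map_in[OF x] open_img] by simp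
  then have "((\<lambda>z. p (chart_inv c z)) has_derivative (F \<circ> ?M)) (at ?z)"
  proof (rule has_derivative_transform_within_open[OF _ open_img chart_map_in[OF x]])
    show "(f \<circ> ?m) z = p (chart_inv c z)" if "z \<in> chart_img c" for z
      using eq chart_inv_in[OF that] DX by (simp add: subset_iff)
  qed
  then have pd_p: "pd c i p x = F (?M (axis i 1))" for i
    using pd_eqI[of p "F \<circ> ?M"] by simp
  have "pd c i p x = F 1 * pd c i \<mu> x" for i
  proof -
    have "F (?M (axis i 1)) = ?M (axis i 1) * F 1"
      using linear_scale[OF has_derivative_linear[OF F], of "?M (axis i 1)" 1] by simp
    then show ?thesis unfolding pd_p pd_def[of c i \<mu>] by (simp only: mult.commute)
  qed
  then show ?thesis by blast
qed

text \<open>The torse-forming equation makes u closed, so the Poincare lemma applies. The sign is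
  chosen so that T increases at unit rate along u, whose square is -1.\<close>

lemma (in fluid_chart) local_cosmic_time:
  assumes r: "r > 0" "ball z0 r \<subseteq> chart_img c"
  shows "\<exists>T. smooth_on T (ball z0 r) \<and> T z0 = 0 \<and>
    (\<forall>z\<in>ball z0 r. (T has_derivative (\<lambda>v. (- flat g u c (chart_inv c z)) \<bullet> v)) (at z))"
proof -
  let ?B = "ball z0 r"
  define \<omega> where "\<omega> = (\<lambda>z. - flat g u c (chart_inv c z))"
  have s\<omega>j: "smooth_on (\<lambda>z. \<omega> z $ j) ?B" for j
    using smooth_on_subset[OF sm_minus[OF sm_U[of j], unfolded smooth_in_chart_def] r(2)] by (simp add: \<omega>_def o_def)
  have s\<omega>: "smooth_on \<omega> ?B"
  proof -
    have "smooth_on (\<lambda>z. \<chi> j. \<omega> z $ j) ?B" by (rule smooth_on_vec_lambda[OF open_ball s\<omega>j])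
    then show ?thesis by simp
  qed
  have closed: "frechet_derivative \<omega> (at z) v \<bullet> w = frechet_derivative \<omega> (at z) w \<bullet> v" if z: "z \<in> ?B" for z v w
  proof -
    have zi: "z \<in> chart_img c" using z r(2) by blast
    let ?x = "chart_inv c z"
    have D\<omega>: "frechet_derivative \<omega> (at z) v $ j = - (\<Sum>i\<in>UNIV. v $ i * pd c i (U j) ?x)" for v j
    proof -
      have "((\<lambda>z. \<omega> z $ j) has_derivative (\<lambda>v. frechet_derivative \<omega> (at z) v $ j)) (at z)"
        by (rule bounded_linear.has_derivative[OF bounded_linear_vec_nth smooth_on_has_derivative[OF s\<omega> z]])
      moreover have "((\<lambda>z. \<omega> z $ j) has_derivative (\<lambda>v. - frechet_derivative (U j \<circ> chart_inv c) (at z) v)) (at z)"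
        using has_derivative_minus[OF has_derivative_in_chart[OF sm_U[of j] chart_inv_in[OF zi]]]
        unfolding chart_map_inv[OF zi] \<omega>_def by simp
      ultimately have "(\<lambda>v. frechet_derivative \<omega> (at z) v $ j) = (\<lambda>v. - frechet_derivative (U j \<circ> chart_inv c) (at z) v)"
        by (rule has_derivative_unique)
      from fun_cong[OF this, of v] show ?thesis
        using directional_derivative[OF sm_U[of j] chart_inv_in[OF zi], of v] unfolding chart_map_inv[OF zi] by simp
    qed
    have eq: "frechet_derivative \<omega> (at z) v \<bullet> w = - (\<Sum>j\<in>UNIV. \<Sum>i\<in>UNIV. v $ i * w $ j * pd c i (U j) ?x)" for v w
    proof -
      have "frechet_derivative \<omega> (at z) v \<bullet> w = (\<Sum>j\<in>UNIV. - (\<Sum>i\<in>UNIV. v $ i * pd c i (U j) ?x) * w $ j)"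
        unfolding inner_vec_def D\<omega> by (simp only: inner_real_def)
      also have "\<dots> = (\<Sum>j\<in>UNIV. - (\<Sum>i\<in>UNIV. v $ i * w $ j * pd c i (U j) ?x))"
      proof (rule sum.cong[OF refl])
        fix j
        show "- (\<Sum>i\<in>UNIV. v $ i * pd c i (U j) ?x) * w $ j = - (\<Sum>i\<in>UNIV. v $ i * w $ j * pd c i (U j) ?x)"
          unfolding mult_minus_left sum_distrib_right by (simp only: mult.assoc mult.left_commute mult.commute)
      qed
      finally show ?thesis by (simp only: sum_negf)
    qed
    have "(\<Sum>j\<in>UNIV. \<Sum>i\<in>UNIV. v $ i * w $ j * pd c i (U j) ?x) = (\<Sum>j\<in>UNIV. \<Sum>i\<in>UNIV. w $ i * v $ j * pd c i (U j) ?x)"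
    proof -
      have "v $ i * w $ j * pd c i (U j) ?x = w $ j * v $ i * pd c j (U i) ?x" for i j
        using U_closed[OF chart_inv_in[OF zi], of i j] by simp
      then show ?thesis by (subst sum.swap) (simp only:)
    qed
    then show ?thesis unfolding eq by simp
  qed
  show ?thesis
  proof (rule poincare_lemma[OF s\<omega> r(1) closed])
    fix T assume "smooth_on T ?B" "T z0 = 0" "\<And>z. z \<in> ?B \<Longrightarrow> (T has_derivative (\<bullet>) (\<omega> z)) (at z)"
    then show ?thesis unfolding \<omega>_def by blast
  qed
qed

text \<open>Straightening u together with its potential T gives two facts: the t-direction is sent
  to u, and differentiating \<open>T (\<Phi> w) = w $ t\<close> shows that minus the 1-form of u
  pulls back to dt. The second one removes the mixed metric entries later.\<close>

lemma (in fluid_chart) comoving_box: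
  assumes z0: "z0 \<in> chart_img c"
  shows "\<exists>t d \<Phi> \<Psi> E. d > 0 \<and> open E \<and> E \<subseteq> chart_img c \<and> z0 \<in> E \<and>
    homeomorphism {w. \<bar>w $ t\<bar> < d \<and> (\<forall>\<alpha>. \<alpha> \<noteq> t \<longrightarrow> \<bar>w $ \<alpha> - z0 $ \<alpha>\<bar> < d)} E \<Phi> \<Psi> \<and>
    smooth_on \<Phi> {w. \<bar>w $ t\<bar> < d \<and> (\<forall>\<alpha>. \<alpha> \<noteq> t \<longrightarrow> \<bar>w $ \<alpha> - z0 $ \<alpha>\<bar> < d)} \<and> smooth_on \<Psi> E \<and>
    (\<forall>w\<in>{w. \<bar>w $ t\<bar> < d \<and> (\<forall>\<alpha>. \<alpha> \<noteq> t \<longrightarrow> \<bar>w $ \<alpha> - z0 $ \<alpha>\<bar> < d)}.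
      frechet_derivative \<Phi> (at w) (axis t 1) = u c (chart_inv c (\<Phi> w)) \<and>
      (\<forall>v. (- flat g u c (chart_inv c (\<Phi> w))) \<bullet> frechet_derivative \<Phi> (at w) v = v $ t))"
proof -
  obtain r where r: "r > 0" "ball z0 r \<subseteq> chart_img c"
    using open_img z0 open_contains_ball by blast
  let ?B = "ball z0 r"
  obtain T where T: "smooth_on T ?B" "T z0 = 0"
    and DT: "\<forall>z\<in>?B. (T has_derivative (\<lambda>v. (- flat g u c (chart_inv c z)) \<bullet> v)) (at z)"
    using local_cosmic_time[OF r] by auto
  define V' where "V' = (\<lambda>z. u c (chart_inv c z))"
  have sV: "smooth_on V' ?B"
    using smooth_on_subset[OF smooth_u[unfolded smooth_in_chart_def] r(2)] by (simp add: V'_def o_def)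
  have V\<omega>: "(- flat g u c (chart_inv c z)) \<bullet> V' z = 1" if "z \<in> chart_img c" for z
    using unit_u[OF chart_inv_in[OF that]] by (simp add: V'_def inner_vec_def mult.commute sum_negf)
  have "\<exists>t. V' z0 $ t \<noteq> 0"
  proof (rule ccontr)
    assume "\<not> ?thesis"
    then have "V' z0 = 0" by (simp add: vec_eq_iff)
    then show False using V\<omega>[OF z0] by simp
  qed
  \<comment> \<open>The index t is not fixed beforehand: any coordinate direction transversal to u
    at z0 will do, and its hyperplane carries the initial points of the flow.\<close>
  then obtain t where t: "V' z0 $ t \<noteq> 0" ..
  have TV: "frechet_derivative T (at z) (V' z) = 1" if z: "z \<in> ?B" for z
  proof -
    have zi: "z \<in> chart_img c" using z r(2) by blast
    show ?thesis
      unfolding frechet_derivative_at[OF bspec[OF DT z], symmetric] by (rule V\<omega>[OF zi])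
  qed
  have z0B: "z0 \<in> ?B" using r(1) by simp
  show ?thesis
  proof (rule straightening[OF open_ball z0B sV t T TV])
    fix d \<Phi> \<Psi> E
    let ?Q = "{w. \<bar>w $ t\<bar> < d \<and> (\<forall>\<alpha>. \<alpha> \<noteq> t \<longrightarrow> \<bar>w $ \<alpha> - z0 $ \<alpha>\<bar> < d)}"
    assume S: "d > 0" "open E" "E \<subseteq> ?B" "z0 \<in> E" "homeomorphism ?Q E \<Phi> \<Psi>" "smooth_on \<Phi> ?Q" "smooth_on \<Psi> E"
      and flow: "\<And>w. \<bar>w $ t\<bar> < d \<Longrightarrow> (\<forall>\<alpha>. \<alpha> \<noteq> t \<longrightarrow> \<bar>w $ \<alpha> - z0 $ \<alpha>\<bar> < d) \<Longrightarrow>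
        frechet_derivative \<Phi> (at w) (axis t 1) = V' (\<Phi> w) \<and> T (\<Phi> w) = w $ t"
    have flow': "frechet_derivative \<Phi> (at w) (axis t 1) = V' (\<Phi> w)" "T (\<Phi> w) = w $ t" if "w \<in> ?Q" for w
      using flow[of w] that by simp_all
    have oQ: "open ?Q"
    proof -
      have "open {w :: real ^ 'n. \<bar>w $ \<alpha> - (if \<alpha> = t then 0 else z0 $ \<alpha>)\<bar> < d}" for \<alpha>
        by (intro open_Collect_less continuous_intros)
      then show ?thesis unfolding centred_box_eq by (intro open_INT) simp_all
    qed
    have "(- flat g u c (chart_inv c (\<Phi> w))) \<bullet> frechet_derivative \<Phi> (at w) v = v $ t" if w: "w \<in> ?Q" for w v
    proof -
      have "\<Phi> w \<in> ?B" using S(3,5) w by (auto simp only: homeomorphism_def)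
      from has_derivative_compose[OF smooth_on_has_derivative[OF S(6) w] bspec[OF DT this]]
      have "((\<lambda>w. w $ t) has_derivative (\<lambda>v. (- flat g u c (chart_inv c (\<Phi> w))) \<bullet> frechet_derivative \<Phi> (at w) v)) (at w)"
        by (rule has_derivative_transform_within_open[OF _ oQ w]) (rule flow'(2))
      from has_derivative_unique[OF this bounded_linear_imp_has_derivative[OF bounded_linear_vec_nth]]
      show ?thesis by (rule fun_cong)
    qed
    moreover have "E \<subseteq> chart_img c" using S(3) r(2) by (rule subset_trans)
    moreover have "frechet_derivative \<Phi> (at w) (axis t 1) = u c (chart_inv c (\<Phi> w))" if "w \<in> ?Q" for w
      using flow'(1)[OF that] by (simp only: V'_def)
    ultimately show ?thesis
      using S(1,2,4-7)
      by (intro exI[of _ t] exI[of _ d] exI[of _ \<Phi>] exI[of _ \<Psi>] exI[of _ E] conjI ballI allI) assumption+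
  qed
qed

theorem proposition3p1:
  fixes X :: "'a topology"
    and A :: "('a, 'n::finite) chart set"
    and g :: "('a, 'n) bilinear_field"
    and u :: "('a, 'n) vector_field"
    and p \<mu> :: "'a \<Rightarrow> real"
    and \<kappa> :: real
  assumes dim: "CARD('n) \<ge> 4"
    and kappa: "\<kappa> > 0"
    and fluid: "perfect_fluid_spacetime X A g \<kappa> u p \<mu>"
    and state: "\<exists>f. f differentiable_on (\<mu> ` topspace X) \<and> (\<forall>x\<in>topspace X. p x = f (\<mu> x))"
    and nonzero: "\<forall>x\<in>topspace X. p x + \<mu> x \<noteq> 0"
    and div_weyl: "\<forall>c\<in>charts X A. \<forall>x\<in>chart_dom c. \<forall>j k l.
                     (\<Sum>m\<in>UNIV. nabla_weyl_up g c m j k l m x) = 0"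
  shows "generalized_robertson_walker X A g \<and>
         (\<forall>c\<in>charts X A. \<forall>x\<in>chart_dom c.
            (\<forall>k l. nabla_form g c (flat g u) k l x - nabla_form g c (flat g u) l k x = 0) \<and>
            (\<forall>j. (\<Sum>k\<in>UNIV. u c x $ k * nabla_form g c (flat g u) k j x) = 0) \<and>
            (\<forall>j k l. (\<Sum>m\<in>UNIV. weyl_up g c j k l m x * flat g u c x $ m) = 0))"
proof -
  have lor: "lorentzian_manifold X A g" and vec: "smooth_vector_field X A u"
    and sp: "smooth_scalar_field X A p" and s\<mu>: "smooth_scalar_field X A \<mu>"
    and ein: "\<And>c x. c \<in> charts X A \<Longrightarrow> x \<in> chart_dom c \<Longrightarrow>
        (\<Sum>j\<in>UNIV. u c x $ j * flat g u c x $ j) = -1 \<and>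
        (\<forall>i j. ricci g c i j x - 1/2 * scalar_curvature g c x * g c x $ i $ j
               = \<kappa> * fluid_stress g u p \<mu> c i j x)"
    using fluid unfolding perfect_fluid_spacetime_def by blast+
  have man: "smooth_manifold X A"
    and gc: "\<And>c. c \<in> charts X A \<Longrightarrow> smooth_in_chart c (g c)"
    and gs: "\<And>c x. c \<in> charts X A \<Longrightarrow> x \<in> chart_dom c \<Longrightarrow> transpose (g c x) = g c x"
    and sig: "\<And>c x. c \<in> charts X A \<Longrightarrow> x \<in> chart_dom c \<Longrightarrow> lorentzian_signature (g c x)"
    and gt: "\<And>c d x. c \<in> charts X A \<Longrightarrow> d \<in> charts X A \<Longrightarrow> x \<in> chart_dom c \<inter> chart_dom d \<Longrightarrow>
        g c x = transpose (jacobian c d x) ** g d x ** jacobian c d x"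
    using lor unfolding lorentzian_manifold_def by blast+
  have uc: "\<And>c. c \<in> charts X A \<Longrightarrow> smooth_in_chart c (u c)"
    and ut: "\<And>c d x. c \<in> charts X A \<Longrightarrow> d \<in> charts X A \<Longrightarrow> x \<in> chart_dom c \<inter> chart_dom d \<Longrightarrow>
        u d x = jacobian c d x *v u c x"
    using vec unfolding smooth_vector_field_def by blast+
  have chart: "\<And>c. c \<in> charts X A \<Longrightarrow> is_chart X c" by (simp add: charts_def)
  have atlas: "\<And>a. a \<in> A \<Longrightarrow> is_chart X a" "(\<Union>c\<in>A. chart_dom c) = topspace X" "\<And>a b. a \<in> A \<Longrightarrow> b \<in> A \<Longrightarrow> compatible a b"
    using man unfolding smooth_manifold_def smooth_atlas_def by blast+
  obtain f where f: "f differentiable_on (\<mu> ` topspace X)" "\<forall>x\<in>topspace X. p x = f (\<mu> x)"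
    using state by blast
  \<comment> \<open>Stated for every chart of the maximal atlas: it is needed for the original
    chart, for the comoving chart built from it, and for the final pointwise claims.\<close>
  have fl: "fluid_chart X c g u \<kappa> p \<mu>" if c: "c \<in> charts X A" for c
  proof -
    interpret C: chart_calculus X c by unfold_locales (rule chart[OF c])
    have DX: "chart_dom c \<subseteq> topspace X"
      using chart[OF c] openin_subset unfolding is_chart_def by blast
    have sm: "smooth_in_chart c p" "smooth_in_chart c \<mu>"
      using sp s\<mu> c by (simp_all add: smooth_scalar_field_def)
    show ?thesis
    proof unfold_locales
      show "smooth_in_chart c (g c)" "smooth_in_chart c (u c)" "smooth_in_chart c p" "smooth_in_chart c \<mu>"
        using gc[OF c] uc[OF c] sm by simp_all
      show "4 \<le> CARD('n)" "\<kappa> \<noteq> 0" using dim kappa by simp_all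
      fix x assume x: "x \<in> chart_dom c"
      show "transpose (g c x) = g c x" by (rule gs[OF c x])
      show "invertible (g c x)" by (rule lorentzian_signature_invertible[OF sig[OF c x]])
      show "(\<Sum>j\<in>UNIV. u c x $ j * flat g u c x $ j) = -1" using ein[OF c x] by blast
      show "ricci g c i j x - 1/2 * scalar_curvature g c x * g c x $ i $ j = \<kappa> * fluid_stress g u p \<mu> c i j x" for i j
        using ein[OF c x] by blast
      show "\<exists>b. \<forall>i. pd c i p x = b * pd c i \<mu> x"
        by (rule C.equation_of_state_proportional[OF sm f x])
      show "p x + \<mu> x \<noteq> 0" using nonzero x DX by blast
      show "(\<Sum>m\<in>UNIV. nabla_weyl_up g c m j k l m x) = 0" for j k l
        using div_weyl c x by blast
    qed
  qed
  have "\<exists>e\<in>charts X A. x0 \<in> chart_dom e \<and> warped_chart g e" if "x0 \<in> topspace X" for x0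
  proof -
    have "x0 \<in> (\<Union>c\<in>A. chart_dom c)" using that atlas(2) by simp
    then obtain c where cA: "c \<in> A" and x0: "x0 \<in> chart_dom c" by blast
    have c: "c \<in> charts X A" using cA atlas by (simp add: charts_def)
    interpret fluid_chart X c g u \<kappa> p \<mu> by (rule fl[OF c])
    define z0 where "z0 = chart_map c x0"
    have z0: "z0 \<in> chart_img c" using chart_map_in[OF x0] by (simp add: z0_def)
    obtain t d \<Phi> \<Psi> E where S: "d > 0" "open E" "E \<subseteq> chart_img c" "z0 \<in> E"
      "homeomorphism {w. \<bar>w $ t\<bar> < d \<and> (\<forall>\<alpha>. \<alpha> \<noteq> t \<longrightarrow> \<bar>w $ \<alpha> - z0 $ \<alpha>\<bar> < d)} E \<Phi> \<Psi>" "smooth_on \<Phi> {w. \<bar>w $ t\<bar> < d \<and> (\<forall>\<alpha>. \<alpha> \<noteq> t \<longrightarrow> \<bar>w $ \<alpha> - z0 $ \<alpha>\<bar> < d)}" "smooth_on \<Psi> E"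
      "\<forall>w\<in>{w. \<bar>w $ t\<bar> < d \<and> (\<forall>\<alpha>. \<alpha> \<noteq> t \<longrightarrow> \<bar>w $ \<alpha> - z0 $ \<alpha>\<bar> < d)}. frechet_derivative \<Phi> (at w) (axis t 1) = u c (chart_inv c (\<Phi> w)) \<and>
         (\<forall>v. (- flat g u c (chart_inv c (\<Phi> w))) \<bullet> frechet_derivative \<Phi> (at w) v = v $ t)"
      using comoving_box[OF z0] by (elim exE conjE)
    define Q where "Q = {w. \<bar>w $ t\<bar> < d \<and> (\<forall>\<alpha>. \<alpha> \<noteq> t \<longrightarrow> \<bar>w $ \<alpha> - z0 $ \<alpha>\<bar> < d)}"
    note hom = S(5)[folded Q_def] and s\<Phi> = S(6)[folded Q_def]
    have \<Phi>t: "frechet_derivative \<Phi> (at w) (axis t 1) = u c (chart_inv c (\<Phi> w))"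
      "(- flat g u c (chart_inv c (\<Phi> w))) \<bullet> frechet_derivative \<Phi> (at w) v = v $ t" if "w \<in> Q" for w v
      using bspec[OF S(8)[folded Q_def] that] by blast+
    have h: "\<And>w. w \<in> Q \<Longrightarrow> \<Psi> (\<Phi> w) = w" "\<And>y. y \<in> E \<Longrightarrow> \<Phi> (\<Psi> y) = y" "\<Phi> ` Q = E" "\<Psi> ` E = Q"
      using hom by (auto simp: homeomorphism_def)
    have oQ: "open Q"
    proof -
      have "open {w :: real ^ 'n. \<bar>w $ \<alpha> - (if \<alpha> = t then 0 else z0 $ \<alpha>)\<bar> < d}" for \<alpha>
        by (intro open_Collect_less continuous_intros)
      then show ?thesis unfolding Q_def centred_box_eq by (intro open_INT) simp_all
    qed
    note Eimg = S(3)
    \<comment> \<open>The comoving chart: the old coordinates restricted to the straightened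
      neighbourhood and followed by the inverse of the flow map.\<close>
    define e where "e = ({x \<in> chart_dom c. chart_map c x \<in> E}, \<lambda>x. \<Psi> (chart_map c x))"
    have rep: "e \<in> charts X A" "chart_img e = Q" "\<And>w. w \<in> Q \<Longrightarrow> chart_inv e w = chart_inv c (\<Phi> w)"
      using chart_reparametrization[OF c atlas(1) S(2) Eimg oQ hom s\<Phi> S(7), folded e_def] by simp_all
    have e: "e \<in> charts X A" by (rule rep(1))
    interpret E: fluid_chart X e g u \<kappa> p \<mu> by (rule fl[OF e])
    have dom: "x \<in> chart_dom c" "chart_map c x \<in> E" "chart_map e x = \<Psi> (chart_map c x)" "\<Psi> (chart_map c x) \<in> Q"
      if "x \<in> chart_dom e" for x
      using that h(4) by (auto simp: e_def)
    have d\<Phi>: "(\<Phi> has_derivative frechet_derivative \<Phi> (at w)) (at w)" if "w \<in> Q" for w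
      by (rule smooth_on_has_derivative[OF s\<Phi> that])
    have J1: "jacobian e c x *v v = frechet_derivative \<Phi> (at (chart_map e x)) v" if x: "x \<in> chart_dom e" for x v
    proof (rule jacobian_mult[OF oQ])
      show w: "chart_map e x \<in> Q" using dom[OF x] by simp
      show "(\<Phi> has_derivative frechet_derivative \<Phi> (at (chart_map e x))) (at (chart_map e x))" by (rule d\<Phi>[OF w])
      fix w assume w: "w \<in> Q"
      then have "\<Phi> w \<in> chart_img c" using h(3) Eimg by blast
      then show "chart_map c (chart_inv e w) = \<Phi> w" unfolding rep(3)[OF w] by (rule chart_map_inv)
    qed
    have J2: "jacobian c e x *v v = frechet_derivative \<Psi> (at (chart_map c x)) v" if x: "x \<in> chart_dom e" for x v
    proof (rule jacobian_mult[OF S(2)])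
      show z: "chart_map c x \<in> E" using dom[OF x] by simp
      show "(\<Psi> has_derivative frechet_derivative \<Psi> (at (chart_map c x))) (at (chart_map c x))"
        by (rule smooth_on_has_derivative[OF S(7) z])
      fix z assume "z \<in> E"
      then show "chart_map e (chart_inv c z) = \<Psi> z" using Eimg chart_map_inv by (auto simp: e_def)
    qed
    \<comment> \<open>The vector law transports u by the derivative of \<Psi>, and u is already the
      image of the t-direction under the derivative of \<Phi>; the two derivatives are inverse to
      each other.\<close>
    have ue: "u e x = axis t 1" if x: "x \<in> chart_dom e" for x
    proof -
      let ?w = "chart_map e x"
      have w: "?w \<in> Q" "\<Phi> ?w = chart_map c x" using dom[OF x] h(2) by auto
      have d\<Psi>: "(\<Psi> has_derivative frechet_derivative \<Psi> (at (\<Phi> ?w))) (at (\<Phi> ?w))"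
        using smooth_on_has_derivative[OF S(7)] dom[OF x] w(2) by simp
      have "((\<lambda>w. w) has_derivative (\<lambda>v. frechet_derivative \<Psi> (at (\<Phi> ?w)) (frechet_derivative \<Phi> (at ?w) v))) (at ?w)"
        by (rule has_derivative_transform_within_open[OF has_derivative_compose[OF d\<Phi>[OF w(1)] d\<Psi>] oQ w(1)]) (simp add: h(1))
      from has_derivative_unique[OF this has_derivative_ident]
      have inv: "frechet_derivative \<Psi> (at (\<Phi> ?w)) (frechet_derivative \<Phi> (at ?w) v) = v" for v by metis
      have "u e x = frechet_derivative \<Psi> (at (chart_map c x)) (u c x)"
        unfolding J2[OF x, symmetric] using dom[OF x] x by (intro ut[OF c e]) simp
      also have "u c x = frechet_derivative \<Phi> (at ?w) (axis t 1)"
        using \<Phi>t(1)[OF w(1)] chart_inv_map[OF dom(1)[OF x]] by (simp add: w(2))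
      finally show ?thesis using inv by (simp add: w(2))
    qed
    \<comment> \<open>The transformation law of g makes the 1-form of u transform by the transposed
      Jacobian; testing against basis vectors reduces the claim to the pull-back property of
      \<Phi>.\<close>
    have fe: "flat g u e x = - axis t 1" if x: "x \<in> chart_dom e" for x
    proof -
      let ?w = "chart_map e x" and ?J = "jacobian e c x"
      have w: "?w \<in> Q" "\<Phi> ?w = chart_map c x" using dom[OF x] h(2) by auto
      have xx: "x \<in> chart_dom e \<inter> chart_dom c" using x dom[OF x] by simp
      have "flat g u e x = transpose ?J *v (g c x *v (?J *v u e x))"
        unfolding flat_def gt[OF e c xx] by (simp add: matrix_vector_mul_assoc matrix_mul_assoc)
      also have "?J *v u e x = u c x" by (rule ut[OF e c xx, symmetric])
      finally have fl: "flat g u e x = transpose ?J *v flat g u c x" by (simp add: flat_def)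
      have "flat g u e x $ i = - axis t 1 $ i" for i
      proof -
        have "flat g u e x $ i = axis i 1 \<bullet> (transpose ?J *v flat g u c x)"
          by (simp add: fl inner_axis')
        also have "\<dots> = (?J *v axis i 1) \<bullet> flat g u c x" by (rule dot_transpose)
        also have "\<dots> = frechet_derivative \<Phi> (at ?w) (axis i 1) \<bullet> flat g u c (chart_inv c (\<Phi> ?w))"
          unfolding J1[OF x] w(2) chart_inv_map[OF dom(1)[OF x]] ..
        also have "\<dots> = - (axis i 1 $ t)"
          using \<Phi>t(2)[OF w(1), of "axis i 1"] by (simp add: inner_commute)
        finally show ?thesis by (simp add: axis_def)
      qed
      then show ?thesis by (simp add: vec_eq_iff)
    qed
    have "warped_chart g e"
      by (rule E.warped_chart_comoving[OF S(1) rep(2)[unfolded Q_def] ue fe sig[OF e]])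
    moreover have "x0 \<in> chart_dom e" using x0 S(4) by (simp add: e_def z0_def)
    ultimately show ?thesis using e by blast
  qed
  then have "generalized_robertson_walker X A g"
    using lor by (simp add: generalized_robertson_walker_def)
  moreover have "(\<forall>k l. nabla_form g c (flat g u) k l x - nabla_form g c (flat g u) l k x = 0) \<and>
            (\<forall>j. (\<Sum>k\<in>UNIV. u c x $ k * nabla_form g c (flat g u) k j x) = 0) \<and>
            (\<forall>j k l. (\<Sum>m\<in>UNIV. weyl_up g c j k l m x * flat g u c x $ m) = 0)"
    if c: "c \<in> charts X A" and x: "x \<in> chart_dom c" for c x
  proof -
    interpret fluid_chart X c g u \<kappa> p \<mu> by (rule fl[OF c])
    show ?thesis using N_sym[OF x] geodesic[OF x] weyl_annihilates[OF x] by simp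
  qed
  ultimately show ?thesis by blast
qed

end
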